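(* Let $E_1\ge1$ be the extension constant and, for $i=1,\dots,n$, let $\mathbf u^{in}_\infty(\cdot;\mathbf e_i,w)\in H(Q_2)$, $\mathbf u^{out}_\infty(\cdot;\mathbf e_i,w)\in H(Q_1)$ be the limits of the series $\sum_{k\ge0}\mathbf u^{in}_{k+1}(\cdot;\mathbf e_i)w^{k+1}$ and $\sum_{k\ge0}\mathbf u^{out}_k(\cdot;\mathbf e_i)w^k$, which converge for $|w|<1/(2E_1^2)$, i.e. for $|z|>2E_1^2$ with $z=1/w$. Then: (1) $\mathbf u^{in}_\infty(\cdot;\mathbf e_i,0)=\mathbf 0$ in $Q_2$; (2) as $w\to0$, $\mathbf u^{out}_\infty(\cdot;\mathbf e_i,w)$ converges in the norm $\|\cdot\|_{Q_1}$ to $\mathbf u_D^i$, the solution of the classical cell problem, and $\mathbf u^{out}_\infty(\cdot;\mathbf e_i,0)=\mathbf u_D^i$; (3) there is a constant $C$ independent of $w$ such that for all $w\ne0$ with $|w|<1/(2E_1^2)$ and $1/w\notin(-\infty,0]$, $$|K_{ij}(1/w)-K^{(D)}_{ij}|\le C\,\frac{2E_1^2|w|}{1-2E_1^2|w|},$$ so $K_{ij}(1/w)-K^{(D)}_{ij}=O(|w|)$ and $K(z)\to K^{(D)}$ as $|z|\to\infty$.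
   Context: Let $n\in\{2,3\}$, $Q=(0,1)^n$, $Q_2$ a connected open set with $\overline{Q_2}\subset Q$ and $\partial Q_2$ of class $\mathcal C^{k,\sigma}$, $k+\sigma\ge2$; $Q_1=Q\setminus\overline{Q_2}$, $\Gamma=\partial Q_2$, $\mathbf n$ outward unit normal of $Q_2$, $\chi_m$ characteristic function of $Q_m$. Standing assumptions: $Q_1,Q_2$ have positive measure; the $Q$-periodic extensions of $Q_1,Q_2$ are open with $C^1$ boundary, locally on one side of their boundaries, the periodic extension of $Q_1$ is connected; $Q_1$ connected with Lipschitz boundary. $\mu_1>0$; functions complex-valued; $e(\mathbf u)=\frac12(\nabla\mathbf u+\nabla\mathbf u^T)$, $A:B=\sum A_{ij}B_{ij}$, $\mathbf e_1,\dots,\mathbf e_n$ standard basis. $\mathcal R(Q_2)$ = rigid displacements. $H(Q)$ = all $\mathbf v\in H^1(Q_1\cup Q_2)^n$, $\operatorname{div}\mathbf v=0$, $\mathbf v\cdot\mathbf n=0$ on $\Gamma$, no jump across $\Gamma$, $\mathbf v\perp_{H^1(Q_2)}\mathcal R(Q_2)$, $Q$-periodic; $H(Q_1)=\{\mathbf v\in H^1(Q_1)^n:\operatorname{div}\mathbf v=0,\mathbf v\cdot\mathbf n=0\text{ on }\Gamma,Q\text{-periodic}\}$, $\mathring H(Q_1)$ its subspace with $\mathbf v=0$ on $\Gamma$; $H(Q_2)=\{\mathbf v\in H^1(Q_2)^n:\operatorname{div}\mathbf v=0,\mathbf v\cdot\mathbf n=0\text{ on }\Gamma,\mathbf v\perp_{H^1(Q_2)}\mathcal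 R(Q_2)\}$; $\|\mathbf v\|_D^2=\int_D2\mu_1e(\mathbf v):\overline{e(\mathbf v)}$. $E_1\ge1$: constant depending only on $Q_1,Q_2$ such that a linear divergence-free $Q$-periodic extension operator $T_1:H(Q_2)\to H^1(Q)^n$ exists, vanishing outside a small neighbourhood of $\overline{Q_2}$, with $\|T_1\mathbf v\|_Q\le E_1\|\mathbf v\|_{Q_2}$. Coefficients for a unit vector $\mathbf e$ (weak solutions): $\mathbf u^{in}_0=\mathbf 0$; $\mathbf u^{out}_0\in\mathring H(Q_1)$ solves $\operatorname{div}(2\mu_1e(\mathbf u)-p^{out}_0\mathbf I)=-\mathbf e$ in $Q_1$, $\mathbf u=0$ on $\Gamma$; $\mathbf u^{in}_1\in H(Q_2)$ solves $\operatorname{div}(2\mu_1e(\mathbf u^{in}_1)-p^{in}_0\mathbf I)=-\mathbf e$ in $Q_2$ with $\mathbf n\times\mathbf n\times[((2\mu_1e(\mathbf u^{out}_0)-p^{out}_0\mathbf I)-(2\mu_1e(\mathbf u^{in}_1)-p^{in}_0\mathbf I))\mathbf n]=\mathbf 0$ on $\Gamma$; for $k\ge1$, $\mathbf u^{out}_k\in H(Q_1)$ solves $\operatorname{div}(2\mu_1e(\mathbf u^{out}_k)-p^{out}_k\mathbf I)=\mathbf 0$ in $Q_1$, $\mathbf u^{out}_k=\mathbf u^{in}_k$ on $\Gamma$, and $\mathbf u^{in}_{k+1}\in H(Q_2)$ solves $\operatorname{div}(2\mu_1e(\mathbf u^{in}_{k+1})-p^{in}_k\mathbf I)=\mathbf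 0$ in $Q_2$ with $\mathbf n\times\mathbf n\times[((2\mu_1e(\mathbf u^{out}_k)-p^{out}_k\mathbf I)-(2\mu_1e(\mathbf u^{in}_{k+1})-p^{in}_k\mathbf I))\mathbf n]=\mathbf 0$ on $\Gamma$. Self-permeability: for $z\in\mathbb C\setminus(-\infty,0]$, $\mathbf u^j(\cdot;z)\in H(Q)$ is the unique solution of $\int_Q2\mu(\mathbf y;z)e(\mathbf u^j):\overline{e(\mathbf v)}d\mathbf y=\int_Q\mathbf e_j\cdot\overline{\mathbf v}d\mathbf y$ for all $\mathbf v\in H(Q)$, with $\mu(\mathbf y;z)=\mu_1\chi_1+z\mu_1\chi_2$, and $K_{ij}(z)=\int_Q\mathbf u^j(\mathbf y;z)\cdot\mathbf e_i\,d\mathbf y$. Classical (Darcy) cell problem: $\mathbf u_D^j\in\mathring H(Q_1)$ is the unique weak solution of $\mu_1\Delta\mathbf u-\nabla p=-\mathbf e_j$, $\operatorname{div}\mathbf u=0$ in $Q_1$, $\mathbf u=0$ on $\Gamma$, $Q$-periodic, and $K^{(D)}_{ij}=\int_{Q_1}\mathbf u_D^j\cdot\mathbf e_i\,d\mathbf y$. *)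

theory Defs
  imports "HOL-Analysis.Analysis"
begin

text \<open>Points of the cell live in real^'n; vector fields are complex valued,
  i.e. functions real^'n \<Rightarrow> complex^'n.  Fields are genuine functions
  (not a.e. classes); all statements about them are invariant under a.e. changes.\<close>

type_synonym 'n field = "real^'n \<Rightarrow> complex^'n"

definition pd :: "'n::finite \<Rightarrow> (real^'n \<Rightarrow> real) \<Rightarrow> real^'n \<Rightarrow> real" where
  "pd i f x = frechet_derivative f (at x) (axis i 1)"

fun pds :: "'n::finite list \<Rightarrow> (real^'n \<Rightarrow> real) \<Rightarrow> real^'n \<Rightarrow> real" where
  "pds [] f = f"
| "pds (i # is) f = pd i (pds is f)"

definition Ck_on :: "nat \<Rightarrow> (real^'n::finite) set \<Rightarrow> (real^'n \<Rightarrow> real) \<Rightarrow> bool" where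
  "Ck_on k U f \<longleftrightarrow> (\<forall>is::'n list. length is \<le> k \<longrightarrow>
       continuous_on U (pds is f) \<and> (length is < k \<longrightarrow> pds is f differentiable_on U))"

definition smooth :: "(real^'n::finite \<Rightarrow> real) \<Rightarrow> bool" where
  "smooth f \<longleftrightarrow> (\<forall>k. Ck_on k UNIV f)"

definition hoelder_on :: "real \<Rightarrow> (real^'n::finite) set \<Rightarrow> (real^'n \<Rightarrow> real) \<Rightarrow> bool" where
  "hoelder_on \<sigma> U g \<longleftrightarrow> (\<exists>L. \<forall>x\<in>U. \<forall>y\<in>U. \<bar>g x - g y\<bar> \<le> L * dist x y powr \<sigma>)"

definition Ck_sigma_on :: "nat \<Rightarrow> real \<Rightarrow> (real^'n::finite) set \<Rightarrow> (real^'n \<Rightarrow> real) \<Rightarrow> bool" where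
  "Ck_sigma_on k \<sigma> U f \<longleftrightarrow> Ck_on k U f \<and>
      (\<forall>is::'n list. length is = k \<longrightarrow> hoelder_on \<sigma> U (pds is f))"

definition tsupport :: "(real^'n::finite \<Rightarrow> real) \<Rightarrow> (real^'n) set" where
  "tsupport \<phi> = closure {x. \<phi> x \<noteq> 0}"

definition test_fun :: "(real^'n::finite) set \<Rightarrow> (real^'n \<Rightarrow> real) \<Rightarrow> bool" where
  "test_fun U \<phi> \<longleftrightarrow> smooth \<phi> \<and> compact (tsupport \<phi>) \<and> tsupport \<phi> \<subseteq> U"

text \<open>The boundary of \<Omega> is locally (near every boundary point p, in a ball of
  radius r) the graph of a function h over the hyperplane orthogonal to a unit
  vector \<nu> (h does not depend on the \<nu>-coordinate), with \<Omega> lying on one side;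
  the predicate P expresses the regularity of h.\<close>
definition graph_boundary ::
  "((real^'n::finite) set \<Rightarrow> (real^'n \<Rightarrow> real) \<Rightarrow> bool) \<Rightarrow> (real^'n) set \<Rightarrow> bool" where
  "graph_boundary P \<Omega> \<longleftrightarrow> (\<forall>p\<in>frontier \<Omega>. \<exists>r>0. \<exists>\<nu> h. norm \<nu> = 1 \<and>
      (\<forall>x t. h (x + t *\<^sub>R \<nu>) = h x) \<and> P (ball p r) h \<and>
      \<Omega> \<inter> ball p r = {x \<in> ball p r. x \<bullet> \<nu> < h x})"

definition Ck_sigma_boundary :: "nat \<Rightarrow> real \<Rightarrow> (real^'n::finite) set \<Rightarrow> bool" where
  "Ck_sigma_boundary k \<sigma> \<Omega> \<longleftrightarrow> graph_boundary (Ck_sigma_on k \<sigma>) \<Omega>"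

definition C1_boundary :: "(real^'n::finite) set \<Rightarrow> bool" where
  "C1_boundary \<Omega> \<longleftrightarrow> graph_boundary (Ck_on 1) \<Omega>"

definition lipschitz_boundary :: "(real^'n::finite) set \<Rightarrow> bool" where
  "lipschitz_boundary \<Omega> \<longleftrightarrow> graph_boundary (\<lambda>B h. \<exists>L. L-lipschitz_on B h) \<Omega>"

definition cell :: "(real^'n::finite) set" where
  "cell = box 0 One"

definition lattice :: "(real^'n::finite) set" where
  "lattice = {k. \<forall>i. k $ i \<in> \<int>}"

definition per_ext :: "(real^'n::finite) set \<Rightarrow> (real^'n) set" where
  "per_ext S = (\<Union>k\<in>lattice. (\<lambda>x. x + k) ` S)"

text \<open>Periodic extension of the matrix part Q1 = Q - closure Q2: the complement
  of the periodic array of closed inclusions.\<close>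
definition per_ext_matrix :: "(real^'n::finite) set \<Rightarrow> (real^'n) set" where
  "per_ext_matrix Q2 = UNIV - per_ext (closure Q2)"

definition periodic :: "(real^'n::finite \<Rightarrow> 'b) \<Rightarrow> bool" where
  "periodic f \<longleftrightarrow> (\<forall>x i. f (x + axis i 1) = f x)"

definition L2 :: "(real^'n::finite) set \<Rightarrow> (real^'n \<Rightarrow> complex) \<Rightarrow> bool" where
  "L2 U f \<longleftrightarrow> f \<in> borel_measurable (lebesgue_on U) \<and>
      integrable (lebesgue_on U) (\<lambda>x. (cmod (f x))\<^sup>2)"

definition weak_pd :: "(real^'n::finite) set \<Rightarrow> (real^'n \<Rightarrow> complex) \<Rightarrow> 'n \<Rightarrow> (real^'n \<Rightarrow> complex) \<Rightarrow> bool" where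
  "weak_pd U f i g \<longleftrightarrow> (\<forall>\<phi>. test_fun U \<phi> \<longrightarrow>
     integral\<^sup>L (lebesgue_on U) (\<lambda>x. f x * of_real (pd i \<phi> x)) =
     - integral\<^sup>L (lebesgue_on U) (\<lambda>x. g x * of_real (\<phi> x)))"

definition H1 :: "(real^'n::finite) set \<Rightarrow> (real^'n \<Rightarrow> complex) \<Rightarrow> bool" where
  "H1 U f \<longleftrightarrow> L2 U f \<and> (\<forall>i. \<exists>g. L2 U g \<and> weak_pd U f i g)"

definition H1_per :: "(real^'n::finite) set \<Rightarrow> (real^'n \<Rightarrow> complex) \<Rightarrow> bool" where
  "H1_per P f \<longleftrightarrow> periodic f \<and> L2 (P \<inter> cell) f \<and>
     (\<forall>i. \<exists>g. periodic g \<and> L2 (P \<inter> cell) g \<and> weak_pd P f i g)"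

definition Dw :: "(real^'n::finite) set \<Rightarrow> (real^'n \<Rightarrow> complex) \<Rightarrow> 'n \<Rightarrow> real^'n \<Rightarrow> complex" where
  "Dw U f i = (SOME g. L2 U g \<and> weak_pd U f i g)"

definition comp :: "('n::finite) field \<Rightarrow> 'n \<Rightarrow> real^'n \<Rightarrow> complex" where
  "comp v c = (\<lambda>x. v x $ c)"

definition sym_grad :: "(real^'n::finite) set \<Rightarrow> 'n field \<Rightarrow> 'n \<Rightarrow> 'n \<Rightarrow> real^'n \<Rightarrow> complex" where
  "sym_grad U v c d x = (Dw U (comp v c) d x + Dw U (comp v d) c x) / 2"

definition div_free :: "(real^'n::finite) set \<Rightarrow> 'n field \<Rightarrow> bool" where
  "div_free U v \<longleftrightarrow> (AE x in lebesgue_on U. (\<Sum>c\<in>UNIV. Dw U (comp v c) c x) = 0)"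

definition aform :: "real \<Rightarrow> (real^'n::finite) set \<Rightarrow> 'n field \<Rightarrow> 'n field \<Rightarrow> complex" where
  "aform \<mu>1 U u v = integral\<^sup>L (lebesgue_on U)
     (\<lambda>x. of_real (2 * \<mu>1) * (\<Sum>c\<in>UNIV. \<Sum>d\<in>UNIV. sym_grad U u c d x * cnj (sym_grad U v c d x)))"

definition enorm :: "real \<Rightarrow> (real^'n::finite) set \<Rightarrow> 'n field \<Rightarrow> real" where
  "enorm \<mu>1 D v = sqrt (Re (aform \<mu>1 D v v))"

definition load :: "(real^'n::finite) set \<Rightarrow> real^'n \<Rightarrow> 'n field \<Rightarrow> complex" where
  "load U f v = integral\<^sup>L (lebesgue_on U) (\<lambda>x. \<Sum>c\<in>UNIV. of_real (f $ c) * cnj (v x $ c))"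

text \<open>v \<cdot> n = 0 on \<Gamma> (weak normal trace, via Green's formula) for a field
  defined on the subdomain U (= Q1 or Q2) of the cell; test functions are
  supported in the open cell, so only the interface \<Gamma> is involved.\<close>
definition normal_zero :: "(real^'n::finite) set \<Rightarrow> 'n field \<Rightarrow> bool" where
  "normal_zero U v \<longleftrightarrow> (\<forall>\<phi>. test_fun cell \<phi> \<longrightarrow>
     integral\<^sup>L (lebesgue_on U) (\<lambda>x. (\<Sum>c\<in>UNIV. v x $ c * of_real (pd c \<phi> x))
        + (\<Sum>c\<in>UNIV. Dw U (comp v c) c x) * of_real (\<phi> x)) = 0)"

text \<open>No jump across \<Gamma> (weak trace formulation): the weak derivatives on
  Q1 \<union> Q2 are also weak derivatives across the interface.\<close>
definition no_jump :: "(real^'n::finite) set \<Rightarrow> (real^'n) set \<Rightarrow> 'n field \<Rightarrow> bool" where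
  "no_jump Q1 Q2 v \<longleftrightarrow> (\<forall>c i \<phi>. test_fun cell \<phi> \<longrightarrow>
     integral\<^sup>L (lebesgue_on (Q1 \<union> Q2)) (\<lambda>x. v x $ c * of_real (pd i \<phi> x)
        + Dw (Q1 \<union> Q2) (comp v c) i x * of_real (\<phi> x)) = 0)"

definition rigid :: "('n::finite) field \<Rightarrow> bool" where
  "rigid r \<longleftrightarrow> (\<exists>(a::complex^'n) (B::complex^'n^'n). (\<forall>c d. B $ c $ d = - B $ d $ c) \<and>
      (\<forall>y. r y = a + B *v (\<chi> d. of_real (y $ d))))"

definition orth_rigid :: "(real^'n::finite) set \<Rightarrow> 'n field \<Rightarrow> bool" where
  "orth_rigid Q2 v \<longleftrightarrow> (\<forall>r. rigid r \<longrightarrow>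
     integral\<^sup>L (lebesgue_on Q2) (\<lambda>x. (\<Sum>c\<in>UNIV. v x $ c * cnj (r x $ c)) +
        (\<Sum>c\<in>UNIV. \<Sum>d\<in>UNIV. Dw Q2 (comp v c) d x * cnj (Dw Q2 (comp r c) d x))) = 0)"

definition HQ :: "(real^'n::finite) set \<Rightarrow> (real^'n) set \<Rightarrow> 'n field \<Rightarrow> bool" where
  "HQ Q1 Q2 v \<longleftrightarrow>
     (\<forall>c. H1_per (per_ext_matrix Q2 \<union> per_ext Q2) (comp v c)) \<and>
     div_free (Q1 \<union> Q2) v \<and> normal_zero Q2 v \<and> no_jump Q1 Q2 v \<and> orth_rigid Q2 v"

definition HQ1 :: "(real^'n::finite) set \<Rightarrow> (real^'n) set \<Rightarrow> 'n field \<Rightarrow> bool" where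
  "HQ1 Q1 Q2 v \<longleftrightarrow> (\<forall>c. H1_per (per_ext_matrix Q2) (comp v c)) \<and>
     div_free Q1 v \<and> normal_zero Q1 v"

text \<open>v = 0 on \<Gamma>: the extension by zero into the inclusions is periodic H^1_loc.\<close>
definition HQ1_0 :: "(real^'n::finite) set \<Rightarrow> (real^'n) set \<Rightarrow> 'n field \<Rightarrow> bool" where
  "HQ1_0 Q1 Q2 v \<longleftrightarrow> HQ1 Q1 Q2 v \<and>
     (\<forall>c. H1_per UNIV (\<lambda>x. if x \<in> per_ext_matrix Q2 then v x $ c else 0))"

definition HQ2 :: "(real^'n::finite) set \<Rightarrow> 'n field \<Rightarrow> bool" where
  "HQ2 Q2 v \<longleftrightarrow> (\<forall>c. H1 Q2 (comp v c)) \<and> div_free Q2 v \<and> normal_zero Q2 v \<and> orth_rigid Q2 v"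

definition is_extension_constant :: "real \<Rightarrow> (real^'n::finite) set \<Rightarrow> (real^'n) set \<Rightarrow> real \<Rightarrow> bool" where
  "is_extension_constant \<mu>1 Q1 Q2 E1 \<longleftrightarrow> E1 \<ge> 1 \<and>
    (\<exists>(T1 :: 'n field \<Rightarrow> 'n field) N. open N \<and> closure Q2 \<subseteq> N \<and> closure N \<subseteq> cell \<and>
      (\<forall>u v a b. HQ2 Q2 u \<longrightarrow> HQ2 Q2 v \<longrightarrow>
          T1 (\<lambda>x. a *s u x + b *s v x) = (\<lambda>x. a *s T1 u x + b *s T1 v x)) \<and>
      (\<forall>v. HQ2 Q2 v \<longrightarrow>
          (\<forall>x\<in>Q2. T1 v x = v x) \<and>
          (\<forall>c. H1_per UNIV (comp (T1 v) c)) \<and> div_free cell (T1 v) \<and>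
          (\<forall>x\<in>cell - N. T1 v x = 0) \<and>
          enorm \<mu>1 cell (T1 v) \<le> E1 * enorm \<mu>1 Q2 v))"

definition cvec :: "real^'n::finite \<Rightarrow> complex^'n" where
  "cvec e = (\<chi> c. of_real (e $ c))"

definition coeff_solutions :: "real \<Rightarrow> (real^'n::finite) set \<Rightarrow> (real^'n) set \<Rightarrow> real^'n
     \<Rightarrow> (nat \<Rightarrow> 'n field) \<Rightarrow> (nat \<Rightarrow> 'n field) \<Rightarrow> bool" where
  "coeff_solutions \<mu>1 Q1 Q2 e uin uout \<longleftrightarrow>
     uin 0 = (\<lambda>x. 0) \<and>
     HQ1_0 Q1 Q2 (uout 0) \<and>
     (\<forall>v. HQ1_0 Q1 Q2 v \<longrightarrow> aform \<mu>1 Q1 (uout 0) v = load Q1 e v) \<and>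
     (\<forall>k. HQ2 Q2 (uin (Suc k)) \<and>
        (\<forall>v. HQ Q1 Q2 v \<longrightarrow>
           aform \<mu>1 Q2 (uin (Suc k)) v =
             (if k = 0 then load cell e v else 0) - aform \<mu>1 Q1 (uout k) v)) \<and>
     (\<forall>k. HQ1 Q1 Q2 (uout (Suc k)) \<and>
        no_jump Q1 Q2 (\<lambda>x. if x \<in> Q2 then uin (Suc k) x else uout (Suc k) x) \<and>
        (\<forall>v. HQ1_0 Q1 Q2 v \<longrightarrow> aform \<mu>1 Q1 (uout (Suc k)) v = 0))"

text \<open>Classical Darcy cell problem  \<mu>1 \<Delta>u - \<nabla>p = -e, weak form in H0(Q1).\<close>
definition darcy_solution :: "real \<Rightarrow> (real^'n::finite) set \<Rightarrow> (real^'n) set \<Rightarrow> real^'n \<Rightarrow> 'n field \<Rightarrow> bool" where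
  "darcy_solution \<mu>1 Q1 Q2 e u \<longleftrightarrow> HQ1_0 Q1 Q2 u \<and>
     (\<forall>v. HQ1_0 Q1 Q2 v \<longrightarrow>
        integral\<^sup>L (lebesgue_on Q1) (\<lambda>x. of_real \<mu>1 *
          (\<Sum>c\<in>UNIV. \<Sum>d\<in>UNIV. Dw Q1 (comp u c) d x * cnj (Dw Q1 (comp v c) d x)))
        = load Q1 e v)"

text \<open>Self-permeability cell problem with \<mu> = \<mu>1 \<chi>1 + z \<mu>1 \<chi>2.\<close>
definition perm_solution :: "real \<Rightarrow> (real^'n::finite) set \<Rightarrow> (real^'n) set \<Rightarrow> complex \<Rightarrow> real^'n \<Rightarrow> 'n field \<Rightarrow> bool" where
  "perm_solution \<mu>1 Q1 Q2 z e u \<longleftrightarrow> HQ Q1 Q2 u \<and>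
     (\<forall>v. HQ Q1 Q2 v \<longrightarrow>
        aform \<mu>1 Q1 u v + z * aform \<mu>1 Q2 u v = load cell e v)"

definition neg_axis :: "complex set" where
  "neg_axis = {z. Im z = 0 \<and> Re z \<le> 0}"

end

(* Subtracting the identities that define the coefficients from the cell problem with contrast z gives, for
   every v in H(Q),
     a_1(u(z) - u^out_0, v) + z a_2(u(z), v) = a_2(u^in_1, v),
   where a_m is the energy form on Q_m.  The divergence-free extension of u(z) from Q_2 to Q bounds the first
   difference by E_1 times the norm of u(z) on Q_2, and then v = u(z) - u^out_0 yields
     |u(z)|_{Q_2} <= |u^in_1|_{Q_2} / (|z| - E_1^2).
   The same identities represent the load, so K_ij(z) - K^(D)_ij is a combination of energy products with u(z)
   and u(z) - u^out_0 and inherits this rate.  That u^out_0 is the Darcy field follows because the term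
   grad u : (grad v)^T, the difference between the symmetric gradient and the gradient forms, integrates to the
   integral of div u div v on the torus.  Statements about the values of the limits need a field of zero energy
   to vanish: it is a rigid displacement, which orthogonality on Q_2, respectively periodicity and the
   condition v . n = 0 on Q_1, force to be zero. *)
theory Submission
  imports Defs "HOL-Computational_Algebra.Polynomial"
begin

section \<open>Product test functions\<close>

text \<open>Two facts have to be extracted from the weak formulation itself. A field of zero energy
  is rigid because its second weak derivatives cancel in pairs; this needs test functions whose
  mixed derivatives commute, whence products of one-variable bumps. The torus identity for the cross
  term is proved with cross-correlations, which can be differentiated like distributions and are
  continuous at 0. Two admissible fields in H(Q) drive the estimate: the extension by zero of
  u^out_0, on which the a_2 terms vanish, and the extension of u from Q_2, whose a_2 terms agree
  with those of u. So, on Q_1, d = u - u^out_0 has the same product with itself, with u and with the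
  extension. The energy is built on \<open>Dw\<close>, a weak derivative selected by choice on a
  given open set, so its values on Q_1, Q_2, their union and the cell have to be compared with each
  other and with the periodic derivatives. The stated rate follows from the one with E_1^2 because
  E_1 >= 1 gives |w| / (1 - E_1^2 |w|) <= 2 E_1^2 |w| / (1 - 2 E_1^2 |w|).\<close>

definition smooth1 :: "(real \<Rightarrow> real) \<Rightarrow> bool" where
  "smooth1 f \<longleftrightarrow> (\<exists>S. f \<in> S \<and> (\<forall>g\<in>S. \<exists>g'\<in>S. \<forall>x. (g has_real_derivative g' x) (at x)))"

lemma smooth1_deriv:
  assumes "smooth1 f"
  shows "smooth1 (deriv f)" "(f has_real_derivative deriv f x) (at x)"
proof -
  obtain S where S: "f \<in> S" "\<forall>g\<in>S. \<exists>g'\<in>S. \<forall>x. (g has_real_derivative g' x) (at x)"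
    using assms unfolding smooth1_def by blast
  then obtain f' where f': "f' \<in> S" "\<forall>x. (f has_real_derivative f' x) (at x)" by blast
  then have "deriv f = f'" by (auto intro: DERIV_imp_deriv)
  then show "smooth1 (deriv f)" "(f has_real_derivative deriv f x) (at x)"
    using f' S unfolding smooth1_def by auto
qed

text \<open>Infinite differentiability is encoded as a greatest fixed point: a set of functions that
  contains a derivative of each member certifies all its members. No formula for the n-th derivative
  is ever required.\<close>

lemma smooth1_coinduct:
  assumes "f \<in> S" "\<And>g. g \<in> S \<Longrightarrow> \<exists>g'\<in>S. \<forall>x. (g has_real_derivative g' x) (at x)"
  shows "smooth1 f"
  using assms unfolding smooth1_def by blast

lemma smooth1_const [simp]: "smooth1 (\<lambda>x. c)"
  by (rule smooth1_coinduct[of _ "{\<lambda>x. c, \<lambda>x. 0}"]) (auto intro: DERIV_const)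

lemma smooth1_ident [simp]: "smooth1 (\<lambda>x. x)"
  by (rule smooth1_coinduct[of _ "{\<lambda>x. x, \<lambda>x. 1, \<lambda>x. 0}"]) (auto intro: DERIV_const DERIV_ident)

text \<open>A ready-made certificate: the sum, product and reciprocal rules express each derivative
  by members of the same algebra, so closure of \<open>smooth1\<close> under these operations
  follows by coinduction on it.\<close>

inductive_set smooth1_alg :: "(real \<Rightarrow> real) set" where
  base: "smooth1 f \<Longrightarrow> f \<in> smooth1_alg"
| add: "f \<in> smooth1_alg \<Longrightarrow> g \<in> smooth1_alg \<Longrightarrow> (\<lambda>x. f x + g x) \<in> smooth1_alg"
| mult: "f \<in> smooth1_alg \<Longrightarrow> g \<in> smooth1_alg \<Longrightarrow> (\<lambda>x. f x * g x) \<in> smooth1_alg"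
| inv: "f \<in> smooth1_alg \<Longrightarrow> (\<And>x. f x \<noteq> 0) \<Longrightarrow> (\<lambda>x. inverse (f x)) \<in> smooth1_alg"

lemma smooth1_alg_smooth1: "f \<in> smooth1_alg \<Longrightarrow> smooth1 f"
proof (erule smooth1_coinduct)
  fix g assume "g \<in> smooth1_alg"
  then show "\<exists>g'\<in>smooth1_alg. \<forall>x. (g has_real_derivative g' x) (at x)"
  proof induction
    case (base f)
    then show ?case using smooth1_deriv smooth1_alg.base by blast
  next
    case (add f g)
    then obtain f' g' where "f' \<in> smooth1_alg" "\<forall>x. (f has_real_derivative f' x) (at x)"
      "g' \<in> smooth1_alg" "\<forall>x. (g has_real_derivative g' x) (at x)" by blast
    then show ?case
      by (intro bexI[of _ "\<lambda>x. f' x + g' x"]) (auto intro!: derivative_eq_intros smooth1_alg.add)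
  next
    case (mult f g)
    then obtain f' g' where "f' \<in> smooth1_alg" "\<forall>x. (f has_real_derivative f' x) (at x)"
      "g' \<in> smooth1_alg" "\<forall>x. (g has_real_derivative g' x) (at x)" by blast
    with mult.hyps show ?case
      by (intro bexI[of _ "\<lambda>x. f' x * g x + g' x * f x"])
        (auto intro!: derivative_eq_intros smooth1_alg.add smooth1_alg.mult)
  next
    case (inv f)
    then obtain f' where f': "f' \<in> smooth1_alg" "\<forall>x. (f has_real_derivative f' x) (at x)" by blast
    have "(\<lambda>x. (-1) * (inverse (f x) * f' x * inverse (f x))) \<in> smooth1_alg"
      using f' inv by (intro smooth1_alg.mult smooth1_alg.inv) (auto intro: smooth1_alg.base)
    with inv f' show ?case
      by (intro bexI[of _ "\<lambda>x. (-1) * (inverse (f x) * f' x * inverse (f x))"])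
        (auto intro!: derivative_eq_intros)
  qed
qed

lemma smooth1_add: "smooth1 f \<Longrightarrow> smooth1 g \<Longrightarrow> smooth1 (\<lambda>x. f x + g x)"
  by (blast intro: smooth1_alg_smooth1[OF smooth1_alg.add] smooth1_alg.base)

lemma smooth1_mult: "smooth1 f \<Longrightarrow> smooth1 g \<Longrightarrow> smooth1 (\<lambda>x. f x * g x)"
  by (blast intro: smooth1_alg_smooth1[OF smooth1_alg.mult] smooth1_alg.base)

lemma smooth1_inverse: "smooth1 f \<Longrightarrow> (\<And>x. f x \<noteq> 0) \<Longrightarrow> smooth1 (\<lambda>x. inverse (f x))"
  by (blast intro: smooth1_alg_smooth1[OF smooth1_alg.inv] smooth1_alg.base)

lemma smooth1_divide:
  "smooth1 f \<Longrightarrow> smooth1 g \<Longrightarrow> (\<And>x. g x \<noteq> 0) \<Longrightarrow> smooth1 (\<lambda>x. f x / g x)"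
  unfolding divide_inverse by (intro smooth1_mult smooth1_inverse)

lemma smooth1_affine: "smooth1 f \<Longrightarrow> smooth1 (\<lambda>x. f (a + b * x))"
\<comment> \<open>The free factor c absorbs the powers of b that the chain rule produces.\<close>
proof (rule smooth1_coinduct[of _ "{\<lambda>x. c * f (a + b * x) |f c. smooth1 f}"])
  assume "smooth1 f" then show "(\<lambda>x. f (a + b * x)) \<in> {\<lambda>x. c * f (a + b * x) |f c. smooth1 f}"
    by (auto intro!: exI[of _ f] exI[of _ 1])
next
  fix g assume "g \<in> {\<lambda>x. c * f (a + b * x) |f c. smooth1 f}"
  then obtain f c where f: "smooth1 f" and g: "g = (\<lambda>x. c * f (a + b * x))" by blast
  have "((\<lambda>x. c * f (a + b * x)) has_real_derivative (c * b) * deriv f (a + b * x)) (at x)" for x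
    by (auto intro!: derivative_eq_intros DERIV_chain2[OF smooth1_deriv(2)[OF f]])
  then show "\<exists>g'\<in>{\<lambda>x. c * f (a + b * x) |f c. smooth1 f}. \<forall>x. (g has_real_derivative g' x) (at x)"
    unfolding g using smooth1_deriv(1)[OF f]
    by (intro bexI[of _ "\<lambda>x. (c * b) * deriv f (a + b * x)"]) auto
qed

section \<open>The flat function exp(-1/x) and a smooth step\<close>

definition eta :: "real \<Rightarrow> real" where
  "eta x = (if x > 0 then exp (- (1 / x)) else 0)"

lemma poly_exp_tendsto_0:
  fixes p :: "real poly"
  shows "((\<lambda>x. poly p x * exp (- x)) \<longlongrightarrow> 0) at_top"
proof (induction p)
  case (pCons a p)
  have *: "((\<lambda>x. poly q x * exp (- x)) \<longlongrightarrow> 0) at_top" for q :: "real poly"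
  proof -
    have "((\<lambda>x. \<Sum>i\<le>degree q. coeff q i * (x ^ i / exp x)) \<longlongrightarrow> (\<Sum>i\<le>degree q. coeff q i * 0)) at_top"
      by (intro tendsto_intros tendsto_power_div_exp_0)
    then show ?thesis
      by (simp add: poly_altdef sum_distrib_right exp_minus divide_inverse mult.assoc)
  qed
  show ?case by (rule *)
qed simp

text \<open>The functions p(1/x) exp(-1/x) for x > 0, continued by 0, with p a polynomial, are
  closed under differentiation; the point 0 works because the exponential beats every
  polynomial.\<close>

lemma smooth1_eta: "smooth1 eta"
proof (rule smooth1_coinduct[of _ "{\<lambda>x. if x > 0 then poly p (1 / x) * exp (- (1 / x)) else 0 |p. True}"])
  show "eta \<in> {\<lambda>x. if x > 0 then poly p (1 / x) * exp (- (1 / x)) else 0 |p. True}"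
    by (auto simp: eta_def fun_eq_iff intro!: exI[of _ 1])
next
  fix g :: "real \<Rightarrow> real"
  assume "g \<in> {\<lambda>x. if x > 0 then poly p (1 / x) * exp (- (1 / x)) else 0 |p. True}"
  then obtain p :: "real poly" where g: "g = (\<lambda>x. if x > 0 then poly p (1 / x) * exp (- (1 / x)) else 0)" by blast
  \<comment> \<open>By the chain rule the derivative of p(1/x) exp(-1/x) is (1/x)^2 (p - p')(1/x)
    exp(-1/x), so q(t) = t^2 (p - p')(t).\<close>
  define q where "q = [:0, 0, 1:] * (p - pderiv p)"
  define g' where "g' = (\<lambda>x::real. if x > 0 then poly q (1 / x) * exp (- (1 / x)) else 0)"
  have "(g has_real_derivative g' x) (at x)" for x
  proof -
    consider "x > 0" | "x < 0" | "x = 0" by linarith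
    then show ?thesis
    proof cases
      case 1
      have d: "((\<lambda>x. 1 / x) has_real_derivative - (1 / x)\<^sup>2) (at x)"
        using 1 by (auto intro!: derivative_eq_intros simp: power2_eq_square)
      have "((\<lambda>x. poly p (1 / x)) has_real_derivative poly (pderiv p) (1 / x) * - (1 / x)\<^sup>2) (at x)"
        by (rule DERIV_chain2[OF poly_DERIV d])
      moreover have "((\<lambda>x. exp (- (1 / x))) has_real_derivative exp (- (1 / x)) * (- (- (1 / x)\<^sup>2))) (at x)"
        by (rule DERIV_chain2[OF DERIV_exp DERIV_minus[OF d]])
      ultimately have "((\<lambda>x. poly p (1 / x) * exp (- (1 / x))) has_real_derivative
          (poly (pderiv p) (1 / x) * - (1 / x)\<^sup>2) * exp (- (1 / x))
            + (exp (- (1 / x)) * (- (- (1 / x)\<^sup>2))) * poly p (1 / x)) (at x)"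
        by (rule DERIV_mult)
      moreover have "(poly (pderiv p) (1 / x) * - (1 / x)\<^sup>2) * exp (- (1 / x))
            + (exp (- (1 / x)) * (- (- (1 / x)\<^sup>2))) * poly p (1 / x) = g' x"
        using 1 unfolding g'_def q_def by (simp add: power2_eq_square algebra_simps)
      ultimately have "((\<lambda>x. poly p (1 / x) * exp (- (1 / x))) has_real_derivative g' x) (at x)"
        by simp
      then show ?thesis
        by (rule has_field_derivative_transform_within_open[of _ _ _ "{0<..}"])
          (use 1 in \<open>auto simp: g\<close>)
    next
      case 2
      have "((\<lambda>x::real. 0::real) has_real_derivative g' x) (at x)"
        using 2 unfolding g'_def by auto
      then show ?thesis
        by (rule has_field_derivative_transform_within_open[of _ _ _ "{..<0}"])
          (use 2 in \<open>auto simp: g\<close>)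
    next
      case 3
      \<comment> \<open>With x = 1/y the difference quotient becomes x p(x) exp(-x); the polynomial
        x p(x) is \<open>pCons 0 p\<close>.\<close>
      have "((\<lambda>y. g y / y) \<longlongrightarrow> 0) (at_right 0)"
      proof -
        have "((\<lambda>x. poly (pCons 0 p) x * exp (- x)) \<longlongrightarrow> 0) at_top"
          by (rule poly_exp_tendsto_0)
        then have "((\<lambda>x. poly (pCons 0 p) (inverse x) * exp (- (inverse x))) \<longlongrightarrow> 0) (at_right 0)"
          by (rule filterlim_compose) (rule filterlim_inverse_at_top_right)
        then show ?thesis
          by (rule Lim_transform_eventually)
            (auto simp: eventually_at_filter g field_simps)
      qed
      moreover have "((\<lambda>y. g y / y) \<longlongrightarrow> 0) (at_left 0)"
        by (rule Lim_transform_eventually[OF tendsto_const]) (auto simp: eventually_at_filter g)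
      ultimately have "((\<lambda>y. g y / y) \<longlongrightarrow> 0) (at 0)"
        by (rule filterlim_split_at[rotated])
      then show ?thesis
        unfolding 3 has_field_derivative_iff by (simp add: g'_def g)
    qed
  qed
  moreover have "g' \<in> {\<lambda>x. if x > 0 then poly p (1 / x) * exp (- (1 / x)) else 0 |p. True}"
    unfolding g'_def by blast
  ultimately show "\<exists>g'\<in>{\<lambda>x. if x > 0 then poly p (1 / x) * exp (- (1 / x)) else 0 |p. True}.
      \<forall>x. (g has_real_derivative g' x) (at x)" by (intro bexI[of _ g'] allI)
qed


lemma eta_nonneg: "0 \<le> eta x" and eta_le_1: "eta x \<le> 1" and eta_pos_iff: "0 < eta x \<longleftrightarrow> 0 < x"
  by (auto simp: eta_def)

definition step :: "real \<Rightarrow> real" where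
  "step t = eta t / (eta t + eta (1 - t))"

lemma eta_sum_pos: "0 < eta t + eta (1 - t)"
  using eta_nonneg[of t] eta_nonneg[of "1 - t"] eta_pos_iff[of t] eta_pos_iff[of "1 - t"]
  by (cases "t > 0") linarith+

lemma smooth1_step: "smooth1 step"
proof -
  have "smooth1 (\<lambda>t. eta (1 - t))" using smooth1_affine[OF smooth1_eta, of 1 "-1"] by simp
  moreover have "eta t + eta (1 - t) \<noteq> 0" for t using eta_sum_pos[of t] by simp
  ultimately show ?thesis
    unfolding step_def[abs_def] by (intro smooth1_divide smooth1_add smooth1_eta)
qed

lemma step_eq_0: "t \<le> 0 \<Longrightarrow> step t = 0" and step_eq_1: "t \<ge> 1 \<Longrightarrow> step t = 1"
  by (auto simp: step_def eta_def)

section \<open>Products of one-variable functions\<close>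

definition tensor :: "('n::finite \<Rightarrow> real \<Rightarrow> real) \<Rightarrow> real^'n \<Rightarrow> real" where
  "tensor F x = (\<Prod>c\<in>UNIV. F c (x $ c))"

lemma has_derivative_tensor:
  assumes "\<And>c. smooth1 (F c)"
  shows "(tensor F has_derivative (\<lambda>h. \<Sum>c\<in>UNIV. h $ c * tensor (F(c := deriv (F c))) x)) (at x)"
proof -
  have "((\<lambda>x. F c (x $ c)) has_derivative (\<lambda>h. deriv (F c) (x $ c) * h $ c)) (at x)" for c
  proof -
    have "(F c has_derivative (*) (deriv (F c) (x $ c))) (at (x $ c))"
      using smooth1_deriv(2)[OF assms] by (simp add: has_field_derivative_def)
    moreover have "((\<lambda>x. x $ c) has_derivative (\<lambda>h. h $ c)) (at x)"
      by (rule bounded_linear.has_derivative[OF bounded_linear_vec_nth]) simp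
    ultimately show ?thesis
      using has_derivative_compose[of "\<lambda>x. x $ c" "\<lambda>h. h $ c" x UNIV "F c"] by simp
  qed
  then have "(tensor F has_derivative (\<lambda>h. \<Sum>c\<in>UNIV. (deriv (F c) (x $ c) * h $ c) * (\<Prod>d\<in>UNIV - {c}. F d (x $ d)))) (at x)"
    unfolding tensor_def[abs_def] by (intro has_derivative_prod) auto
  moreover have "tensor (F(c := deriv (F c))) x = deriv (F c) (x $ c) * (\<Prod>d\<in>UNIV - {c}. F d (x $ d))" for c
    unfolding tensor_def by (subst prod.remove[of _ c]) auto
  ultimately show ?thesis
    by (simp add: mult_ac)
qed

lemma pd_tensor:
  assumes "\<And>c. smooth1 (F c)"
  shows "pd i (tensor F) = tensor (F(i := deriv (F i)))"
proof
  fix x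
  have "pd i (tensor F) x = (\<Sum>c\<in>UNIV. axis i 1 $ c * tensor (F(c := deriv (F c))) x)"
    unfolding pd_def frechet_derivative_at[OF has_derivative_tensor[OF assms], symmetric] ..
  also have "\<dots> = (\<Sum>c\<in>UNIV. if c = i then tensor (F(c := deriv (F c))) x else 0)"
    by (intro sum.cong) (auto simp: axis_def)
  finally show "pd i (tensor F) x = tensor (F(i := deriv (F i))) x" by simp
qed

text \<open>A partial derivative of a product differentiates one factor and leaves a product, so
  every iterated partial derivative is again differentiable, hence continuous.\<close>

lemma smooth_tensor:
  assumes "\<And>c. smooth1 (F c)"
  shows "smooth (tensor F)"
proof -
  have *: "\<exists>G. (\<forall>c. smooth1 (G c)) \<and> pds is (tensor F) = tensor G" for "is"
  proof (induction "is")
    case Nil then show ?case using assms by auto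
  next
    case (Cons i "is")
    then obtain G where G: "\<forall>c. smooth1 (G c)" "pds is (tensor F) = tensor G" by blast
    then have "pds (i # is) (tensor F) = tensor (G(i := deriv (G i)))" by (simp add: pd_tensor)
    moreover have "smooth1 ((G(i := deriv (G i))) c)" for c
      using G(1) by (auto intro: smooth1_deriv)
    ultimately show ?case by blast
  qed
  have "pds is (tensor F) differentiable_on UNIV" for "is"
  proof -
    obtain G where "\<forall>c. smooth1 (G c)" "pds is (tensor F) = tensor G" using *[of "is"] by blast
    then show ?thesis
      by (auto intro!: differentiable_at_imp_differentiable_on differentiableI[OF has_derivative_tensor])
  qed
  then show ?thesis
    unfolding smooth_def Ck_on_def by (auto intro: differentiable_imp_continuous_on)
qed

text \<open>Products of one-variable bumps form a class of test functions on which partial derivatives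
  visibly commute; it is rich enough to replace all of C_c^infinity below.\<close>

definition ptest :: "real^'n::finite \<Rightarrow> real^'n \<Rightarrow> (real^'n \<Rightarrow> real) \<Rightarrow> bool" where
  "ptest a b \<phi> \<longleftrightarrow> (\<exists>F. (\<forall>c. smooth1 (F c)) \<and> (\<forall>c t. t \<notin> {a $ c..b $ c} \<longrightarrow> F c t = 0) \<and> \<phi> = tensor F)"

lemma ptestI:
  "(\<And>c. smooth1 (F c)) \<Longrightarrow> (\<And>c t. t \<notin> {a $ c..b $ c} \<Longrightarrow> F c t = 0) \<Longrightarrow> ptest a b (tensor F)"
  unfolding ptest_def by blast

lemma ptest_zero: "ptest a b \<phi> \<Longrightarrow> x \<notin> cbox a b \<Longrightarrow> \<phi> x = 0"
proof -
  assume "ptest a b \<phi>" "x \<notin> cbox a b"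
  then obtain F i where F: "\<forall>c t. t \<notin> {a $ c..b $ c} \<longrightarrow> F c t = 0" "\<phi> = tensor F"
    and i: "x $ i \<notin> {a $ i..b $ i}"
    by (auto simp: ptest_def mem_box_cart)
  have "F i (x $ i) = 0" using F(1) i by blast
  then show ?thesis unfolding F(2) tensor_def by (intro prod_zero) auto
qed

lemma deriv_zero_outside:
  assumes "\<And>t. t \<notin> {u..v::real} \<Longrightarrow> f t = (0::real)" "t \<notin> {u..v}"
  shows "deriv f t = 0"
proof -
  have "open (- {u..v})" by (intro open_Compl closed_atLeastAtMost)
  then have "(f has_field_derivative 0) (at t)"
    by (intro has_field_derivative_transform_within_open[of "\<lambda>_. 0" 0 t "- {u..v}" f])
      (use assms in auto)
  then show ?thesis by (rule DERIV_imp_deriv)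
qed

lemma ptest_pd:
  assumes "ptest a b \<phi>"
  shows "ptest a b (pd i \<phi>)"
proof -
  obtain F where F: "\<forall>c. smooth1 (F c)" "\<forall>c t. t \<notin> {a $ c..b $ c} \<longrightarrow> F c t = 0" "\<phi> = tensor F"
    using assms unfolding ptest_def by blast
  have "(F(i := deriv (F i))) c t = 0" if "t \<notin> {a $ c..b $ c}" for c t
    using F(2) that deriv_zero_outside[of "a $ i" "b $ i" "F i" t] by (cases "c = i") (simp_all del: atLeastAtMost_iff)
  moreover have "smooth1 ((F(i := deriv (F i))) c)" for c
    using F(1) by (auto intro: smooth1_deriv)
  ultimately have "ptest a b (tensor (F(i := deriv (F i))))" by (intro ptestI) blast+
  with F show ?thesis by (simp add: pd_tensor)
qed

lemma ptest_pd_commute: "ptest a b \<phi> \<Longrightarrow> pd i (pd j \<phi>) = pd j (pd i \<phi>)"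
  by (cases "i = j") (auto simp: ptest_def pd_tensor smooth1_deriv fun_upd_twist)

lemma ptest_has_derivative:
  assumes "ptest a b \<phi>"
  shows "(\<phi> has_derivative (\<lambda>h. \<Sum>c\<in>UNIV. h $ c * pd c \<phi> x)) (at x)"
proof -
  obtain F where F: "\<And>c. smooth1 (F c)" "\<phi> = tensor F"
    using assms unfolding ptest_def by blast
  show ?thesis
    unfolding F(2) pd_tensor[OF F(1)] by (rule has_derivative_tensor[OF F(1)])
qed

lemma ptest_continuous: "ptest a b \<phi> \<Longrightarrow> continuous_on UNIV \<phi>"
  by (intro continuous_at_imp_continuous_on ballI has_derivative_continuous) (rule ptest_has_derivative)

lemma ptest_measurable [measurable_dest]: "ptest a b \<phi> \<Longrightarrow> \<phi> \<in> borel_measurable borel"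
  using ptest_continuous by (rule borel_measurable_continuous_onI)

lemma ptest_bounded:
  assumes "ptest a b \<phi>"
  obtains B where "B > 0" "\<And>x. \<bar>\<phi> x\<bar> \<le> B"
proof -
  have "compact (\<phi> ` cbox a b)"
    using assms by (intro compact_continuous_image continuous_on_subset[OF ptest_continuous]) auto
  then obtain B where B: "B > 0" "\<forall>y\<in>\<phi> ` cbox a b. norm y \<le> B"
    using compact_imp_bounded bounded_pos by blast
  have "\<bar>\<phi> x\<bar> \<le> B" for x
    using B ptest_zero[OF assms, of x] by (cases "x \<in> cbox a b") auto
  then show thesis using that B(1) by blast
qed

lemma ptest_test_fun:
  assumes "ptest a b \<phi>" "cbox a b \<subseteq> U"
  shows "test_fun U \<phi>"
proof -
  have "tsupport \<phi> \<subseteq> cbox a b"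
    unfolding tsupport_def using ptest_zero[OF assms(1)] by (intro closure_minimal) auto
  moreover have "compact (tsupport \<phi>)"
    unfolding compact_eq_bounded_closed
    by (rule conjI[OF bounded_subset[OF bounded_cbox calculation]]) (simp add: tsupport_def)
  moreover have "smooth \<phi>"
    using assms(1) unfolding ptest_def by (auto intro: smooth_tensor)
  ultimately show ?thesis
    using assms(2) unfolding test_fun_def by blast
qed

lemma tensor_affine:
  "tensor F (p + s *\<^sub>R x) = tensor (\<lambda>c t. F c (p $ c + s * t)) x"
  by (simp add: tensor_def)

lemma ptest_translate:
  assumes "ptest a b \<phi>"
  shows "ptest (a + y) (b + y) (\<lambda>x. \<phi> (x - y))"
proof -
  obtain F where F: "\<forall>c. smooth1 (F c)" "\<forall>c t. t \<notin> {a $ c..b $ c} \<longrightarrow> F c t = 0" "\<phi> = tensor F"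
    using assms unfolding ptest_def by blast
  have "(\<lambda>x. \<phi> (x - y)) = tensor (\<lambda>c t. F c ((- y) $ c + 1 * t))"
    unfolding F(3) tensor_affine[symmetric] by (simp add: fun_eq_iff)
  moreover have "F c ((- y) $ c + 1 * t) = 0" if "t \<notin> {(a + y) $ c..(b + y) $ c}" for c t
    using that by (intro F(2)[rule_format]) auto
  ultimately show ?thesis
    using F(1) by (simp only:) (intro ptestI smooth1_affine; simp)
qed

lemma ptest_reflect:
  fixes a :: "real^'n::finite"
  assumes "ptest a b \<phi>"
  shows "ptest (- b) (- a) (\<lambda>x. \<phi> (- x))"
proof -
  obtain F where F: "\<forall>c. smooth1 (F c)" "\<forall>c t. t \<notin> {a $ c..b $ c} \<longrightarrow> F c t = 0" "\<phi> = tensor F"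
    using assms unfolding ptest_def by blast
  have "(\<lambda>x. \<phi> (- x)) = tensor (\<lambda>c t. F c ((0::real^'n) $ c + (-1) * t))"
    unfolding F(3) tensor_affine[symmetric] by (simp add: fun_eq_iff)
  moreover have "F c ((0::real^'n) $ c + (-1) * t) = 0" if "t \<notin> {(- b) $ c..(- a) $ c}" for c t
    using that by (intro F(2)[rule_format]) auto
  ultimately show ?thesis
    using F(1) by (simp only:) (intro ptestI smooth1_affine; simp)
qed

lemma frechet_derivative_affine:
  fixes f :: "'a::real_normed_vector \<Rightarrow> real"
  assumes "f differentiable at (p + s *\<^sub>R x)"
  shows "((\<lambda>x. f (p + s *\<^sub>R x)) has_derivative (\<lambda>h. s * frechet_derivative f (at (p + s *\<^sub>R x)) h)) (at x)"
proof -
  have f: "(f has_derivative frechet_derivative f (at (p + s *\<^sub>R x))) (at (p + s *\<^sub>R x))"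
    using assms by (simp add: frechet_derivative_works)
  have "((\<lambda>x. p + s *\<^sub>R x) has_derivative (\<lambda>h. s *\<^sub>R h)) (at x)"
    by (auto intro!: derivative_eq_intros)
  from has_derivative_compose[OF this f] show ?thesis
    by (simp add: linear_frechet_derivative[OF assms, THEN linear_cmul] o_def)
qed

lemma pd_affine:
  assumes "\<And>x. f differentiable at x"
  shows "pd i (\<lambda>x. f (p + s *\<^sub>R x)) x = s * pd i f (p + s *\<^sub>R x)"
  unfolding pd_def frechet_derivative_at[OF frechet_derivative_affine[OF assms], symmetric] ..

lemma ptest_differentiable: "ptest a b \<phi> \<Longrightarrow> \<phi> differentiable at x"
  by (rule differentiableI[OF ptest_has_derivative])

lemma pd_translate: "ptest a b \<phi> \<Longrightarrow> pd i (\<lambda>x. \<phi> (x - y)) x = pd i \<phi> (x - y)"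
  using pd_affine[of \<phi> i "- y" 1 x] ptest_differentiable[of a b \<phi>] by simp

lemma pd_reflect: "ptest a b \<phi> \<Longrightarrow> pd i (\<lambda>x. \<phi> (- x)) x = - pd i \<phi> (- x)"
  using pd_affine[of \<phi> i 0 "-1" x] ptest_differentiable[of a b \<phi>] by simp

text \<open>Since \<open>eta\<close> vanishes on the negative axis and \<open>eta (k * t)\<close>
  tends to 1 for t > 0, these bumps converge to the indicator of the open box while staying in
  [0, 1]; dominated convergence then turns pairings with bumps into integrals over boxes.\<close>

definition box_bump :: "real^'n::finite \<Rightarrow> real^'n \<Rightarrow> nat \<Rightarrow> real^'n \<Rightarrow> real" where
  "box_bump a b k = tensor (\<lambda>c t. eta (real k * (t - a $ c)) * eta (real k * (b $ c - t)))"

lemma ptest_box_bump: "ptest a b (box_bump a b k)"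
  unfolding box_bump_def
proof (rule ptestI)
  fix c
  show "smooth1 (\<lambda>t. eta (real k * (t - a $ c)) * eta (real k * (b $ c - t)))"
    using smooth1_affine[OF smooth1_eta, of "- real k * a $ c" "real k"]
      smooth1_affine[OF smooth1_eta, of "real k * b $ c" "- real k"]
    by (intro smooth1_mult) (simp_all add: algebra_simps)
qed (auto simp: eta_def zero_less_mult_iff)

lemma box_bump_bounds: "0 \<le> box_bump a b k x" "box_bump a b k x \<le> 1"
  by (auto simp: box_bump_def tensor_def eta_nonneg eta_le_1 mult_le_one intro!: prod_nonneg prod_le_1)

lemma box_bump_tendsto: "(\<lambda>k. box_bump a b k x) \<longlonglongrightarrow> indicator (box a b) x"
proof (cases "x \<in> box a b")
  case True
  have eta_lim: "(\<lambda>k. eta (real k * t)) \<longlonglongrightarrow> 1" if "t > 0" for t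
  proof -
    have "(\<lambda>k. exp (- ((1 / t) * (1 / real k)))) \<longlonglongrightarrow> exp (- ((1 / t) * 0))"
      by (intro tendsto_intros lim_1_over_n)
    then have "(\<lambda>k. exp (- ((1 / t) * (1 / real k)))) \<longlonglongrightarrow> 1" by simp
    moreover have "\<forall>\<^sub>F k in sequentially. exp (- ((1 / t) * (1 / real k))) = eta (real k * t)"
      using eventually_gt_at_top[of 0]
      by eventually_elim (use that in \<open>simp add: eta_def mult.commute\<close>)
    ultimately show ?thesis by (rule Lim_transform_eventually)
  qed
  have "(\<lambda>k. box_bump a b k x) \<longlonglongrightarrow> (\<Prod>c\<in>(UNIV::'a set). 1 * 1)"
    unfolding box_bump_def tensor_def
    using True by (intro tendsto_prod tendsto_mult eta_lim) (auto simp: mem_box_cart)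
  with True show ?thesis by simp
next
  case False
  then have "box_bump a b k x = 0" for k
  proof -
    obtain i where "\<not> (a $ i < x $ i \<and> x $ i < b $ i)" using False by (auto simp: mem_box_cart)
    then show ?thesis
      unfolding box_bump_def tensor_def by (intro prod_zero bexI[of _ i]) (auto simp: eta_def zero_less_mult_iff)
  qed
  with False show ?thesis by simp
qed

section \<open>The fundamental lemma of the calculus of variations\<close>

lemma lebesgue_translate:
  "lebesgue = distr lebesgue lebesgue (\<lambda>x::'a::euclidean_space. x + y)"
  and measurable_translate [measurable]: "(\<lambda>x::'a::euclidean_space. x + y) \<in> lebesgue \<rightarrow>\<^sub>M lebesgue"
proof -
  have *: "(\<lambda>x::'a. y + (\<Sum>j\<in>Basis. (1 * (x \<bullet> j)) *\<^sub>R j)) = (\<lambda>x. x + y)"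
    by (simp add: euclidean_representation add.commute)
  show "lebesgue = distr lebesgue lebesgue (\<lambda>x::'a. x + y)"
    using lebesgue_affine_euclidean[of "\<lambda>_. 1" y] unfolding * by (simp add: density_1)
  show "(\<lambda>x::'a. x + y) \<in> lebesgue \<rightarrow>\<^sub>M lebesgue"
    using lebesgue_affine_measurable[of "\<lambda>_. 1" y] unfolding * by simp
qed

lemma lebesgue_reflect:
  "lebesgue = distr lebesgue lebesgue (\<lambda>x::'a::euclidean_space. - x)"
  and measurable_reflect: "(\<lambda>x::'a::euclidean_space. - x) \<in> lebesgue \<rightarrow>\<^sub>M lebesgue"
proof -
  have *: "(\<lambda>x::'a. 0 + (\<Sum>j\<in>Basis. (- 1 * (x \<bullet> j)) *\<^sub>R j)) = (\<lambda>x. - x)"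
    by (simp add: sum_negf euclidean_representation)
  show "lebesgue = distr lebesgue lebesgue (\<lambda>x::'a. - x)"
    using lebesgue_affine_euclidean[of "\<lambda>_. -1" "0::'a"] unfolding * by (simp add: density_1)
  show "(\<lambda>x::'a. - x) \<in> lebesgue \<rightarrow>\<^sub>M lebesgue"
    using lebesgue_affine_measurable[of "\<lambda>_. -1" "0::'a"] unfolding * by simp
qed

lemma AE_translate:
  fixes y :: "'a::euclidean_space"
  assumes "AE x in lebesgue. P x"
  shows "AE x in lebesgue. P (x + y)"
proof -
  have "AE x in distr lebesgue lebesgue (\<lambda>x. x + y). P x"
    by (subst lebesgue_translate[symmetric]) (rule assms)
  from AE_distrD[OF measurable_translate this] show ?thesis .
qed

lemma measurable_lebesgue_translate:
  "f \<in> borel_measurable lebesgue \<Longrightarrow> (\<lambda>x. f (x + y)) \<in> borel_measurable (lebesgue :: 'a::euclidean_space measure)"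
  by (rule measurable_compose[OF measurable_translate])

lemma
  fixes f :: "'a::euclidean_space \<Rightarrow> 'b::{banach, second_countable_topology}"
  shows integrable_translate: "integrable lebesgue f \<Longrightarrow> integrable lebesgue (\<lambda>x. f (x + y))"
    and integral_translate: "integral\<^sup>L lebesgue (\<lambda>x. f (x + y)) = integral\<^sup>L lebesgue f"
proof -
  have 1: "integrable lebesgue (\<lambda>x. g (x + z))" if "integrable lebesgue g" for g :: "'a \<Rightarrow> 'b" and z
  proof (rule integrable_distr[OF measurable_translate])
    show "integrable (distr lebesgue lebesgue (\<lambda>x. x + z)) g"
      by (subst lebesgue_translate[symmetric]) (rule that)
  qed
  then show "integrable lebesgue f \<Longrightarrow> integrable lebesgue (\<lambda>x. f (x + y))" .
  show "integral\<^sup>L lebesgue (\<lambda>x. f (x + y)) = integral\<^sup>L lebesgue f"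
  proof (cases "integrable lebesgue f")
    case True
    have "integral\<^sup>L lebesgue f = integral\<^sup>L (distr lebesgue lebesgue (\<lambda>x. x + y)) f"
      by (subst lebesgue_translate[symmetric]) (rule refl)
    also have "\<dots> = integral\<^sup>L lebesgue (\<lambda>x. f (x + y))"
      using True by (intro integral_distr measurable_translate) auto
    finally show ?thesis by simp
  next
    case False
    then have "\<not> integrable lebesgue (\<lambda>x. f (x + y))"
      using 1[of "\<lambda>x. f (x + y)" "- y"] by auto
    with False show ?thesis by (simp add: not_integrable_integral_eq)
  qed
qed

lemma
  fixes f :: "'a::euclidean_space \<Rightarrow> 'b::{banach, second_countable_topology}"
  shows integrable_reflect: "integrable lebesgue f \<Longrightarrow> integrable lebesgue (\<lambda>x. f (- x))"
    and integral_reflect: "integral\<^sup>L lebesgue (\<lambda>x. f (- x)) = integral\<^sup>L lebesgue f"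
proof -
  have 1: "integrable lebesgue (\<lambda>x. g (- x))" if "integrable lebesgue g" for g :: "'a \<Rightarrow> 'b"
  proof (rule integrable_distr[OF measurable_reflect])
    show "integrable (distr lebesgue lebesgue uminus) g"
      by (subst lebesgue_reflect[symmetric]) (rule that)
  qed
  then show "integrable lebesgue f \<Longrightarrow> integrable lebesgue (\<lambda>x. f (- x))" .
  show "integral\<^sup>L lebesgue (\<lambda>x. f (- x)) = integral\<^sup>L lebesgue f"
  proof (cases "integrable lebesgue f")
    case True
    have "integral\<^sup>L lebesgue f = integral\<^sup>L (distr lebesgue lebesgue (\<lambda>x::'a. - x)) f"
      by (subst lebesgue_reflect[symmetric]) (rule refl)
    also have "\<dots> = integral\<^sup>L lebesgue (\<lambda>x. f (- x))"
      using True by (intro integral_distr measurable_reflect) auto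
    finally show ?thesis by simp
  next
    case False
    then have "\<not> integrable lebesgue (\<lambda>x. f (- x))"
      using 1[of "\<lambda>x. f (- x)"] by auto
    with False show ?thesis by (simp add: not_integrable_integral_eq)
  qed
qed

text \<open>Lebesgue measure is the completion of \<open>lborel\<close>, and only
  \<open>lborel\<close> has well-behaved products. Each use of Fubini below passes through such a
  representative.\<close>

lemma borel_representative:
  fixes f :: "'a::euclidean_space \<Rightarrow> complex"
  assumes "f \<in> borel_measurable lebesgue"
  obtains f' where "f' \<in> borel_measurable borel" "AE x in lebesgue. f x = f' x"
proof -
  obtain g h where g: "g \<in> borel_measurable lborel" "AE x in lborel. Re (f x) = g x"
    and h: "h \<in> borel_measurable lborel" "AE x in lborel. Im (f x) = h x"
    using completion_ex_borel_measurable_real[of "\<lambda>x. Re (f x)" lborel]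
      completion_ex_borel_measurable_real[of "\<lambda>x. Im (f x)" lborel] assms by auto
  have [measurable]: "g \<in> borel_measurable borel" "h \<in> borel_measurable borel"
    using g h by auto
  have "AE x in lebesgue. Re (f x) = g x" "AE x in lebesgue. Im (f x) = h x"
    using g(2) h(2) by (auto intro: AE_completion)
  then have "AE x in lebesgue. f x = Complex (g x) (h x)"
    by eventually_elim (simp add: complex_eq_iff)
  moreover have "(\<lambda>x. Complex (g x) (h x)) \<in> borel_measurable borel"
    unfolding Complex_eq by measurable
  ultimately show thesis using that by blast
qed

text \<open>Boxes form an intersection-stable generator of the Borel sets, and the sets over which f
  integrates to 0 form a Dynkin system. So all Borel sets have integral 0, and a density with this
  property vanishes almost everywhere.\<close>

lemma AE_0_of_box_integrals:
  fixes f :: "'a::euclidean_space \<Rightarrow> complex"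
  assumes f: "integrable lebesgue f"
    and 0: "\<And>a b. integral\<^sup>L lebesgue (\<lambda>x. indicator (box a b) x *\<^sub>R f x) = 0"
  shows "AE x in lebesgue. f x = 0"
proof -
  obtain f' where [measurable]: "f' \<in> borel_measurable borel" and ff': "AE x in lebesgue. f x = f' x"
    using borel_representative[OF borel_measurable_integrable[OF f]] .
  have "integrable lebesgue f'"
    by (rule integrable_cong_AE_imp[OF f _ ff']) (simp add: measurable_completion)
  then have f'_int: "integrable lborel f'"
    by (simp add: integrable_completion)
  have box0: "(LINT x:box a b|lborel. f' x) = 0" for a b
  proof -
    have "(LINT x:box a b|lborel. f' x) = integral\<^sup>L lebesgue (\<lambda>x. indicator (box a b) x *\<^sub>R f' x)"
      unfolding set_lebesgue_integral_def by (subst integral_completion) auto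
    also have "\<dots> = integral\<^sup>L lebesgue (\<lambda>x. indicator (box a b) x *\<^sub>R f x)"
    proof (intro integral_cong_AE borel_measurable_scaleR borel_measurable_indicator)
      show "AE x in lebesgue. indicat_real (box a b) x *\<^sub>R f' x = indicat_real (box a b) x *\<^sub>R f x"
        using ff' by eventually_elim simp
    qed (use f in \<open>auto simp: measurable_completion\<close>)
    finally show ?thesis using 0 by simp
  qed
  have set_int: "set_integrable lborel A f'" if "A \<in> sets borel" for A
    unfolding set_integrable_def using that f'_int by (intro integrable_mult_indicator) auto
  \<comment> \<open>Complements need the integral over the whole space, which is the limit over the
    cubes (-n, n)^d.\<close>
  have full: "integral\<^sup>L lborel f' = 0"
  proof -
    have "(\<lambda>n::nat. LINT x:box (- real n *\<^sub>R One) (real n *\<^sub>R One)|lborel. f' x)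
        \<longlonglongrightarrow> (LINT x:(\<Union>n::nat. box (- real n *\<^sub>R One) (real n *\<^sub>R One))|lborel. f' x)"
    proof (rule set_integral_cont_up)
      show "incseq (\<lambda>n::nat. box (- real n *\<^sub>R One) (real n *\<^sub>R One) :: 'a set)"
      proof (intro incseq_SucI subsetI)
        fix n :: nat and x :: 'a assume "x \<in> box (- real n *\<^sub>R One) (real n *\<^sub>R One)"
        then show "x \<in> box (- real (Suc n) *\<^sub>R One) (real (Suc n) *\<^sub>R One)"
          by (fastforce simp: mem_box)
      qed
      show "set_integrable lborel (\<Union>n::nat. box (- real n *\<^sub>R One) (real n *\<^sub>R One)) f'"
        by (rule set_int) (simp add: UN_box_eq_UNIV)
    qed simp
    then have "(LINT x:(\<Union>n::nat. box (- real n *\<^sub>R One) (real n *\<^sub>R One))|lborel. f' x) = 0"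
      unfolding box0 by (simp add: LIMSEQ_const_iff)
    then show ?thesis
      by (simp add: UN_box_eq_UNIV set_lebesgue_integral_def)
  qed
  have all0: "(LINT x:A|lborel. f' x) = 0" if A: "A \<in> sets borel" for A
  proof -
    have Int: "Int_stable (range (\<lambda>(a, b). box a b :: 'a set))"
      by (auto simp: Int_stable_def box_Int_box)
    have Pw: "range (\<lambda>(a, b). box a b :: 'a set) \<subseteq> Pow UNIV" by simp
    have "A \<in> sigma_sets UNIV (range (\<lambda>(a, b). box a b :: 'a set))"
      using A unfolding borel_eq_box by simp
    from Int Pw this show ?thesis
    proof (induction rule: sigma_sets_induct_disjoint)
      case (basic A) then show ?case using box0 by auto
    next
      case empty show ?case by (simp add: set_lebesgue_integral_def)
    next
      case (compl A)
      then have [measurable]: "A \<in> sets borel" unfolding borel_eq_box by simp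
      have "(LINT x:UNIV|lborel. f' x) = (LINT x:A|lborel. f' x) + (LINT x:UNIV - A|lborel. f' x)"
        using set_integral_Un[of A "UNIV - A" lborel f'] set_int by (simp add: Un_absorb1)
      then show ?case using compl full by (simp add: set_lebesgue_integral_def)
    next
      case (union A)
      then have A: "\<And>i. A i \<in> sets borel" unfolding borel_eq_box by auto
      have "((LINT x:(\<Union>i. A i)|lborel. f' x)) = (\<Sum>i. (LINT x:(A i)|lborel. f' x))"
        using A union(1) set_int[of "\<Union>i. A i"] by (intro lebesgue_integral_countable_add) (auto simp: disjoint_family_on_def)
      then show ?case using union by simp
    qed
  qed
  have "AE x in lborel. f' x = 0"
    by (rule sigma_finite_measure.density_zero[OF lborel.sigma_finite_measure_axioms f'_int]) (use all0 in simp)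
  then have "AE x in lebesgue. f' x = 0" by (rule AE_completion)
  with ff' show ?thesis by eventually_elim simp
qed

text \<open>Local integrability is asked on closed boxes only, because these are the supports of the
  product test functions.\<close>

definition loc_int :: "(real^'n::finite) set \<Rightarrow> (real^'n \<Rightarrow> complex) \<Rightarrow> bool" where
  "loc_int U f \<longleftrightarrow> (\<forall>a b. cbox a b \<subseteq> U \<longrightarrow> set_integrable lebesgue (cbox a b) f)"

abbreviation pair_int :: "(real^'n::finite \<Rightarrow> complex) \<Rightarrow> (real^'n \<Rightarrow> real) \<Rightarrow> complex" where
  "pair_int f \<phi> \<equiv> integral\<^sup>L lebesgue (\<lambda>x. f x * of_real (\<phi> x))"

lemma ptest_lebesgue_measurable:
  "ptest a b \<phi> \<Longrightarrow> (\<lambda>x. of_real (\<phi> x) :: complex) \<in> borel_measurable lebesgue"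
  by (rule measurable_completion) (auto intro!: borel_measurable_of_real ptest_measurable)

lemma integrable_bounded_mult:
  fixes f g :: "'a \<Rightarrow> complex"
  assumes "integrable M f" "g \<in> borel_measurable M" "\<And>x. norm (g x) \<le> B"
  shows "integrable M (\<lambda>x. f x * g x)"
proof (rule Bochner_Integration.integrable_bound)
  show "integrable M (\<lambda>x. B * norm (f x))" using assms(1) by auto
  show "AE x in M. norm (f x * g x) \<le> norm (B * norm (f x))"
  proof (rule AE_I2)
    fix x
    have "norm (f x * g x) \<le> norm (f x) * B"
      unfolding norm_mult by (intro mult_left_mono assms(3)) auto
    also have "\<dots> \<le> norm (B * norm (f x))" by (simp add: mult.commute)
    finally show "norm (f x * g x) \<le> norm (B * norm (f x))" .
  qed
qed (use assms in auto)

lemma ptest_cut: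
  assumes "ptest a b \<phi>" "cbox a b \<subseteq> C"
  shows "(\<lambda>x. f x * of_real (\<phi> x)) = (\<lambda>x. (indicator C x *\<^sub>R f x) * of_real (\<phi> x) :: complex)"
  using ptest_zero[OF assms(1)] assms(2) by (auto simp: indicator_def fun_eq_iff)

lemma ptest_integrable:
  assumes "ptest a b \<phi>" "cbox a b \<subseteq> U" "loc_int U f"
  shows "integrable lebesgue (\<lambda>x. f x * of_real (\<phi> x))"
proof -
  obtain B where B: "\<And>x. \<bar>\<phi> x\<bar> \<le> B" using ptest_bounded[OF assms(1)] by blast
  show ?thesis
  proof (subst ptest_cut[OF assms(1) subset_refl], rule integrable_bounded_mult)
    show "integrable lebesgue (\<lambda>x. indicat_real (cbox a b) x *\<^sub>R f x)"
      using assms(2,3) by (simp add: loc_int_def set_integrable_def)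
    show "norm (complex_of_real (\<phi> x)) \<le> B" for x using B by simp
  qed (rule ptest_lebesgue_measurable[OF assms(1)])
qed

text \<open>Bumps are admissible only on closed boxes inside the given one. On these the limit of
  bumps gives vanishing integrals; an arbitrary box, cut with the given one, is exhausted from
  inside.\<close>

lemma fundamental_lemma_box:
  assumes f: "set_integrable lebesgue (box a b) f"
    and 0: "\<And>a' b' \<phi>. ptest a' b' \<phi> \<Longrightarrow> cbox a' b' \<subseteq> box a b \<Longrightarrow> pair_int f \<phi> = 0"
  shows "AE x in lebesgue. x \<in> box a b \<longrightarrow> f x = 0"
proof -
  define F where "F x = indicator (box a b) x *\<^sub>R f x" for x
  have F: "integrable lebesgue F" using f unfolding F_def set_integrable_def .
  have box_m [measurable]: "(\<lambda>x. complex_of_real (indicat_real (box c d) x)) \<in> borel_measurable lebesgue" for c d :: "real^'a"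
    by (intro measurable_completion) (simp add: borel_measurable_indicator)
  have cb: "integral\<^sup>L lebesgue (\<lambda>x. indicator (box c d) x *\<^sub>R F x) = 0" if "cbox c d \<subseteq> box a b" for c d
  proof -
    have "(\<lambda>k. integral\<^sup>L lebesgue (\<lambda>x. F x * of_real (box_bump c d k x)))
        \<longlonglongrightarrow> integral\<^sup>L lebesgue (\<lambda>x. F x * of_real (indicator (box c d) x))"
    proof (rule integral_dominated_convergence[where w = "\<lambda>x. norm (F x)"])
      show "AE x in lebesgue. (\<lambda>k. F x * complex_of_real (box_bump c d k x)) \<longlonglongrightarrow> F x * complex_of_real (indicator (box c d) x)"
        by (intro AE_I2 tendsto_intros box_bump_tendsto)
      show "AE x in lebesgue. norm (F x * complex_of_real (box_bump c d k x)) \<le> norm (F x)" for k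
        using box_bump_bounds[of c d k] by (intro AE_I2) (auto simp: norm_mult mult_left_le)
    qed (use F in \<open>auto intro!: borel_measurable_times box_m ptest_lebesgue_measurable[OF ptest_box_bump] intro: borel_measurable_integrable\<close>)
    moreover have "integral\<^sup>L lebesgue (\<lambda>x. F x * of_real (box_bump c d k x)) = 0" for k
      using 0[OF ptest_box_bump that] ptest_cut[OF ptest_box_bump that, of f] by (simp add: F_def)
    ultimately have "integral\<^sup>L lebesgue (\<lambda>x. F x * of_real (indicator (box c d) x)) = 0"
      by (simp add: LIMSEQ_const_iff)
    moreover have "F x * of_real (indicator (box c d) x) = indicator (box c d) x *\<^sub>R F x" for x
      by (simp add: indicator_def)
    ultimately show ?thesis by simp
  qed
  have "integral\<^sup>L lebesgue (\<lambda>x. indicator (box c d) x *\<^sub>R F x) = 0" for c d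
  proof -
    \<comment> \<open>The corners of the intersection of the two boxes, moved inwards by 1/(k+1), so
      that even the closed box stays inside both.\<close>
    define l where "l k = (\<Sum>i\<in>Basis. (max (c \<bullet> i) (a \<bullet> i) + inverse (real (Suc k))) *\<^sub>R i)" for k
    define u where "u k = (\<Sum>i\<in>Basis. (min (d \<bullet> i) (b \<bullet> i) - inverse (real (Suc k))) *\<^sub>R i)" for k
    have li: "l k \<bullet> i = max (c \<bullet> i) (a \<bullet> i) + inverse (real (Suc k))"
      and ui: "u k \<bullet> i = min (d \<bullet> i) (b \<bullet> i) - inverse (real (Suc k))" if "i \<in> Basis" for i k
      using that by (simp_all add: l_def u_def)
    have pos: "0 < inverse (real (Suc k))" for k by simp
    have sub': "x \<in> box c d \<inter> box a b" if x: "x \<in> cbox (l k) (u k)" for x k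
    proof -
      have "c \<bullet> i < x \<bullet> i \<and> a \<bullet> i < x \<bullet> i \<and> x \<bullet> i < d \<bullet> i \<and> x \<bullet> i < b \<bullet> i" if i: "i \<in> Basis" for i
      proof -
        have "l k \<bullet> i \<le> x \<bullet> i" "x \<bullet> i \<le> u k \<bullet> i" using x i by (auto simp: mem_box)
        then show ?thesis using pos[of k] unfolding li[OF i] ui[OF i] by linarith
      qed
      then show ?thesis by (auto simp: mem_box)
    qed
    have sub: "cbox (l k) (u k) \<subseteq> box a b" for k
      using sub' by blast
    have lim: "(\<lambda>k. indicator (box (l k) (u k)) x :: real) \<longlonglongrightarrow> indicator (box c d \<inter> box a b) x" for x
    proof (cases "x \<in> box c d \<inter> box a b")
      case True
      have "\<forall>\<^sub>F k in sequentially. \<forall>i\<in>Basis. l k \<bullet> i < x \<bullet> i \<and> x \<bullet> i < u k \<bullet> i"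
      proof (intro eventually_ball_finite ballI eventually_conj finite_Basis)
        fix i :: "real^'a" assume i: "i \<in> Basis"
        have "(\<lambda>k. l k \<bullet> i) \<longlonglongrightarrow> max (c \<bullet> i) (a \<bullet> i) + 0" "(\<lambda>k. u k \<bullet> i) \<longlonglongrightarrow> min (d \<bullet> i) (b \<bullet> i) - 0"
          unfolding li[OF i] ui[OF i] by (intro tendsto_intros LIMSEQ_inverse_real_of_nat)+
        then show "\<forall>\<^sub>F k in sequentially. l k \<bullet> i < x \<bullet> i" "\<forall>\<^sub>F k in sequentially. x \<bullet> i < u k \<bullet> i"
          using True i by (auto intro!: order_tendstoD simp: mem_box)
      qed
      then have "\<forall>\<^sub>F k in sequentially. indicator (box c d \<inter> box a b) x = (indicator (box (l k) (u k)) x :: real)"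
        by eventually_elim (use True in \<open>auto simp: mem_box\<close>)
      then show ?thesis by (rule Lim_transform_eventually[OF tendsto_const])
    next
      case False
      have "x \<notin> box (l k) (u k)" for k
        using sub'[of x k] False box_subset_cbox[of "l k" "u k"] by blast
      with False show ?thesis by simp
    qed
    have "(\<lambda>k. integral\<^sup>L lebesgue (\<lambda>x. indicator (box (l k) (u k)) x *\<^sub>R F x))
        \<longlonglongrightarrow> integral\<^sup>L lebesgue (\<lambda>x. indicator (box c d \<inter> box a b) x *\<^sub>R F x)"
    proof (rule integral_dominated_convergence[where w = "\<lambda>x. norm (F x)"])
      show "AE x in lebesgue. (\<lambda>k. indicat_real (box (l k) (u k)) x *\<^sub>R F x)
          \<longlonglongrightarrow> indicat_real (box c d \<inter> box a b) x *\<^sub>R F x"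
        by (intro AE_I2 tendsto_scaleR lim tendsto_const)
      show "AE x in lebesgue. norm (indicat_real (box (l k) (u k)) x *\<^sub>R F x) \<le> norm (F x)" for k
        by (intro AE_I2) (simp add: indicator_def)
    qed (use F in \<open>auto intro!: borel_measurable_scaleR borel_measurable_indicator sets.Int\<close>)
    then have "integral\<^sup>L lebesgue (\<lambda>x. indicator (box c d \<inter> box a b) x *\<^sub>R F x) = 0"
      by (simp add: cb[OF sub] LIMSEQ_const_iff)
    moreover have "indicator (box c d \<inter> box a b) x *\<^sub>R F x = indicator (box c d) x *\<^sub>R F x" for x
      by (simp add: F_def indicator_def)
    ultimately show ?thesis by simp
  qed
  from AE_0_of_box_integrals[OF F this] show ?thesis
    by eventually_elim (auto simp: F_def)
qed

lemma AE_open_of_cboxes: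
  fixes U :: "'a::euclidean_space set"
  assumes "open U" "\<And>a b. cbox a b \<subseteq> U \<Longrightarrow> AE x in lebesgue. x \<in> cbox a b \<longrightarrow> P x"
  shows "AE x in lebesgue. x \<in> U \<longrightarrow> P x"
proof -
  obtain D where D: "countable D" "D \<subseteq> Pow U" "\<And>X. X \<in> D \<Longrightarrow> \<exists>a b. X = cbox a b" "\<Union>D = U"
    by (rule open_countable_Union_open_cbox[OF assms(1)]) (rule that; assumption)
  have "AE x in lebesgue. \<forall>X\<in>D. x \<in> X \<longrightarrow> P x"
  proof (subst AE_ball_countable[OF D(1)], intro ballI)
    fix X assume "X \<in> D"
    then obtain a b where "X = cbox a b" "cbox a b \<subseteq> U" using D(2,3) by blast
    then show "AE x in lebesgue. x \<in> X \<longrightarrow> P x" using assms(2) by blast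
  qed
  then show ?thesis unfolding D(4)[symmetric] by eventually_elim blast
qed

lemma fundamental_lemma:
  assumes U: "open U" and f: "loc_int U f"
    and 0: "\<And>a b \<phi>. ptest a b \<phi> \<Longrightarrow> cbox a b \<subseteq> U \<Longrightarrow> pair_int f \<phi> = 0"
  shows "AE x in lebesgue. x \<in> U \<longrightarrow> f x = 0"
proof (rule AE_open_of_cboxes[OF U])
  fix a b assume ab: "cbox a b \<subseteq> U"
  have "AE x in lebesgue. x \<in> box a b \<longrightarrow> f x = 0"
  proof (rule fundamental_lemma_box)
    show "set_integrable lebesgue (box a b) f"
      by (rule set_integrable_subset[of lebesgue "cbox a b"]) (use f ab in \<open>auto simp: loc_int_def box_subset_cbox\<close>)
  qed (use 0 ab box_subset_cbox[of a b] in blast)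
  moreover have "AE x in lebesgue. x \<notin> cbox a b - box a b"
    using negligible_frontier_interval[of a b] by (intro AE_not_in) (simp add: negligible_iff_null_sets)
  ultimately show "AE x in lebesgue. x \<in> cbox a b \<longrightarrow> f x = 0"
    by eventually_elim blast
qed

section \<open>Fields with vanishing weak symmetric gradient\<close>

lemma ptest_line_deriv:
  assumes "ptest a b \<phi>"
  shows "((\<lambda>s. \<phi> (x - s *\<^sub>R y)) has_real_derivative - (\<Sum>c\<in>UNIV. y $ c * pd c \<phi> (x - s *\<^sub>R y))) (at s)"
proof -
  have "((\<lambda>s. x - s *\<^sub>R y) has_derivative (\<lambda>h. - (h *\<^sub>R y))) (at s)"
    by (auto intro!: derivative_eq_intros)
  note d = has_derivative_compose[OF this ptest_has_derivative[OF assms]]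
  have "(\<lambda>h. \<Sum>c\<in>UNIV. (- (h *\<^sub>R y)) $ c * pd c \<phi> (x - s *\<^sub>R y)) = (*) (- (\<Sum>c\<in>UNIV. y $ c * pd c \<phi> (x - s *\<^sub>R y)))"
    by (simp add: fun_eq_iff sum_negf sum_distrib_left mult_ac)
  with d show ?thesis
    by (simp add: has_field_derivative_def)
qed

lemma ptest_line_bound:
  assumes "ptest a b \<phi>"
  obtains L where "L \<ge> 0" "\<And>x. \<bar>\<Sum>c\<in>UNIV. y $ c * pd c \<phi> x\<bar> \<le> L"
    "\<And>x s t. \<bar>\<phi> (x - s *\<^sub>R y) - \<phi> (x - t *\<^sub>R y)\<bar> \<le> L * \<bar>s - t\<bar>"
proof -
  have "\<forall>c. \<exists>B>0. \<forall>x. \<bar>pd c \<phi> x\<bar> \<le> B"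
    using ptest_bounded[OF ptest_pd[OF assms]] by blast
  then have "\<forall>c. \<exists>B. B > 0 \<and> (\<forall>x. \<bar>pd c \<phi> x\<bar> \<le> B)" by blast
  from choice[OF this] obtain B where "\<forall>c. B c > 0 \<and> (\<forall>x. \<bar>pd c \<phi> x\<bar> \<le> B c)" ..
  then have B: "\<And>c. B c > 0" "\<And>c x. \<bar>pd c \<phi> x\<bar> \<le> B c" by auto
  define L where "L = (\<Sum>c\<in>UNIV. \<bar>y $ c\<bar> * B c)"
  have L: "\<bar>\<Sum>c\<in>UNIV. y $ c * pd c \<phi> x\<bar> \<le> L" for x
    unfolding L_def by (rule order_trans[OF sum_abs]) (auto simp: abs_mult intro!: sum_mono mult_left_mono B)
  have "\<bar>\<phi> (x - s *\<^sub>R y) - \<phi> (x - t *\<^sub>R y)\<bar> \<le> L * \<bar>s - t\<bar>" for x s t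
  proof -
    have "norm (\<phi> (x - s *\<^sub>R y) - \<phi> (x - t *\<^sub>R y)) \<le> L * norm (s - t)"
      by (rule field_differentiable_bound[where S = UNIV and f = "\<lambda>s. \<phi> (x - s *\<^sub>R y)"
            and f' = "\<lambda>s. - (\<Sum>c\<in>UNIV. y $ c * pd c \<phi> (x - s *\<^sub>R y))"])
        (use ptest_line_deriv[OF assms] L in auto)
    then show ?thesis by simp
  qed
  moreover have "L \<ge> 0" unfolding L_def by (intro sum_nonneg mult_nonneg_nonneg) (auto simp: less_imp_le[OF B(1)])
  ultimately show thesis using L that by blast
qed

text \<open>Differentiation under the integral along a line: the bump is Lipschitz in the direction
  y with some constant L, which also bounds its directional derivative, so the error of the
  difference quotient is dominated by 2 L |F|.\<close>

lemma pair_int_line_deriv: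
  assumes F: "integrable lebesgue F" and \<phi>: "ptest a b \<phi>"
  shows "((\<lambda>t. pair_int F (\<lambda>x. \<phi> (x - t *\<^sub>R y))) has_vector_derivative
      - (\<Sum>c\<in>UNIV. of_real (y $ c) * pair_int F (\<lambda>x. pd c \<phi> (x - t *\<^sub>R y)))) (at t)"
proof -
  obtain L where L0: "L \<ge> 0" and L: "\<And>x. \<bar>\<Sum>c\<in>UNIV. y $ c * pd c \<phi> x\<bar> \<le> L"
    "\<And>x s t. \<bar>\<phi> (x - s *\<^sub>R y) - \<phi> (x - t *\<^sub>R y)\<bar> \<le> L * \<bar>s - t\<bar>"
    by (rule ptest_line_bound[OF \<phi>, of y]) (rule that; assumption)
  define G where "G t = pair_int F (\<lambda>x. \<phi> (x - t *\<^sub>R y))" for t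
  define q where "q x = (\<Sum>c\<in>UNIV. y $ c * pd c \<phi> (x - t *\<^sub>R y))" for x
  define D where "D = - (\<Sum>c\<in>UNIV. of_real (y $ c) * pair_int F (\<lambda>x. pd c \<phi> (x - t *\<^sub>R y)))"
  have int: "integrable lebesgue (\<lambda>x. F x * of_real (\<psi> (x - s *\<^sub>R y)))" if \<psi>: "ptest a b \<psi>" for \<psi> s
  proof -
    obtain B where B: "\<And>x. \<bar>\<psi> x\<bar> \<le> B" using ptest_bounded[OF \<psi>] by blast
    show ?thesis
      by (rule integrable_bounded_mult[OF F ptest_lebesgue_measurable[OF ptest_translate[OF \<psi>]], where B = B])
        (use B in simp)
  qed
  have D_eq: "D = - integral\<^sup>L lebesgue (\<lambda>x. F x * of_real (q x))"
  proof -
    have "integral\<^sup>L lebesgue (\<lambda>x. \<Sum>c\<in>UNIV. of_real (y $ c) * (F x * of_real (pd c \<phi> (x - t *\<^sub>R y))))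
        = (\<Sum>c\<in>UNIV. integral\<^sup>L lebesgue (\<lambda>x. of_real (y $ c) * (F x * of_real (pd c \<phi> (x - t *\<^sub>R y)))))"
      using int[OF ptest_pd[OF \<phi>]] by (intro Bochner_Integration.integral_sum) auto
    then have "integral\<^sup>L lebesgue (\<lambda>x. \<Sum>c\<in>UNIV. of_real (y $ c) * (F x * of_real (pd c \<phi> (x - t *\<^sub>R y)))) = - D"
      unfolding D_def by simp
    moreover have "(\<lambda>x. \<Sum>c\<in>UNIV. of_real (y $ c) * (F x * of_real (pd c \<phi> (x - t *\<^sub>R y))))
        = (\<lambda>x. F x * of_real (q x))"
      by (simp add: q_def fun_eq_iff sum_distrib_left mult_ac)
    ultimately show ?thesis by simp
  qed
  have qm: "(\<lambda>x. complex_of_real (q x)) \<in> borel_measurable lebesgue"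
    unfolding q_def of_real_sum of_real_mult
    by (intro borel_measurable_sum borel_measurable_times borel_measurable_const
        ptest_lebesgue_measurable[OF ptest_translate[OF ptest_pd[OF \<phi>]]])
  have intq: "integrable lebesgue (\<lambda>x. F x * of_real (q x))"
    by (rule integrable_bounded_mult[OF F qm, of L]) (use L(1) in \<open>simp only: q_def norm_of_real\<close>)
  \<comment> \<open>The integrand of the difference quotient minus the claimed derivative, which is
    that of -q.\<close>
  define R where "R h x = F x * of_real ((\<phi> (x - (t + h) *\<^sub>R y) - \<phi> (x - t *\<^sub>R y)) / h + q x)" for h x
  have R_int: "integral\<^sup>L lebesgue (R h) = (G (t + h) - G t) / of_real h - D" if "h \<noteq> 0" for h
  proof -
    have "R h = (\<lambda>x. (F x * of_real (\<phi> (x - (t + h) *\<^sub>R y)) - F x * of_real (\<phi> (x - t *\<^sub>R y))) / of_real h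
        + F x * of_real (q x))"
      using that by (simp add: R_def fun_eq_iff field_simps)
    then show ?thesis
      unfolding G_def D_eq using int[OF \<phi>] intq by simp
  qed
  have "((\<lambda>h. norm (G (t + h) - G t - h *\<^sub>R D) / norm h) \<longlongrightarrow> 0) (at 0)"
    unfolding tendsto_at_iff_sequentially
  proof (intro allI impI)
    fix h :: "nat \<Rightarrow> real" assume h: "\<forall>i. h i \<in> UNIV - {0}" "h \<longlonglongrightarrow> 0"
    have lim: "(\<lambda>i. integral\<^sup>L lebesgue (R (h i))) \<longlonglongrightarrow> integral\<^sup>L lebesgue (\<lambda>x::real^'a. 0)"
    proof (rule integral_dominated_convergence[where w = "\<lambda>x. (2 * L) * norm (F x)"])
      show "AE x in lebesgue. (\<lambda>i. R (h i) x) \<longlonglongrightarrow> 0"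
      proof (rule AE_I2)
        fix x
        have "((\<lambda>k. (\<phi> (x - (t + k) *\<^sub>R y) - \<phi> (x - t *\<^sub>R y)) / k) \<longlongrightarrow> - q x) (at 0)"
          using ptest_line_deriv[OF \<phi>, of x y t] unfolding DERIV_def q_def .
        then have "(\<lambda>i. (\<phi> (x - (t + h i) *\<^sub>R y) - \<phi> (x - t *\<^sub>R y)) / h i) \<longlonglongrightarrow> - q x"
          using h unfolding tendsto_at_iff_sequentially by (auto simp: o_def)
        then have "(\<lambda>i. F x * of_real ((\<phi> (x - (t + h i) *\<^sub>R y) - \<phi> (x - t *\<^sub>R y)) / h i + q x)) \<longlonglongrightarrow> F x * of_real (- q x + q x)"
          by (intro tendsto_intros)
        then show "(\<lambda>i. R (h i) x) \<longlonglongrightarrow> 0" by (simp add: R_def)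
      qed
      show "AE x in lebesgue. norm (R (h i) x) \<le> (2 * L) * norm (F x)" for i
      proof (rule AE_I2)
        fix x
        have "\<bar>\<phi> (x - (t + h i) *\<^sub>R y) - \<phi> (x - t *\<^sub>R y)\<bar> \<le> L * \<bar>h i\<bar>" using L(2)[of x "t + h i" t] by simp
        then have "\<bar>(\<phi> (x - (t + h i) *\<^sub>R y) - \<phi> (x - t *\<^sub>R y)) / h i\<bar> \<le> L"
          using h(1) by (simp add: abs_divide divide_le_eq)
        moreover have "\<bar>q x\<bar> \<le> L" using L(1) by (simp add: q_def)
        ultimately have "\<bar>(\<phi> (x - (t + h i) *\<^sub>R y) - \<phi> (x - t *\<^sub>R y)) / h i + q x\<bar> \<le> 2 * L" by linarith
        then have "norm (F x) * \<bar>(\<phi> (x - (t + h i) *\<^sub>R y) - \<phi> (x - t *\<^sub>R y)) / h i + q x\<bar> \<le> norm (F x) * (2 * L)"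
          by (intro mult_left_mono) auto
        then show "norm (R (h i) x) \<le> (2 * L) * norm (F x)"
          unfolding R_def norm_mult norm_of_real by (simp only: mult.commute)
      qed
      show "integrable lebesgue (\<lambda>x. 2 * L * norm (F x))" using F by auto
      show "R (h i) \<in> borel_measurable lebesgue" for i
        unfolding R_def of_real_add of_real_divide of_real_diff
        using F ptest_lebesgue_measurable[OF ptest_translate[OF \<phi>]]
        by (intro borel_measurable_times borel_measurable_add borel_measurable_divide borel_measurable_diff qm
            borel_measurable_const) auto
    qed simp
    have "norm (G (t + h i) - G t - h i *\<^sub>R D) / norm (h i) = norm (integral\<^sup>L lebesgue (R (h i)))" for i
    proof -
      have hi: "h i \<noteq> 0" using h(1) by blast
      have "G (t + h i) - G t - h i *\<^sub>R D = of_real (h i) * integral\<^sup>L lebesgue (R (h i))"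
        unfolding R_int[OF hi] using hi by (simp add: field_simps scaleR_conv_of_real)
      with hi show ?thesis by (simp add: norm_mult)
    qed
    then show "((\<lambda>h. norm (G (t + h) - G t - h *\<^sub>R D) / norm h) \<circ> h) \<longlonglongrightarrow> 0"
      using tendsto_norm[OF lim] by (simp add: o_def)
  qed
  then have "(G has_derivative (\<lambda>h. h *\<^sub>R D)) (at t)"
    unfolding has_derivative_at by (intro conjI bounded_linear_scaleR_left) simp
  then show ?thesis
    unfolding has_vector_derivative_def G_def[abs_def] D_def .
qed

lemma loc_int_continuous: "continuous_on U f \<Longrightarrow> loc_int U f"
  unfolding loc_int_def by (auto intro: absolutely_integrable_continuous continuous_on_subset)

text \<open>Weak derivative tested with product bumps only. Such a bump vanishes outside its box, so
  the integrals may be taken over the whole space and translated freely.\<close>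

definition weak_pt :: "(real^'n::finite) set \<Rightarrow> (real^'n \<Rightarrow> complex) \<Rightarrow> 'n \<Rightarrow> (real^'n \<Rightarrow> complex) \<Rightarrow> bool" where
  "weak_pt U f i g \<longleftrightarrow> (\<forall>a b \<phi>. ptest a b \<phi> \<longrightarrow> cbox a b \<subseteq> U \<longrightarrow> pair_int f (pd i \<phi>) = - pair_int g \<phi>)"

definition cube :: "real^'n::finite \<Rightarrow> real \<Rightarrow> (real^'n) set" where
  "cube p s = cbox (p - s *\<^sub>R 1) (p + s *\<^sub>R 1)"

definition ocube :: "real^'n::finite \<Rightarrow> real \<Rightarrow> (real^'n) set" where
  "ocube p s = box (p - s *\<^sub>R 1) (p + s *\<^sub>R 1)"

lemma mem_cube: "x \<in> cube p s \<longleftrightarrow> (\<forall>c. p $ c - s \<le> x $ c \<and> x $ c \<le> p $ c + s)"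
  and mem_ocube: "x \<in> ocube p s \<longleftrightarrow> (\<forall>c. p $ c - s < x $ c \<and> x $ c < p $ c + s)"
  by (auto simp: cube_def ocube_def mem_box_cart)

lemma pair_int_translate:
  "pair_int (\<lambda>x. f (x + y)) \<phi> = pair_int f (\<lambda>x. \<phi> (x - y))"
  using integral_translate[of "\<lambda>x. f x * of_real (\<phi> (x - y))" y] by simp

text \<open>Paired with a bump, the translate of f by t y is differentiable in t with constant
  derivative, namely the increment times the integral of the bump. Integrating from t = 0 to t = 1
  shows that f(x + y) - f(x) minus the increment annihilates every bump.\<close>

lemma translate_affine:
  assumes f: "loc_int U f" and w: "\<And>c. weak_pt U f c (\<lambda>_. \<beta> c)"
    and U: "cube p (2 * r) \<subseteq> U" and y: "\<And>c. \<bar>y $ c\<bar> \<le> r"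
  shows "AE x in lebesgue. x \<in> ocube p r \<longrightarrow> f (x + y) = f x + (\<Sum>c\<in>UNIV. \<beta> c * of_real (y $ c))"
proof -
  define K where "K = (\<Sum>c\<in>UNIV. \<beta> c * of_real (y $ c))"
  define F where "F x = indicator (cube p (2 * r)) x *\<^sub>R f x" for x
  have F: "integrable lebesgue F"
    using f U unfolding F_def loc_int_def cube_def set_integrable_def by blast
  have sub: "ocube p r \<subseteq> cube p (2 * r)"
  proof
    fix x assume x: "x \<in> ocube p r"
    have "p $ c - 2 * r \<le> x $ c \<and> x $ c \<le> p $ c + 2 * r" for c
      using x[unfolded mem_ocube, rule_format, of c] y[of c] by linarith
    then show "x \<in> cube p (2 * r)" by (simp add: mem_cube)
  qed
  have shift: "x + y \<in> cube p (2 * r)" if x: "x \<in> ocube p r" for x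
  proof -
    have "p $ c - 2 * r \<le> x $ c + y $ c \<and> x $ c + y $ c \<le> p $ c + 2 * r" for c
      using x[unfolded mem_ocube, rule_format, of c] y[of c] by linarith
    then show "x + y \<in> cube p (2 * r)" by (simp add: mem_cube)
  qed
  have "AE x in lebesgue. x \<in> ocube p r \<longrightarrow> F (x + y) - F x - K = 0"
    unfolding ocube_def
  proof (rule fundamental_lemma_box)
    have K: "set_integrable lebesgue (box (p - r *\<^sub>R 1) (p + r *\<^sub>R 1)) (\<lambda>x. K)"
      by (rule set_integrable_subset[OF absolutely_integrable_continuous[OF continuous_on_const, of "p - r *\<^sub>R 1" "p + r *\<^sub>R 1"]])
        (auto simp: box_subset_cbox)
    show "set_integrable lebesgue (box (p - r *\<^sub>R 1) (p + r *\<^sub>R 1)) (\<lambda>x. F (x + y) - F x - K)"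
      using integrable_translate[OF F, of y] F K
      by (intro set_integral_diff) (auto simp: set_integrable_def intro!: integrable_mult_indicator)
    fix a b \<phi> assume \<phi>: "ptest a b \<phi>" and ab: "cbox a b \<subseteq> box (p - r *\<^sub>R 1) (p + r *\<^sub>R 1)"
    show "pair_int (\<lambda>x. F (x + y) - F x - K) \<phi> = 0"
    proof (cases "cbox a b = {}")
      case True
      then have "\<phi> x = 0" for x using ptest_zero[OF \<phi>, of x] by simp
      then show ?thesis by simp
    next
      case False
      then have "a \<in> cbox a b" "b \<in> cbox a b" by (auto simp: box_ne_empty mem_box)
      then have mem: "a \<in> ocube p r" "b \<in> ocube p r" using ab by (auto simp: ocube_def)
      \<comment> \<open>During the whole motion the support stays in the cube of radius 2r, where
        the weak gradient is known.\<close>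
      have in_cube: "cbox (a + t *\<^sub>R y) (b + t *\<^sub>R y) \<subseteq> cube p (2 * r)" if t: "0 \<le> t" "t \<le> 1" for t
      proof -
        have *: "\<bar>t * y $ c\<bar> \<le> r" for c
        proof -
          have "\<bar>t * y $ c\<bar> \<le> \<bar>y $ c\<bar>" using t by (simp add: abs_mult mult_left_le_one_le)
          then show ?thesis using y[of c] by linarith
        qed
        show ?thesis
        proof
          fix x assume x: "x \<in> cbox (a + t *\<^sub>R y) (b + t *\<^sub>R y)"
          have "p $ c - 2 * r \<le> x $ c \<and> x $ c \<le> p $ c + 2 * r" for c
          proof -
            have "a $ c + t * y $ c \<le> x $ c" "x $ c \<le> b $ c + t * y $ c"
              using x by (simp_all add: mem_box_cart)
            then show ?thesis
              using mem[unfolded mem_ocube, rule_format, of c] *[of c] by linarith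
          qed
          then show "x \<in> cube p (2 * r)" by (simp add: mem_cube)
        qed
      qed
      define I where "I = complex_of_real (integral\<^sup>L lebesgue \<phi>)"
      have I_t: "integral\<^sup>L lebesgue (\<lambda>x. \<phi> (x - z)) = integral\<^sup>L lebesgue \<phi>" for z
        using integral_translate[of \<phi> "- z"] by simp
      define G where "G t = pair_int F (\<lambda>x. \<phi> (x - t *\<^sub>R y))" for t
      have G': "(G has_vector_derivative K * I) (at t)" if t: "0 \<le> t" "t \<le> 1" for t
      proof -
        have "pair_int F (\<lambda>x. pd c \<phi> (x - t *\<^sub>R y)) = - \<beta> c * I" for c
        proof -
          have \<psi>: "ptest (a + t *\<^sub>R y) (b + t *\<^sub>R y) (\<lambda>x. \<phi> (x - t *\<^sub>R y))" by (rule ptest_translate[OF \<phi>])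
          have "pair_int F (pd c (\<lambda>x. \<phi> (x - t *\<^sub>R y))) = pair_int f (pd c (\<lambda>x. \<phi> (x - t *\<^sub>R y)))"
            using ptest_cut[OF ptest_pd[OF \<psi>] in_cube[OF t], of f] by (simp add: F_def)
          also have "\<dots> = - pair_int (\<lambda>_. \<beta> c) (\<lambda>x. \<phi> (x - t *\<^sub>R y))"
            using w[of c] \<psi> in_cube[OF t] U unfolding weak_pt_def by blast
          finally show ?thesis using pd_translate[OF \<phi>, of c "t *\<^sub>R y"] by (simp add: I_t I_def)
        qed
        then have "- (\<Sum>c\<in>UNIV. of_real (y $ c) * pair_int F (\<lambda>x. pd c \<phi> (x - t *\<^sub>R y))) = K * I"
          by (simp add: K_def sum_distrib_left sum_negf mult_ac)
        then show ?thesis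
          using pair_int_line_deriv[OF F \<phi>, of y t] by (simp add: G_def[abs_def])
      qed
      \<comment> \<open>G(t) - t K I has zero derivative on [0, 1], so its values at 0 and 1
        agree.\<close>
      obtain k where k: "\<And>t. t \<in> {0..1} \<Longrightarrow> G t - of_real t * (K * I) = k"
      proof (rule has_vector_derivative_zero_constant[of "{0..1::real}" "\<lambda>t. G t - of_real t * (K * I)"])
        fix t :: real assume "t \<in> {0..1}"
        then have "(G has_vector_derivative K * I) (at t within {0..1})"
          using G'[of t] by (auto intro: has_vector_derivative_at_within)
        moreover have "((\<lambda>t. of_real t * (K * I)) has_vector_derivative K * I) (at t within {0..1})"
          by (auto intro!: derivative_eq_intros simp: scaleR_conv_of_real)
        ultimately show "((\<lambda>t. G t - of_real t * (K * I)) has_vector_derivative 0) (at t within {0..1})"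
          using has_vector_derivative_diff[of G "K * I" _ "\<lambda>t. of_real t * (K * I)" "K * I"] by simp
      qed auto
      have "G 1 - K * I = G 0" using k[of 1] k[of 0] by simp
      moreover have "integrable lebesgue (\<lambda>x. F (x + z) * of_real (\<phi> x))" for z
      proof -
        obtain B where B: "\<And>x. \<bar>\<phi> x\<bar> \<le> B" using ptest_bounded[OF \<phi>] by blast
        show ?thesis
          by (rule integrable_bounded_mult[OF integrable_translate[OF F] ptest_lebesgue_measurable[OF \<phi>], of B])
            (use B in simp)
      qed
      note this[of y] this[of 0]
      moreover have "integrable lebesgue (\<lambda>x. K * complex_of_real (\<phi> x))"
          by (rule ptest_integrable[OF \<phi>, of UNIV]) (auto intro: loc_int_continuous)
      ultimately show ?thesis
        using pair_int_translate[of F y \<phi>] by (simp add: G_def I_def algebra_simps)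
    qed
  qed
  then show ?thesis
    by eventually_elim (use sub shift in \<open>auto simp: F_def K_def algebra_simps\<close>)
qed


text \<open>For each shift y the affine law holds for almost every x. Fubini exchanges the
  quantifiers and yields a single base point x0 from which almost every shift is affine, and this
  determines f near p.\<close>

lemma locally_affine:
  assumes f: "loc_int U f" and w: "\<And>c. weak_pt U f c (\<lambda>_. \<beta> c)"
    and U: "cube p (2 * r) \<subseteq> U" and r: "r > 0"
  shows "\<exists>\<alpha>. AE x in lebesgue. x \<in> ocube p (r / 2) \<longrightarrow> f x = \<alpha> + (\<Sum>c\<in>UNIV. \<beta> c * of_real (x $ c))"
proof -
  define b where "b x = (\<Sum>c\<in>UNIV. \<beta> c * complex_of_real (x $ c))" for x
  have b_add: "b (x + y) = b x + b y" for x y by (simp add: b_def sum.distrib algebra_simps)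
  have [measurable]: "b \<in> borel_measurable borel"
    unfolding b_def by (intro borel_measurable_continuous_onI continuous_intros)
  define F where "F x = indicator (cube p (2 * r)) x *\<^sub>R f x" for x
  have F: "integrable lebesgue F"
    using f U unfolding F_def loc_int_def cube_def set_integrable_def by blast
  \<comment> \<open>The exceptional set has to be measurable in the pair (x, y), hence the Borel
    version of f.\<close>
  obtain g where [measurable]: "g \<in> borel_measurable borel" and Fg: "AE x in lebesgue. F x = g x"
    using borel_representative[OF borel_measurable_integrable[OF F]] .
  define P where "P y x \<longleftrightarrow> x \<in> ocube p r \<longrightarrow> y \<in> ocube 0 r \<longrightarrow> g (x + y) = g x + b y" for y x
  have "AE x in lborel. P y x" for y
  proof (cases "y \<in> ocube 0 r")
    case True
    then have y: "\<bar>y $ c\<bar> \<le> r" for c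
      using True[unfolded mem_ocube, rule_format, of c] by (simp add: abs_le_iff)
    have sub: "x \<in> cube p (2 * r)" "x + y \<in> cube p (2 * r)" if x: "x \<in> ocube p r" for x
    proof -
      have "p $ c - 2 * r \<le> x $ c \<and> x $ c \<le> p $ c + 2 * r"
        "p $ c - 2 * r \<le> x $ c + y $ c \<and> x $ c + y $ c \<le> p $ c + 2 * r" for c
        using x[unfolded mem_ocube, rule_format, of c] y[of c] by linarith+
      then show "x \<in> cube p (2 * r)" "x + y \<in> cube p (2 * r)" by (simp_all add: mem_cube)
    qed
    have "AE x in lebesgue. P y x"
      using translate_affine[OF f w U y] Fg AE_translate[OF Fg, of y]
      by eventually_elim (use sub in \<open>auto simp: P_def F_def b_def\<close>)
    then show ?thesis by (simp add: AE_completion_iff)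
  qed (simp add: P_def)
  moreover have "{z \<in> space (lborel \<Otimes>\<^sub>M lborel). P (fst z) (snd z)} \<in> sets (lborel \<Otimes>\<^sub>M lborel)"
    unfolding P_def ocube_def by measurable
  ultimately have "AE x in lborel. AE y in lborel. P y x"
    using lborel_pair.AE_commute[of P] by simp
  moreover have "\<not> (AE x in lborel. x \<notin> ocube p r')" if "r' > 0" for r'
  proof
    assume "AE x in lborel. x \<notin> ocube p r'"
    then have "ocube p r' \<in> null_sets lborel"
      by (subst (asm) AE_iff_null_sets[symmetric]) (simp_all add: ocube_def)
    then have "negligible (ocube p r')" by (simp add: negligible_iff_null_sets null_sets_completionI)
    moreover have "p \<in> ocube p r'" using that by (simp add: mem_ocube)
    ultimately show False
      using open_not_negligible[of "ocube p r'"] unfolding ocube_def by blast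
  qed
  \<comment> \<open>A cube has positive measure, so it contains a good base point x0. Half the
    radius is used so that differences of two points of it are admissible shifts.\<close>
  from this[of "r / 2"] r have "\<not> (AE x in lborel. x \<notin> ocube p (r / 2))" by simp
  moreover have "AE x in lborel. x \<notin> ocube p (r / 2)"
    if "\<not> (\<exists>x0\<in>ocube p (r / 2). AE y in lborel. P y x0)" "AE x in lborel. AE y in lborel. P y x"
    using that(2) by eventually_elim (use that(1) in blast)
  ultimately have "\<exists>x0\<in>ocube p (r / 2). AE y in lborel. P y x0" by blast
  then obtain x0 where x0: "x0 \<in> ocube p (r / 2)" "AE y in lborel. P y x0" by blast
  have Px0: "AE x in lebesgue. P (x + - x0) x0"
    by (rule AE_translate) (use x0(2) in \<open>rule AE_completion\<close>)
  have geo: "x0 \<in> ocube p r" "x - x0 \<in> ocube 0 r" "x \<in> cube p (2 * r)" if x: "x \<in> ocube p (r / 2)" for x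
  proof -
    have "p $ c - r < x0 $ c \<and> x0 $ c < p $ c + r" "- r < x $ c - x0 $ c \<and> x $ c - x0 $ c < r"
      "p $ c - 2 * r \<le> x $ c \<and> x $ c \<le> p $ c + 2 * r" for c
      using x0(1)[unfolded mem_ocube, rule_format, of c] x[unfolded mem_ocube, rule_format, of c] r
      by linarith+
    then show "x0 \<in> ocube p r" "x - x0 \<in> ocube 0 r" "x \<in> cube p (2 * r)"
      by (auto simp: mem_cube mem_ocube)
  qed
  have "AE x in lebesgue. x \<in> ocube p (r / 2) \<longrightarrow> f x = (g x0 - b x0) + b x"
    using Px0 Fg
  proof eventually_elim
    case (elim x)
    then show ?case using b_add[of x0 "x - x0"] geo[of x] by (auto simp: P_def F_def)
  qed
  then show ?thesis unfolding b_def by blast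
qed

lemma open_contains_cube:
  assumes "open U" "p \<in> U"
  obtains r where "r > 0" "cube p r \<subseteq> U"
proof -
  obtain e where e: "e > 0" "ball p e \<subseteq> U" using assms open_contains_ball by blast
  define r where "r = e / (2 * real CARD('a))"
  have r: "r > 0" using e by (simp add: r_def)
  have "x \<in> ball p e" if "x \<in> cube p r" for x
  proof -
    have "\<bar>(p - x) $ c\<bar> \<le> r" for c
      using that[unfolded mem_cube, rule_format, of c] by (simp add: abs_le_iff)
    then have "norm (p - x) \<le> (\<Sum>c\<in>(UNIV::'a set). r)"
      by (intro order_trans[OF norm_le_l1_cart] sum_mono) 
    also have "\<dots> < e" using e by (simp add: r_def)
    finally show ?thesis by (simp add: dist_norm)
  qed
  with r e(2) that show thesis by blast
qed

text \<open>Two local constants on overlapping open sets agree, because a nonempty open set is not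
  null. The constant is therefore locally constant as a function of the point, and connectedness
  makes it global.\<close>

lemma weak_gradient_const_affine:
  assumes U: "open U" "connected U" and f: "loc_int U f" and w: "\<And>c. weak_pt U f c (\<lambda>_. \<beta> c)"
  shows "\<exists>\<alpha>. AE x in lebesgue. x \<in> U \<longrightarrow> f x = \<alpha> + (\<Sum>c\<in>UNIV. \<beta> c * of_real (x $ c))"
proof -
  define b where "b x = (\<Sum>c\<in>UNIV. \<beta> c * complex_of_real (x $ c))" for x
  define R where "R W \<alpha> \<longleftrightarrow> open W \<and> (AE x in lebesgue. x \<in> W \<longrightarrow> f x = \<alpha> + b x)" for W \<alpha>
  have ex: "\<exists>W \<alpha>. p \<in> W \<and> W \<subseteq> U \<and> R W \<alpha>" if p: "p \<in> U" for p
  proof -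
    obtain r where r: "r > 0" "cube p r \<subseteq> U" using open_contains_cube[OF U(1) p] by blast
    obtain \<alpha> where "AE x in lebesgue. x \<in> ocube p (r / 2 / 2) \<longrightarrow> f x = \<alpha> + b x"
      using locally_affine[OF f w, of p "r / 2"] r unfolding b_def by auto
    moreover have "p \<in> ocube p (r / 2 / 2)" using r by (simp add: mem_ocube)
    moreover have "ocube p (r / 2 / 2) \<subseteq> cube p r"
    proof
      fix x assume x: "x \<in> ocube p (r / 2 / 2)"
      have "p $ c - r \<le> x $ c \<and> x $ c \<le> p $ c + r" for c
        using x[unfolded mem_ocube, rule_format, of c] r by linarith
      then show "x \<in> cube p r" by (simp add: mem_cube)
    qed
    ultimately show ?thesis using r unfolding R_def ocube_def by blast
  qed
  have uniq: "\<alpha> = \<alpha>'" if "R W \<alpha>" "R W' \<alpha>'" "p \<in> W" "p \<in> W'" for W W' \<alpha> \<alpha>' p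
  proof (rule ccontr)
    assume "\<alpha> \<noteq> \<alpha>'"
    have "AE x in lebesgue. x \<in> W \<longrightarrow> f x = \<alpha> + b x" "AE x in lebesgue. x \<in> W' \<longrightarrow> f x = \<alpha>' + b x"
      using that unfolding R_def by auto
    then have "AE x in lebesgue. x \<notin> W \<inter> W'"
      by eventually_elim (use \<open>\<alpha> \<noteq> \<alpha>'\<close> in auto)
    moreover have o: "open (W \<inter> W')" using that unfolding R_def by auto
    ultimately have "W \<inter> W' \<in> null_sets lebesgue"
      by (subst (asm) AE_iff_null_sets[symmetric]) (auto intro: sets_completionI_sets)
    then show False
      using open_not_negligible[OF o] that by (auto simp: negligible_iff_null_sets)
  qed
  define A where "A p = (SOME \<alpha>. \<exists>W. p \<in> W \<and> W \<subseteq> U \<and> R W \<alpha>)" for p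
  have A: "\<exists>W. p \<in> W \<and> W \<subseteq> U \<and> R W (A p)" if "p \<in> U" for p
  proof -
    have "\<exists>\<alpha> W. p \<in> W \<and> W \<subseteq> U \<and> R W \<alpha>" using ex[OF that] by blast
    then show ?thesis unfolding A_def by (rule someI_ex)
  qed
  have "A constant_on U"
  proof (rule locally_constant_imp_constant[OF U(2)])
    fix p assume p: "p \<in> U"
    then obtain W where W: "p \<in> W" "W \<subseteq> U" "R W (A p)" using A by blast
    have "A q = A p" if q: "q \<in> W" for q
    proof -
      obtain W' where "q \<in> W'" "R W' (A q)" using A q W(2) by blast
      then show ?thesis using uniq[OF _ W(3), of W' "A q" q] q by blast
    qed
    moreover have "openin (top_of_set U) W"
      using W unfolding R_def by (simp add: open_openin_trans openin_open_eq U(1))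
    ultimately show "\<exists>T. openin (top_of_set U) T \<and> p \<in> T \<and> (\<forall>x\<in>T. A x = A p)" using W(1) by blast
  qed
  then obtain \<alpha> where \<alpha>: "\<And>p. p \<in> U \<Longrightarrow> A p = \<alpha>" unfolding constant_on_def by blast
  have "AE x in lebesgue. x \<in> U \<longrightarrow> f x = \<alpha> + b x"
  proof (rule AE_open_of_cboxes[OF U(1)])
    fix u v assume uv: "cbox u v \<subseteq> U"
    define \<W> where "\<W> = {W. R W \<alpha>}"
    have "cbox u v \<subseteq> \<Union>\<W>"
    proof
      fix p assume "p \<in> cbox u v"
      then have "p \<in> U" using uv by blast
      then show "p \<in> \<Union>\<W>" using A[of p] \<alpha>[of p] unfolding \<W>_def by auto
    qed
    moreover have "\<And>W. W \<in> \<W> \<Longrightarrow> open W" unfolding \<W>_def R_def by blast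
    ultimately obtain D where D: "D \<subseteq> \<W>" "finite D" "cbox u v \<subseteq> \<Union>D"
      using compactE[OF compact_cbox, of u v \<W>] by blast
    have "AE x in lebesgue. \<forall>W\<in>D. x \<in> W \<longrightarrow> f x = \<alpha> + b x"
      using D(1,2) unfolding \<W>_def R_def by (intro AE_finite_allI) auto
    then show "AE x in lebesgue. x \<in> cbox u v \<longrightarrow> f x = \<alpha> + b x"
      by eventually_elim (use D(3) in blast)
  qed
  then show ?thesis unfolding b_def by blast
qed

lemma pair_int_cong_AE:
  assumes "ptest a b \<phi>" "cbox a b \<subseteq> U" "loc_int U f" "loc_int U g"
    and "AE x in lebesgue. x \<in> U \<longrightarrow> f x = g x"
  shows "pair_int f \<phi> = pair_int g \<phi>"
proof (rule integral_cong_AE)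
  show "AE x in lebesgue. f x * complex_of_real (\<phi> x) = g x * complex_of_real (\<phi> x)"
    using assms(5) by eventually_elim (use ptest_zero[OF assms(1)] assms(2) in force)
qed (use ptest_integrable[OF assms(1,2)] assms(3,4) in auto)

text \<open>The pairing of u_k with second derivatives is symmetric in the last two and, because the
  symmetric gradient vanishes, antisymmetric in the first two indices; hence it vanishes.\<close>
lemma zero_strain_rigid:
  fixes u :: "'n::finite \<Rightarrow> real^'n \<Rightarrow> complex"
  assumes U: "open U" "connected U" "U \<noteq> {}"
    and u: "\<And>k. loc_int U (u k)" and g: "\<And>k i. loc_int U (g k i)"
    and w: "\<And>k i. weak_pt U (u k) i (g k i)"
    and e: "\<And>k i. AE x in lebesgue. x \<in> U \<longrightarrow> g k i x + g i k x = 0"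
  shows "\<exists>(A::complex^'n) B. (\<forall>k i. B $ k $ i = - B $ i $ k)
      \<and> (\<forall>k. AE x in lebesgue. x \<in> U \<longrightarrow> u k x = A $ k + (\<Sum>i\<in>UNIV. B $ k $ i * of_real (x $ i)))
      \<and> (\<forall>k i. AE x in lebesgue. x \<in> U \<longrightarrow> g k i x = B $ k $ i)"
proof -
  have wg: "weak_pt U (g k i) j (\<lambda>_. 0)" for k i j
    unfolding weak_pt_def
  proof (intro allI impI)
    fix a b \<phi> assume \<phi>: "ptest a b \<phi>" and ab: "cbox a b \<subseteq> U"
    define T where "T k i j = pair_int (u k) (pd i (pd j \<phi>))" for k i j
    have T: "T k i j = - pair_int (g k i) (pd j \<phi>)" for k i j
      using w[of k i] ptest_pd[OF \<phi>] ab unfolding weak_pt_def T_def by blast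
    have sym: "T k i j = T k j i" for k i j
      unfolding T_def using ptest_pd_commute[OF \<phi>, of i j] by simp
    have anti: "T k i j = - T i k j" for k i j
    proof -
      have "pair_int (g k i) (pd j \<phi>) = pair_int (\<lambda>x. - g i k x) (pd j \<phi>)"
      proof (rule pair_int_cong_AE[OF ptest_pd[OF \<phi>] ab g])
        show "loc_int U (\<lambda>x. - g i k x)"
          using g[of i k] by (auto simp: loc_int_def set_integrable_def)
        show "AE x in lebesgue. x \<in> U \<longrightarrow> g k i x = - g i k x"
          using e[of k i] by eventually_elim (auto simp: eq_neg_iff_add_eq_0)
      qed
      then show ?thesis unfolding T by simp
    qed
    have "T k i j = - T k i j"
      using anti[of k i j] sym[of i k j] anti[of i j k] sym[of j i k] anti[of j k i] sym[of k j i] by simp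
    then have "T k i j = 0" by (simp add: eq_neg_iff_add_eq_0)
    then show "pair_int (g k i) (pd j \<phi>) = - pair_int (\<lambda>_. 0) \<phi>" unfolding T by simp
  qed
  \<comment> \<open>A weak gradient 0 means affine with slope 0, so each first derivative is almost
    everywhere equal to a constant.\<close>
  define B where "B k i = (SOME \<beta>. AE x in lebesgue. x \<in> U \<longrightarrow> g k i x = \<beta>)" for k i
  have B: "AE x in lebesgue. x \<in> U \<longrightarrow> g k i x = B k i" for k i
    unfolding B_def by (rule someI_ex) (use weak_gradient_const_affine[OF U(1,2) g wg, of k i] in simp)
  have ne: "\<not> (AE x in lebesgue. x \<notin> U)"
  proof
    assume "AE x in lebesgue. x \<notin> U"
    then have "U \<in> null_sets lebesgue"
      using U(1) by (subst (asm) AE_iff_null_sets[symmetric]) (auto intro: sets_completionI_sets)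
    then show False using open_not_negligible[OF U(1,3)] by (auto simp: negligible_iff_null_sets)
  qed
  \<comment> \<open>An almost everywhere identity between constants is an identity, as U has
    positive measure.\<close>
  have anti: "B k i = - B i k" for k i
  proof (rule ccontr)
    assume "B k i \<noteq> - B i k"
    then have ne0: "B k i + B i k \<noteq> 0" by (simp add: eq_neg_iff_add_eq_0)
    have "AE x in lebesgue. x \<notin> U"
      using B[of k i] B[of i k] e[of k i] by eventually_elim (use ne0 in auto)
    with ne show False by blast
  qed
  have "\<exists>A. AE x in lebesgue. x \<in> U \<longrightarrow> u k x = A + (\<Sum>i\<in>UNIV. B k i * of_real (x $ i))" for k
  proof (rule weak_gradient_const_affine[OF U(1,2) u])
    fix i
    show "weak_pt U (u k) i (\<lambda>_. B k i)"
      unfolding weak_pt_def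
    proof (intro allI impI)
      fix a b \<phi> assume \<phi>: "ptest a b \<phi>" and ab: "cbox a b \<subseteq> U"
      have "pair_int (g k i) \<phi> = pair_int (\<lambda>_. B k i) \<phi>"
        by (rule pair_int_cong_AE[OF \<phi> ab g _ B]) (auto intro: loc_int_continuous)
      then show "pair_int (u k) (pd i \<phi>) = - pair_int (\<lambda>_. B k i) \<phi>"
        using w[of k i, unfolded weak_pt_def, rule_format, OF \<phi> ab] by simp
    qed
  qed
  then have "\<forall>k. \<exists>A. AE x in lebesgue. x \<in> U \<longrightarrow> u k x = A + (\<Sum>i\<in>UNIV. B k i * of_real (x $ i))" by blast
  from choice[OF this] obtain A where
    A: "\<And>k. AE x in lebesgue. x \<in> U \<longrightarrow> u k x = A k + (\<Sum>i\<in>UNIV. B k i * of_real (x $ i))" by blast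
  show ?thesis
  proof (intro exI[of _ "\<chi> k. A k"] exI[of _ "\<chi> k i. B k i"] conjI allI)
    show "(\<chi> k i. B k i) $ k $ i = - (\<chi> k i. B k i) $ i $ k" for k i
      using anti[of k i] by simp
  qed (use A B in simp_all)
qed

section \<open>Periodic functions\<close>

lemma One_vec: "(One :: real^'n::finite) = 1"
proof (subst vec_eq_iff, rule allI)
  fix i :: 'n
  have "(One :: real^'n) $ i = (One :: real^'n) \<bullet> axis i 1" by (simp only: cart_eq_inner_axis)
  also have "\<dots> = (\<Sum>b\<in>(Basis::(real^'n) set). if b = axis i 1 then 1 else 0)"
    unfolding inner_sum_left by (intro sum.cong refl) (simp add: inner_Basis axis_in_Basis_iff)
  also have "\<dots> = 1" by (simp add: axis_in_Basis_iff)
  finally show "(One :: real^'n) $ i = 1 $ i" by simp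
qed

lemma mem_cell: "x \<in> cell \<longleftrightarrow> (\<forall>i. 0 < x $ i \<and> x $ i < 1)"
  unfolding cell_def One_vec by (simp add: mem_box_cart)

text \<open>The half-open cell: its integer translates partition the space exactly, and it differs
  from \<open>cell\<close> by a null set. Translation arguments use it in place of the open
  cell.\<close>

definition hcell :: "real^'n::finite \<Rightarrow> (real^'n) set" where
  "hcell y = {x. \<forall>c. y $ c \<le> x $ c \<and> x $ c < y $ c + 1}"

lemma hcell_borel [measurable]: "hcell y \<in> sets borel"
  unfolding hcell_def by measurable

lemma hcell_lebesgue [measurable]: "hcell y \<in> sets lebesgue"
  by (intro sets_completionI_sets) simp

lemma hcell_subset_cbox: "hcell y \<subseteq> cbox y (y + 1)"
  by (auto simp: hcell_def mem_box_cart less_imp_le)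

lemma AE_cell_hcell: "AE x in lebesgue. x \<in> (cell :: (real^'n::finite) set) \<longleftrightarrow> x \<in> hcell 0"
proof -
  have "AE x in lebesgue. x \<notin> cbox (0::real^'n) 1 - box 0 1"
    using negligible_frontier_interval[of "0::real^'n" 1] by (intro AE_not_in) (simp add: negligible_iff_null_sets)
  then show ?thesis
    by eventually_elim (auto simp: mem_cell mem_box_cart hcell_def less_imp_le)
qed

lemma cell_lebesgue [measurable]: "cell \<in> sets lebesgue"
  unfolding cell_def by (intro sets_completionI_sets) simp

lemma periodic_axis_int:
  assumes "periodic f"
  shows "f (x + axis i (of_int m)) = f x"
proof (induction m arbitrary: x rule: int_induct[where k = 0])
  case base then show ?case by (simp add: axis_def zero_vec_def[symmetric])
next
  case (step1 m)
  have "axis i (real_of_int (m + 1)) = axis i (of_int m) + axis i 1" by (simp add: axis_def vec_eq_iff)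
  then show ?case using step1 assms unfolding periodic_def by (simp add: add.assoc[symmetric])
next
  case (step2 m)
  have "axis i (real_of_int m) = axis i (of_int (m - 1)) + axis i 1" by (simp add: axis_def vec_eq_iff)
  then have "f (x + axis i (of_int m)) = f (x + axis i (of_int (m - 1)))"
    using assms unfolding periodic_def by (simp add: add.assoc[symmetric])
  with step2 show ?case by simp
qed

lemma vec_sum_axis: "(\<Sum>i\<in>UNIV. axis i (y $ i)) = (y :: real^'n::finite)"
  by (simp add: vec_eq_iff axis_def if_distrib sum.delta cong: if_cong)

lemma periodic_lattice:
  assumes "periodic f" "k \<in> lattice"
  shows "f (x + k) = f x"
proof -
  have "f (x + (\<Sum>i\<in>S. axis i (k $ i))) = f x" if "finite S" for S
    using that
  proof (induction S)
    case (insert i S)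
    obtain m where m: "k $ i = of_int m" using assms(2) by (auto simp: lattice_def elim: Ints_cases)
    have "f (x + (\<Sum>i\<in>insert i S. axis i (k $ i))) = f ((x + (\<Sum>i\<in>S. axis i (k $ i))) + axis i (of_int m))"
      using insert by (simp add: m algebra_simps)
    then show ?case using insert by (simp add: periodic_axis_int[OF assms(1)])
  qed simp
  from this[of UNIV] show ?thesis by (simp add: vec_sum_axis)
qed

lemma countable_lattice: "countable (lattice :: (real^'n::finite) set)"
proof -
  have "lattice \<subseteq> range (\<lambda>k::int^'n. \<chi> i. real_of_int (k $ i))"
  proof
    fix x :: "real^'n" assume "x \<in> lattice"
    then have "x = (\<chi> i. real_of_int ((\<chi> i. \<lfloor>x $ i\<rfloor>) $ i))"
      by (auto simp: lattice_def vec_eq_iff)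
    then show "x \<in> range (\<lambda>k::int^'n. \<chi> i. real_of_int (k $ i))" by blast
  qed
  then show ?thesis by (rule countable_subset) simp
qed

lemma finite_lattice_box: "finite {k \<in> (lattice :: (real^'n::finite) set). \<forall>i. \<bar>k $ i\<bar> \<le> real_of_int N}"
proof -
  have "{k \<in> (lattice :: (real^'n) set). \<forall>i. \<bar>k $ i\<bar> \<le> real_of_int N}
      \<subseteq> (\<lambda>g. \<chi> i. real_of_int (g i)) ` (PiE UNIV (\<lambda>_. {- N..N}))"
  proof
    fix x :: "real^'n" assume x: "x \<in> {k \<in> lattice. \<forall>i. \<bar>k $ i\<bar> \<le> real_of_int N}"
    have int: "real_of_int \<lfloor>x $ i\<rfloor> = x $ i" for i
      using x by (auto simp: lattice_def)
    have "\<lfloor>x $ i\<rfloor> \<in> {- N..N}" for i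
    proof -
      have "\<bar>real_of_int \<lfloor>x $ i\<rfloor>\<bar> \<le> real_of_int N" unfolding int using x by simp
      then have "real_of_int \<bar>\<lfloor>x $ i\<rfloor>\<bar> \<le> real_of_int N" by (simp only: of_int_abs)
      then have "\<bar>\<lfloor>x $ i\<rfloor>\<bar> \<le> N" by (simp only: of_int_le_iff)
      then show ?thesis by (simp add: abs_le_iff)
    qed
    moreover have "x = (\<chi> i. real_of_int \<lfloor>x $ i\<rfloor>)" by (simp add: vec_eq_iff int)
    ultimately show "x \<in> (\<lambda>g. \<chi> i. real_of_int (g i)) ` (PiE UNIV (\<lambda>_. {- N..N}))"
      by (intro image_eqI[of _ _ "\<lambda>i. \<lfloor>x $ i\<rfloor>"]) auto
  qed
  then show ?thesis by (rule finite_subset) (intro finite_imageI finite_PiE; simp)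
qed

definition fl :: "real^'n::finite \<Rightarrow> real^'n" where "fl x = (\<chi> i. of_int \<lfloor>x $ i\<rfloor>)"

lemma fl_lattice: "fl x \<in> lattice" and fl_hcell: "x \<in> hcell (fl x)"
  by (auto simp: fl_def lattice_def hcell_def)

lemma hcell_shift: "x \<in> hcell (y + k) \<longleftrightarrow> x - k \<in> hcell y"
  by (auto simp: hcell_def algebra_simps)

lemma mem_hcell_shift: "x \<in> hcell k \<longleftrightarrow> x + - k \<in> hcell 0"
  using hcell_shift[of x 0 k] by simp

section \<open>Square-integrable periodic functions\<close>

lemma L2_iff:
  assumes "U \<in> sets lebesgue"
  shows "L2 U f \<longleftrightarrow> (\<lambda>x. indicator U x *\<^sub>R f x) \<in> borel_measurable lebesgue
     \<and> integrable lebesgue (\<lambda>x. indicator U x *\<^sub>R (cmod (f x))\<^sup>2)"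
  unfolding L2_def using assms
  by (simp add: borel_measurable_restrict_space_iff integrable_restrict_space)

text \<open>On each of the countably many lattice cells the function is a translate of its
  restriction to the basic one.\<close>

lemma periodic_L2_measurable:
  assumes "periodic f" "L2 cell f"
  shows "f \<in> borel_measurable lebesgue"
proof -
  define G where "G x = indicator (hcell 0) x *\<^sub>R f x" for x
  have "(\<lambda>x. indicator cell x *\<^sub>R f x) \<in> borel_measurable lebesgue"
    using assms(2) by (simp add: L2_iff)
  moreover have "AE x in lebesgue. indicator cell x *\<^sub>R f x = G x"
    using AE_cell_hcell by eventually_elim (auto simp: G_def indicator_def)
  ultimately have G: "G \<in> borel_measurable lebesgue"
    by (rule borel_measurable_AE)
  show ?thesis
  proof (rule measurable_piecewise_restrict[where C = "hcell ` lattice"])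
    fix \<Omega> :: "(real^'a) set" assume "\<Omega> \<in> hcell ` lattice"
    then obtain k where k: "k \<in> lattice" "\<Omega> = hcell k" by blast
    have "indicator (hcell k) x *\<^sub>R f x = G (x + - k)" for x
    proof -
      have "f (x + - k) = f x" using periodic_lattice[OF assms(1) k(1), of "x + - k"] by simp
      then show ?thesis unfolding G_def indicator_def mem_hcell_shift[of x k] by simp
    qed
    then have "(\<lambda>x. indicator \<Omega> x *\<^sub>R f x) = (\<lambda>x. G (x + - k))" unfolding k(2) by (rule ext)
    moreover have "(\<lambda>x. G (x + - k)) \<in> borel_measurable lebesgue" by (rule measurable_lebesgue_translate[OF G])
    ultimately show "f \<in> borel_measurable (restrict_space lebesgue \<Omega>)"
      using k by (subst borel_measurable_restrict_space_iff) simp_all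
    show "\<Omega> \<inter> space lebesgue \<in> sets lebesgue" using k by simp
  next
    show "space lebesgue \<subseteq> \<Union> (hcell ` lattice)" using fl_lattice fl_hcell by blast
  qed (intro countable_image countable_lattice)
qed

lemma set_integrable_periodic:
  fixes F :: "real^'n::finite \<Rightarrow> 'b::{banach, second_countable_topology}"
  assumes "periodic F" "set_integrable lebesgue (hcell 0) F"
  shows "set_integrable lebesgue (cbox a b) F"
proof -
  \<comment> \<open>One more than the coordinates of a and b, so that the lattice corner of every
    point of the box lies in [-N, N]^d; finitely many cells then cover the box.\<close>
  obtain N :: nat where N: "\<And>i. \<bar>a $ i\<bar> + 1 \<le> N" "\<And>i. \<bar>b $ i\<bar> + 1 \<le> N"
  proof -
    obtain N :: nat where "norm a + norm b + 1 \<le> N" using real_arch_simple by blast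
    then have "\<bar>a $ i\<bar> + 1 \<le> N" "\<bar>b $ i\<bar> + 1 \<le> N" for i
      using component_le_norm_cart[of a i] component_le_norm_cart[of b i] norm_ge_zero[of a] norm_ge_zero[of b]
      by linarith+
    then show thesis using that by blast
  qed
  define K where "K = {k \<in> (lattice :: (real^'n) set). \<forall>i. \<bar>k $ i\<bar> \<le> real_of_int (int N)}"
  have "set_integrable lebesgue (hcell k) F" if k: "k \<in> K" for k
  proof -
    have "F (x + - k) = F x" for x
      using periodic_lattice[OF assms(1), of k "x + - k"] k by (simp add: K_def)
    then have "(\<lambda>x. indicator (hcell k) x *\<^sub>R F x) = (\<lambda>x. indicator (hcell 0) (x + - k) *\<^sub>R F (x + - k))"
      by (simp add: indicator_def mem_hcell_shift[of _ k] fun_eq_iff)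
    then show ?thesis
      using integrable_translate[OF assms(2)[unfolded set_integrable_def], of "- k"]
      unfolding set_integrable_def by simp
  qed
  then have "set_integrable lebesgue (\<Union>k\<in>K. hcell k) F"
    using finite_lattice_box[of "int N"] by (intro set_integrable_UN) (auto simp: K_def)
  moreover have "cbox a b \<subseteq> (\<Union>k\<in>K. hcell k)"
  proof
    fix x assume x: "x \<in> cbox a b"
    have "\<bar>fl x $ i\<bar> \<le> N" for i
    proof -
      have "a $ i \<le> x $ i" "x $ i \<le> b $ i" using x by (auto simp: mem_box_cart)
      moreover have "fl x $ i \<le> x $ i" "x $ i < fl x $ i + 1" using fl_hcell[of x] by (auto simp: hcell_def)
      ultimately show ?thesis using N[of i] by linarith
    qed
    then show "x \<in> (\<Union>k\<in>K. hcell k)" using fl_lattice[of x] fl_hcell[of x] by (auto simp: K_def)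
  qed
  ultimately show ?thesis by (elim set_integrable_subset) simp_all
qed

lemma periodic_L2_sq_integrable:
  assumes "periodic f" "L2 cell f"
  shows "set_integrable lebesgue (cbox a b) (\<lambda>x. (cmod (f x))\<^sup>2)"
proof (rule set_integrable_periodic)
  show "periodic (\<lambda>x. (cmod (f x))\<^sup>2)" using assms(1) by (simp add: periodic_def)
  have m: "f \<in> borel_measurable lebesgue" using assms by (rule periodic_L2_measurable)
  have "integrable lebesgue (\<lambda>x. indicator cell x *\<^sub>R (cmod (f x))\<^sup>2)"
    using assms(2) by (simp add: L2_iff)
  moreover have "(\<lambda>x. indicator (hcell 0) x *\<^sub>R (cmod (f x))\<^sup>2) \<in> borel_measurable lebesgue"
    using m by (intro borel_measurable_scaleR borel_measurable_indicator) auto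
  moreover have "AE x in lebesgue. indicator cell x *\<^sub>R (cmod (f x))\<^sup>2 = indicator (hcell 0) x *\<^sub>R (cmod (f x))\<^sup>2"
    using AE_cell_hcell by eventually_elim (auto simp: indicator_def)
  ultimately show "set_integrable lebesgue (hcell 0) (\<lambda>x. (cmod (f x))\<^sup>2)"
    unfolding set_integrable_def by (rule integrable_cong_AE_imp)
qed

text \<open>On a bounded set the bound |f| <= 1 + |f|^2 suffices.\<close>

lemma set_integrable_of_sq:
  fixes f :: "real^'n::finite \<Rightarrow> complex"
  assumes m: "(\<lambda>x. indicator S x *\<^sub>R f x) \<in> borel_measurable lebesgue" and S: "S \<in> sets lebesgue" "bounded S"
    and sq: "set_integrable lebesgue S (\<lambda>x. (cmod (f x))\<^sup>2)"
  shows "set_integrable lebesgue S f"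
  unfolding set_integrable_def
proof (rule Bochner_Integration.integrable_bound[OF _ m])
  have "S \<in> lmeasurable" using S by (simp add: bounded_set_imp_lmeasurable)
  then have "integrable lebesgue (\<lambda>x. indicator S x *\<^sub>R (1::real))"
    by (simp add: lmeasurable_iff_integrable)
  then show "integrable lebesgue (\<lambda>x. indicator S x *\<^sub>R (1::real) + indicator S x *\<^sub>R (cmod (f x))\<^sup>2)"
    using sq unfolding set_integrable_def by (rule Bochner_Integration.integrable_add)
  have "cmod (f x) \<le> 1 + (cmod (f x))\<^sup>2" for x
  proof -
    have "0 \<le> (cmod (f x))\<^sup>2 - 2 * cmod (f x) + 1"
      using zero_le_power2[of "cmod (f x) - 1"] by (simp add: power2_diff)
    then show ?thesis using norm_ge_zero[of "f x"] by linarith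
  qed
  then show "AE x in lebesgue. norm (indicator S x *\<^sub>R f x) \<le> norm (indicator S x *\<^sub>R (1::real) + indicator S x *\<^sub>R (cmod (f x))\<^sup>2)"
    by (intro AE_I2) (auto simp: indicator_def)
qed

lemma periodic_L2_loc_int:
  assumes "periodic f" "L2 cell f"
  shows "loc_int UNIV f"
  unfolding loc_int_def
proof (intro allI impI)
  fix a b :: "real^'a"
  show "set_integrable lebesgue (cbox a b) f"
    using periodic_L2_measurable[OF assms]
    by (intro set_integrable_of_sq periodic_L2_sq_integrable[OF assms] borel_measurable_scaleR borel_measurable_indicator) auto
qed

abbreviation cell_int :: "(real^'n::finite \<Rightarrow> complex) \<Rightarrow> complex" where
  "cell_int F \<equiv> integral\<^sup>L lebesgue (\<lambda>x. indicator (hcell 0) x *\<^sub>R F x)"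

lemma hcell_set_integrable: "loc_int UNIV F \<Longrightarrow> set_integrable lebesgue (hcell y) F"
  by (rule set_integrable_subset[OF _ _ hcell_subset_cbox]) (simp_all add: loc_int_def)

text \<open>The cell y and the cell shifted by t along the axis i share the slab R. What one loses
  is the slab L, what the other gains is L', and L' is L moved by a full period.\<close>

lemma cell_int_axis_shift:
  assumes p: "periodic F" and F: "loc_int UNIV F" and t: "0 \<le> t" "t \<le> 1"
  shows "integral\<^sup>L lebesgue (\<lambda>x. indicator (hcell (y + axis i t)) x *\<^sub>R F x)
    = integral\<^sup>L lebesgue (\<lambda>x. indicator (hcell y) x *\<^sub>R F x)"
proof -
  define L where "L = hcell y \<inter> {x. x $ i < y $ i + t}"
  define R where "R = hcell y \<inter> {x. y $ i + t \<le> x $ i}"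
  define L' where "L' = hcell (y + axis i t) \<inter> {x. y $ i + 1 \<le> x $ i}"
  have borel: "L \<in> sets lebesgue" "R \<in> sets lebesgue" "L' \<in> sets lebesgue"
    unfolding L_def R_def L'_def
    by (intro sets_completionI_sets; simp add: closed_halfspace_component_ge_cart open_halfspace_component_lt_cart sets.Int)+
  have ax: "axis i t $ c = (if c = i then t else 0)" for c by (simp add: axis_def)
  have "hcell y = L \<union> R" "L \<inter> R = {}" by (auto simp: L_def R_def)
  then have ind: "indicator (hcell y) x = (indicator L x + indicator R x :: real)" for x
    by (auto simp: indicator_def)
  have "x \<in> hcell (y + axis i t) \<longleftrightarrow> x \<in> L' \<or> x \<in> R" for x
  proof
    assume x: "x \<in> hcell (y + axis i t)"
    show "x \<in> L' \<or> x \<in> R"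
    proof (cases "y $ i + 1 \<le> x $ i")
      case False
      have "y $ c \<le> x $ c \<and> x $ c < y $ c + 1" for c
        using x False t unfolding hcell_def mem_Collect_eq vector_add_component ax
        by (cases "c = i") (auto dest!: spec[of _ c])
      moreover have "y $ i + t \<le> x $ i" using x unfolding hcell_def mem_Collect_eq vector_add_component ax
        by (auto dest!: spec[of _ i])
      ultimately show ?thesis by (simp add: R_def hcell_def)
    qed (use x in \<open>simp add: L'_def\<close>)
  next
    assume "x \<in> L' \<or> x \<in> R"
    then show "x \<in> hcell (y + axis i t)"
    proof
      assume x: "x \<in> R"
      have "y $ c + axis i t $ c \<le> x $ c \<and> x $ c < y $ c + axis i t $ c + 1" for c
        using x t unfolding R_def hcell_def mem_Collect_eq ax
        by (cases "c = i") (auto dest!: spec[of _ c])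
      then show ?thesis by (simp add: hcell_def)
    qed (simp add: L'_def)
  qed
  moreover have "L' \<inter> R = {}" by (auto simp: L'_def R_def hcell_def) (meson not_less)
  ultimately have ind': "indicator (hcell (y + axis i t)) x = (indicator L' x + indicator R x :: real)" for x
    by (auto simp: indicator_def)
  have LL': "x + axis i 1 \<in> L' \<longleftrightarrow> x \<in> L" for x
  proof -
    have ax1: "axis i (1::real) $ c = (if c = i then 1 else 0)" for c by (simp add: axis_def)
    have "(\<forall>c. y $ c + axis i t $ c \<le> x $ c + axis i 1 $ c \<and> x $ c + axis i 1 $ c < y $ c + axis i t $ c + 1) \<and> y $ i + 1 \<le> x $ i + axis i 1 $ i
      \<longleftrightarrow> (\<forall>c. y $ c \<le> x $ c \<and> x $ c < y $ c + 1) \<and> x $ i < y $ i + t"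
      (is "?A \<longleftrightarrow> ?B")
    proof
      assume A: ?A
      have "y $ c \<le> x $ c \<and> x $ c < y $ c + 1" for c
        using A[THEN conjunct1, rule_format, of c] A[THEN conjunct2] t unfolding ax ax1
        by (cases "c = i") auto
      moreover have "x $ i < y $ i + t"
        using A[THEN conjunct1, rule_format, of i] unfolding ax ax1 by simp
      ultimately show ?B by blast
    next
      assume B: ?B
      have "y $ c + axis i t $ c \<le> x $ c + axis i 1 $ c \<and> x $ c + axis i 1 $ c < y $ c + axis i t $ c + 1" for c
        using B[THEN conjunct1, rule_format, of c] B[THEN conjunct2] t unfolding ax ax1
        by (cases "c = i") auto
      moreover have "y $ i + 1 \<le> x $ i + axis i 1 $ i"
        using B[THEN conjunct1, rule_format, of i] unfolding ax1 by simp
      ultimately show ?A by blast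
    qed
    then show ?thesis by (simp add: L_def L'_def hcell_def)
  qed
  have int: "integrable lebesgue (\<lambda>x. indicator A x *\<^sub>R F x)" if "A \<in> sets lebesgue" "A \<subseteq> hcell z" for A z
    using set_integrable_subset[OF hcell_set_integrable[OF F] that] unfolding set_integrable_def .
  have iL: "integrable lebesgue (\<lambda>x. indicator L x *\<^sub>R F x)" by (rule int[OF borel(1), of y]) (simp add: L_def)
  have iR: "integrable lebesgue (\<lambda>x. indicator R x *\<^sub>R F x)" by (rule int[OF borel(2), of y]) (simp add: R_def)
  have iL': "integrable lebesgue (\<lambda>x. indicator L' x *\<^sub>R F x)" by (rule int[OF borel(3), of "y + axis i t"]) (simp add: L'_def)
  have "integral\<^sup>L lebesgue (\<lambda>x. indicator L' x *\<^sub>R F x) = integral\<^sup>L lebesgue (\<lambda>x. indicator L' (x + axis i 1) *\<^sub>R F (x + axis i 1))"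
    using integral_translate[of "\<lambda>x. indicator L' x *\<^sub>R F x" "axis i 1"] by simp
  also have "\<dots> = integral\<^sup>L lebesgue (\<lambda>x. indicator L x *\<^sub>R F x)"
    using p by (simp add: LL' indicator_def periodic_def)
  finally show ?thesis
    unfolding ind ind' scaleR_add_left by (simp add: iL iR iL')
qed

text \<open>The shift is carried out one coordinate at a time; the bound 1 on each coordinate is the
  range covered by \<open>cell_int_axis_shift\<close>, used in both directions.\<close>

lemma cell_int_shift:
  assumes p: "periodic F" and F: "loc_int UNIV F" and y: "\<And>c. \<bar>y $ c\<bar> \<le> 1"
  shows "cell_int (\<lambda>x. F (x + y)) = cell_int F"
proof -
  define J where "J z = integral\<^sup>L lebesgue (\<lambda>x. indicator (hcell z) x *\<^sub>R F x)" for z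
  have step: "J (z + axis i t) = J z" if "\<bar>t\<bar> \<le> 1" for z i t
  proof (cases "t \<ge> 0")
    case True then show ?thesis using cell_int_axis_shift[OF p F, of t z i] that by (simp add: J_def)
  next
    case False
    have "z + axis i t + axis i (- t) = z" by (simp add: axis_def vec_eq_iff)
    then have "J z = J (z + axis i t)"
      using cell_int_axis_shift[OF p F, of "- t" "z + axis i t" i] that False unfolding J_def by (simp only:)
    then show ?thesis ..
  qed
  have "J (\<Sum>i\<in>S. axis i (y $ i)) = J 0" if "finite S" for S
    using that
  proof (induction S)
    case (insert i S)
    then show ?case using step[OF y, of "\<Sum>i\<in>S. axis i (y $ i)" i] by (simp add: add.commute)
  qed simp
  from this[of UNIV] have J: "J y = J 0" by (simp add: vec_sum_axis)
  have "cell_int (\<lambda>x. F (x + y)) = integral\<^sup>L lebesgue (\<lambda>x. (\<lambda>x. indicator (hcell y) x *\<^sub>R F x) (x + y))"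
    using hcell_shift[of _ 0 y] by (simp add: indicator_def)
  also have "\<dots> = J y" unfolding J_def by (rule integral_translate)
  finally show ?thesis using J by (simp add: J_def)
qed

section \<open>Exchange of weak derivatives of periodic functions\<close>

lemma measurable_sq_diff:
  fixes f g :: "'a \<Rightarrow> complex"
  assumes [measurable]: "f \<in> borel_measurable M" "g \<in> borel_measurable M" "C \<in> sets M"
  shows "(\<lambda>x. indicator C x *\<^sub>R (cmod (f x - g x))\<^sup>2) \<in> borel_measurable M"
  by measurable

text \<open>Bounded continuous functions are dense in L2 of a set of finite measure: truncate a at a
  high level, then replace the truncation by continuous functions converging to it almost
  everywhere, clipped to stay bounded, and apply dominated convergence twice.\<close>

lemma truncation_approx:
  fixes a :: "real^'n::finite \<Rightarrow> complex"
  assumes a: "a \<in> borel_measurable lebesgue" and C: "C \<in> lmeasurable"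
    and sq: "set_integrable lebesgue C (\<lambda>x. (cmod (a x))\<^sup>2)" and \<delta>: "\<delta> > 0"
  shows "\<exists>s. continuous_on UNIV s \<and> (\<exists>M. \<forall>x. cmod (s x) \<le> M) \<and>
    set_integrable lebesgue C (\<lambda>x. (cmod (a x - s x))\<^sup>2) \<and>
    integral\<^sup>L lebesgue (\<lambda>x. indicator C x *\<^sub>R (cmod (a x - s x))\<^sup>2) < \<delta>"
proof -
  have Cs [measurable]: "C \<in> sets lebesgue" using C by (rule fmeasurableD)
  have intC: "integrable lebesgue (\<lambda>x. indicator C x *\<^sub>R (k::real))" for k
    using C by (simp add: lmeasurable_iff_integrable)
  define am where "am m x = (if cmod (a x) \<le> real m then a x else 0)" for m x
  have am_m [measurable]: "am m \<in> borel_measurable lebesgue" for m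
  proof -
    note [measurable] = a
    show ?thesis unfolding am_def by measurable
  qed
  have "(\<lambda>m. integral\<^sup>L lebesgue (\<lambda>x. indicator C x *\<^sub>R (cmod (a x - am m x))\<^sup>2))
      \<longlonglongrightarrow> integral\<^sup>L lebesgue (\<lambda>x::real^'n. 0::real)"
  proof (rule integral_dominated_convergence[where w = "\<lambda>x. indicator C x *\<^sub>R (cmod (a x))\<^sup>2"])
    show "AE x in lebesgue. (\<lambda>m. indicator C x *\<^sub>R (cmod (a x - am m x))\<^sup>2) \<longlonglongrightarrow> 0"
    proof (rule AE_I2)
      fix x
      obtain m0 :: nat where "cmod (a x) \<le> m0" using real_arch_simple by blast
      then have "\<forall>\<^sub>F m in sequentially. 0 = indicator C x *\<^sub>R (cmod (a x - am m x))\<^sup>2"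
        unfolding eventually_sequentially by (intro exI[of _ m0]) (auto simp: am_def)
      then show "(\<lambda>m. indicator C x *\<^sub>R (cmod (a x - am m x))\<^sup>2) \<longlonglongrightarrow> 0"
        by (rule Lim_transform_eventually[OF tendsto_const])
    qed
    show "AE x in lebesgue. norm (indicator C x *\<^sub>R (cmod (a x - am m x))\<^sup>2) \<le> indicator C x *\<^sub>R (cmod (a x))\<^sup>2" for m
      by (intro AE_I2) (auto simp: am_def indicator_def)
    show "(\<lambda>x. indicator C x *\<^sub>R (cmod (a x - am m x))\<^sup>2) \<in> borel_measurable lebesgue" for m
      using a am_m[of m] Cs by (intro measurable_sq_diff)
  qed (use sq in \<open>auto simp: set_integrable_def\<close>)
  then have "\<forall>\<^sub>F m in sequentially. integral\<^sup>L lebesgue (\<lambda>x. indicator C x *\<^sub>R (cmod (a x - am m x))\<^sup>2) < \<delta> / 4"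
    using \<delta> by (intro order_tendstoD(2)) auto
  then obtain m where m: "integral\<^sup>L lebesgue (\<lambda>x. indicator C x *\<^sub>R (cmod (a x - am m x))\<^sup>2) < \<delta> / 4"
    unfolding eventually_sequentially by blast
  have iam: "integrable lebesgue (\<lambda>x. indicator C x *\<^sub>R (cmod (a x - am m x))\<^sup>2)"
  proof (rule Bochner_Integration.integrable_bound)
    show "integrable lebesgue (\<lambda>x. indicator C x *\<^sub>R (cmod (a x))\<^sup>2)" using sq by (simp add: set_integrable_def)
    show "AE x in lebesgue. norm (indicator C x *\<^sub>R (cmod (a x - am m x))\<^sup>2) \<le> norm (indicator C x *\<^sub>R (cmod (a x))\<^sup>2)"
      by (intro AE_I2) (auto simp: am_def indicator_def)
    show "(\<lambda>x. indicator C x *\<^sub>R (cmod (a x - am m x))\<^sup>2) \<in> borel_measurable lebesgue"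
      using a am_m[of m] Cs by (intro measurable_sq_diff)
  qed
  have "am m measurable_on UNIV"
    using am_m[of m] by (simp add: measurable_on_iff_borel_measurable)
  then obtain N g where N: "negligible N" and g: "\<And>n. continuous_on UNIV (g n)"
    and lim: "\<And>x. x \<notin> N \<Longrightarrow> (\<lambda>n. g n x) \<longlonglongrightarrow> am m x"
    unfolding measurable_on_def by auto
  define M where "M = real m + 1"
  have M: "M > 0" by (simp add: M_def)
  \<comment> \<open>The radial retraction onto the disc of radius M. The truncation lies in this
    disc, so clipping does not alter the limit.\<close>
  define s where "s n x = (M / max M (cmod (g n x))) *\<^sub>R g n x" for n x
  have s_cont: "continuous_on UNIV (s n)" for n
    unfolding s_def using M g[of n]
    by (intro continuous_on_scaleR continuous_on_divide continuous_on_const continuous_on_max continuous_on_norm) auto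
  have s_le: "cmod (s n x) \<le> M" for n x
  proof -
    have "cmod (s n x) = M * (cmod (g n x) / max M (cmod (g n x)))" using M by (simp add: s_def)
    also have "\<dots> \<le> M * 1" using M by (intro mult_left_mono) (auto simp: divide_le_eq)
    finally show ?thesis by simp
  qed
  have am_le: "cmod (am m x) \<le> M" for x by (auto simp: am_def M_def)
  have s_lim: "(\<lambda>n. s n x) \<longlonglongrightarrow> am m x" if "x \<notin> N" for x
  proof -
    have "(\<lambda>n. (M / max M (cmod (g n x))) *\<^sub>R g n x) \<longlonglongrightarrow> (M / max M (cmod (am m x))) *\<^sub>R am m x"
      using M by (intro tendsto_scaleR tendsto_divide tendsto_const tendsto_max tendsto_norm lim[OF that]) auto
    then show ?thesis using am_le[of x] M by (simp add: s_def max_absorb1)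
  qed
  have s_m: "s n \<in> borel_measurable lebesgue" for n
    using borel_measurable_continuous_onI[OF s_cont[of n]] by (intro measurable_completion) simp
  have d_bd: "(cmod (am m x - s n x))\<^sup>2 \<le> (2 * M)\<^sup>2" for n x
    using norm_triangle_ineq4[of "am m x" "s n x"] am_le[of x] s_le[of n x]
    by (intro power_mono) auto
  have d_m: "(\<lambda>x. indicator C x *\<^sub>R (cmod (am m x - s n x))\<^sup>2) \<in> borel_measurable lebesgue" for n
    using s_m[of n] am_m[of m] Cs by (intro measurable_sq_diff)
  have "(\<lambda>n. integral\<^sup>L lebesgue (\<lambda>x. indicator C x *\<^sub>R (cmod (am m x - s n x))\<^sup>2))
      \<longlonglongrightarrow> integral\<^sup>L lebesgue (\<lambda>x::real^'n. 0::real)"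
  proof (rule integral_dominated_convergence[where w = "\<lambda>x. indicator C x *\<^sub>R (2 * M)\<^sup>2"])
    have "AE x in lebesgue. x \<notin> N" using N by (intro AE_not_in) (simp add: negligible_iff_null_sets)
    then show "AE x in lebesgue. (\<lambda>n. indicator C x *\<^sub>R (cmod (am m x - s n x))\<^sup>2) \<longlonglongrightarrow> 0"
    proof eventually_elim
      case (elim x)
      have "(\<lambda>n. indicator C x *\<^sub>R (cmod (am m x - s n x))\<^sup>2) \<longlonglongrightarrow> indicator C x *\<^sub>R (cmod (am m x - am m x))\<^sup>2"
        by (intro tendsto_intros s_lim elim)
      then show ?case by simp
    qed
    show "AE x in lebesgue. norm (indicator C x *\<^sub>R (cmod (am m x - s n x))\<^sup>2) \<le> indicator C x *\<^sub>R (2 * M)\<^sup>2" for n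
      using d_bd by (intro AE_I2) (auto simp: indicator_def)
  qed (use d_m intC in auto)
  then have "\<forall>\<^sub>F n in sequentially. integral\<^sup>L lebesgue (\<lambda>x. indicator C x *\<^sub>R (cmod (am m x - s n x))\<^sup>2) < \<delta> / 4"
    using \<delta> by (intro order_tendstoD(2)) auto
  then obtain n where n: "integral\<^sup>L lebesgue (\<lambda>x. indicator C x *\<^sub>R (cmod (am m x - s n x))\<^sup>2) < \<delta> / 4"
    unfolding eventually_sequentially by blast
  have isn: "integrable lebesgue (\<lambda>x. indicator C x *\<^sub>R (cmod (am m x - s n x))\<^sup>2)"
    by (rule Bochner_Integration.integrable_bound[OF intC[of "(2 * M)\<^sup>2"] d_m])
      (use d_bd in \<open>auto simp: indicator_def intro!: AE_I2\<close>)
  \<comment> \<open>From (p + q)^2 <= 2 p^2 + 2 q^2; each of the two errors is below \<delta>/4,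
    which explains that choice.\<close>
  define h where "h x = 2 * (indicator C x *\<^sub>R (cmod (a x - am m x))\<^sup>2) + 2 * (indicator C x *\<^sub>R (cmod (am m x - s n x))\<^sup>2)" for x
  have h: "integrable lebesgue h" unfolding h_def using iam isn by auto
  have le: "indicator C x *\<^sub>R (cmod (a x - s n x))\<^sup>2 \<le> h x" for x
  proof -
    have "cmod (a x - s n x) \<le> cmod (a x - am m x) + cmod (am m x - s n x)"
      using norm_triangle_ineq[of "a x - am m x" "am m x - s n x"] by simp
    then have "(cmod (a x - s n x))\<^sup>2 \<le> (cmod (a x - am m x) + cmod (am m x - s n x))\<^sup>2"
      by (intro power_mono) auto
    also have "\<dots> \<le> 2 * (cmod (a x - am m x))\<^sup>2 + 2 * (cmod (am m x - s n x))\<^sup>2"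
      using zero_le_power2[of "cmod (a x - am m x) - cmod (am m x - s n x)"]
      by (simp add: power2_sum power2_diff)
    finally show ?thesis by (simp add: h_def indicator_def)
  qed
  have int: "integrable lebesgue (\<lambda>x. indicator C x *\<^sub>R (cmod (a x - s n x))\<^sup>2)"
  proof (rule Bochner_Integration.integrable_bound[OF h])
    show "(\<lambda>x. indicator C x *\<^sub>R (cmod (a x - s n x))\<^sup>2) \<in> borel_measurable lebesgue"
      using s_m[of n] a Cs by (intro measurable_sq_diff)
    show "AE x in lebesgue. norm (indicator C x *\<^sub>R (cmod (a x - s n x))\<^sup>2) \<le> norm (h x)"
    proof (rule AE_I2)
      fix x
      have "0 \<le> indicator C x *\<^sub>R (cmod (a x - s n x))\<^sup>2" by simp
      then show "norm (indicator C x *\<^sub>R (cmod (a x - s n x))\<^sup>2) \<le> norm (h x)" using le[of x] unfolding real_norm_def by linarith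
    qed
  qed
  have "integral\<^sup>L lebesgue (\<lambda>x. indicator C x *\<^sub>R (cmod (a x - s n x))\<^sup>2) \<le> integral\<^sup>L lebesgue h"
    using int h le by (intro integral_mono)
  also have "\<dots> = 2 * integral\<^sup>L lebesgue (\<lambda>x. indicator C x *\<^sub>R (cmod (a x - am m x))\<^sup>2)
      + 2 * integral\<^sup>L lebesgue (\<lambda>x. indicator C x *\<^sub>R (cmod (am m x - s n x))\<^sup>2)"
    unfolding h_def using iam isn by simp
  also have "\<dots> < \<delta>" using m n by linarith
  finally show ?thesis using s_cont[of n] s_le[of n] int unfolding set_integrable_def
    by (intro exI[of _ "s n"]) blast
qed

text \<open>The correlation of A and B, integrated against a bounded function of the shift, equals
  the integral of B against a pairing of A with translates of that function. Derivatives of A can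
  then be moved to the translated function.\<close>

lemma convolution_Fubini:
  fixes A B :: "real^'n::finite \<Rightarrow> complex" and \<psi> :: "real^'n \<Rightarrow> complex"
  assumes A: "integrable lebesgue A" and B: "integrable lebesgue B"
    and \<psi>: "\<psi> \<in> borel_measurable borel" "\<And>y. cmod (\<psi> y) \<le> M"
  shows "integral\<^sup>L lebesgue (\<lambda>y. \<psi> y * integral\<^sup>L lebesgue (\<lambda>x. A (x + y) * B x))
    = integral\<^sup>L lebesgue (\<lambda>x. B x * integral\<^sup>L lebesgue (\<lambda>y. A y * \<psi> (y - x)))"
    and "integrable lebesgue (\<lambda>y. \<psi> y * integral\<^sup>L lebesgue (\<lambda>x. A (x + y) * B x))"
proof -
  obtain A' where A'm [measurable]: "A' \<in> borel_measurable borel" and AA': "AE x in lebesgue. A x = A' x"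
    using borel_representative[OF borel_measurable_integrable[OF A]] .
  obtain B' where B'm [measurable]: "B' \<in> borel_measurable borel" and BB': "AE x in lebesgue. B x = B' x"
    using borel_representative[OF borel_measurable_integrable[OF B]] .
  note [measurable] = \<psi>(1)
  have leb: "f \<in> borel_measurable lebesgue" if "f \<in> borel_measurable borel" for f :: "real^'n \<Rightarrow> complex"
    using that by (intro measurable_completion) simp
  have A'i: "integrable lborel A'"
    using integrable_cong_AE_imp[OF A leb[OF A'm] AA'] by (simp add: integrable_completion)
  have B'i: "integrable lborel B'"
    using integrable_cong_AE_imp[OF B leb[OF B'm] BB'] by (simp add: integrable_completion)
  have conv: "integral\<^sup>L lebesgue (\<lambda>x. A (x + y) * B x) = integral\<^sup>L lborel (\<lambda>x. A' (x + y) * B' x)" for y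
  proof -
    have "integral\<^sup>L lebesgue (\<lambda>x. A (x + y) * B x) = integral\<^sup>L lebesgue (\<lambda>x. A' (x + y) * B' x)"
    proof (rule integral_cong_AE)
      show "AE x in lebesgue. A (x + y) * B x = A' (x + y) * B' x"
        using AE_translate[OF AA', of y] BB' by eventually_elim simp
      show "(\<lambda>x. A (x + y) * B x) \<in> borel_measurable lebesgue"
        using A B by (intro borel_measurable_times measurable_lebesgue_translate) auto
    qed (intro leb; measurable)
    also have "\<dots> = integral\<^sup>L lborel (\<lambda>x. A' (x + y) * B' x)"
      by (rule integral_completion) measurable
    finally show ?thesis .
  qed
  have tr: "integrable lborel (\<lambda>y. f (x + y))" "integral\<^sup>L lborel (\<lambda>y. f (x + y)) = integral\<^sup>L lborel f"
    if "integrable lborel f" for f :: "real^'n \<Rightarrow> 'c::{banach, second_countable_topology}" and x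
  proof -
    have fm [measurable]: "f \<in> borel_measurable borel" using that by auto
    have "integrable lebesgue (\<lambda>y. f (y + x))"
      using that by (intro integrable_translate) (simp add: integrable_completion)
    then show "integrable lborel (\<lambda>y. f (x + y))"
      by (subst (asm) integrable_completion) (measurable, simp add: add.commute)
    have "integral\<^sup>L lborel (\<lambda>y. f (x + y)) = integral\<^sup>L lebesgue (\<lambda>y. f (x + y))"
      by (rule integral_completion[symmetric]) measurable
    also have "\<dots> = integral\<^sup>L lebesgue f" using integral_translate[of f x] by (simp add: add.commute)
    also have "\<dots> = integral\<^sup>L lborel f" by (rule integral_completion) measurable
    finally show "integral\<^sup>L lborel (\<lambda>y. f (x + y)) = integral\<^sup>L lborel f" .
  qed
  define F where "F x y = \<psi> y * (A' (x + y) * B' x)" for x y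
  \<comment> \<open>Absolute integrability comes from translation invariance: the inner integral of
    |A'(x + y)| over y does not depend on x.\<close>
  have base: "integrable (lborel \<Otimes>\<^sub>M lborel) (\<lambda>z. A' (fst z + snd z) * B' (fst z))"
  proof (rule lborel_pair.Fubini_integrable)
    show "(\<lambda>z. A' (fst z + snd z) * B' (fst z)) \<in> borel_measurable (lborel \<Otimes>\<^sub>M lborel)" by measurable
    have "(\<lambda>x. integral\<^sup>L lborel (\<lambda>y. norm (A' (fst (x, y) + snd (x, y)) * B' (fst (x, y)))))
        = (\<lambda>x. integral\<^sup>L lborel (\<lambda>y. norm (A' y)) * norm (B' x))"
      using tr(2)[OF integrable_norm[OF A'i]] by (simp add: norm_mult)
    then show "integrable lborel (\<lambda>x. integral\<^sup>L lborel (\<lambda>y. norm (A' (fst (x, y) + snd (x, y)) * B' (fst (x, y)))))"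
      using B'i by simp
    show "AE x in lborel. integrable lborel (\<lambda>y. A' (fst (x, y) + snd (x, y)) * B' (fst (x, y)))"
      using tr(1)[OF A'i] by (intro AE_I2) simp
  qed
  have Fi: "integrable (lborel \<Otimes>\<^sub>M lborel) (case_prod F)"
  proof -
    have "integrable (lborel \<Otimes>\<^sub>M lborel) (\<lambda>z. (A' (fst z + snd z) * B' (fst z)) * \<psi> (snd z))"
      by (rule integrable_bounded_mult[OF base, where B = M]) (measurable, rule \<psi>(2))
    moreover have "case_prod F = (\<lambda>z. (A' (fst z + snd z) * B' (fst z)) * \<psi> (snd z))"
      by (auto simp: F_def fun_eq_iff)
    ultimately show ?thesis by simp
  qed
  have lhs: "(\<lambda>y. \<psi> y * integral\<^sup>L lebesgue (\<lambda>x. A (x + y) * B x)) = (\<lambda>y. integral\<^sup>L lborel (\<lambda>x. F x y))"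
    unfolding conv F_def by simp
  have I: "integrable lborel (\<lambda>y. integral\<^sup>L lborel (\<lambda>x. F x y))"
    by (rule lborel_pair.integrable_snd[OF Fi])
  then have Im: "(\<lambda>y. integral\<^sup>L lborel (\<lambda>x. F x y)) \<in> borel_measurable borel" by auto
  show "integrable lebesgue (\<lambda>y. \<psi> y * integral\<^sup>L lebesgue (\<lambda>x. A (x + y) * B x))"
    unfolding lhs using I Im by (subst integrable_completion) auto
  have "integral\<^sup>L lebesgue (\<lambda>y. \<psi> y * integral\<^sup>L lebesgue (\<lambda>x. A (x + y) * B x))
      = integral\<^sup>L lborel (\<lambda>y. integral\<^sup>L lborel (\<lambda>x. F x y))"
    unfolding lhs using Im by (intro integral_completion) auto
  also have "\<dots> = integral\<^sup>L lborel (\<lambda>x. integral\<^sup>L lborel (\<lambda>y. F x y))"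
    by (rule lborel_pair.Fubini_integral[OF Fi])
  also have "\<dots> = integral\<^sup>L lborel (\<lambda>x. B' x * integral\<^sup>L lborel (\<lambda>y. A' y * \<psi> (y - x)))"
  proof (rule Bochner_Integration.integral_cong[OF refl])
    fix x
    have i: "integrable lborel (\<lambda>y. A' y * \<psi> (y - x))"
      by (rule integrable_bounded_mult[OF A'i, where B = M]) (measurable, rule \<psi>(2))
    have "integral\<^sup>L lborel (\<lambda>y. F x y) = integral\<^sup>L lborel (\<lambda>y. B' x * (A' (x + y) * \<psi> (x + y - x)))"
      by (simp add: F_def mult_ac)
    also have "\<dots> = B' x * integral\<^sup>L lborel (\<lambda>y. A' y * \<psi> (y - x))"
      using tr(2)[OF i, of x] by simp
    finally show "integral\<^sup>L lborel (\<lambda>y. F x y) = B' x * integral\<^sup>L lborel (\<lambda>y. A' y * \<psi> (y - x))" .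
  qed
  also have "\<dots> = integral\<^sup>L lebesgue (\<lambda>x. B' x * integral\<^sup>L lborel (\<lambda>y. A' y * \<psi> (y - x)))"
    by (rule integral_completion[symmetric]) measurable
  also have "\<dots> = integral\<^sup>L lebesgue (\<lambda>x. B x * integral\<^sup>L lebesgue (\<lambda>y. A y * \<psi> (y - x)))"
  proof -
    have eq: "integral\<^sup>L lborel (\<lambda>y. A' y * \<psi> (y - x)) = integral\<^sup>L lebesgue (\<lambda>y. A y * \<psi> (y - x))" for x
    proof -
      have "integral\<^sup>L lborel (\<lambda>y. A' y * \<psi> (y - x)) = integral\<^sup>L lebesgue (\<lambda>y. A' y * \<psi> (y - x))"
        by (rule integral_completion[symmetric]) measurable
      also have "\<dots> = integral\<^sup>L lebesgue (\<lambda>y. A y * \<psi> (y - x))"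
      proof (rule integral_cong_AE)
        show "AE y in lebesgue. A' y * \<psi> (y - x) = A y * \<psi> (y - x)" using AA' by eventually_elim simp
        show "(\<lambda>y. A y * \<psi> (y - x)) \<in> borel_measurable lebesgue"
        proof (rule borel_measurable_times)
          show "(\<lambda>y. \<psi> (y - x)) \<in> borel_measurable lebesgue" by (intro leb) measurable
        qed (use A in auto)
      qed (intro leb; measurable)
      finally show ?thesis .
    qed
    have m: "(\<lambda>x. integral\<^sup>L lebesgue (\<lambda>y. A y * \<psi> (y - x))) \<in> borel_measurable lebesgue"
      unfolding eq[symmetric] by (intro leb) measurable
    show ?thesis
      unfolding eq
    proof (rule integral_cong_AE)
      show "AE x in lebesgue. B' x * integral\<^sup>L lebesgue (\<lambda>y. A y * \<psi> (y - x)) = B x * integral\<^sup>L lebesgue (\<lambda>y. A y * \<psi> (y - x))"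
        using BB' by eventually_elim simp
    qed (use m leb[OF B'm] B in \<open>auto intro!: borel_measurable_times\<close>)
  qed
  finally show "integral\<^sup>L lebesgue (\<lambda>y. \<psi> y * integral\<^sup>L lebesgue (\<lambda>x. A (x + y) * B x))
    = integral\<^sup>L lebesgue (\<lambda>x. B x * integral\<^sup>L lebesgue (\<lambda>y. A y * \<psi> (y - x)))" .
qed


section \<open>Cross-correlation of periodic functions\<close>

definition pconv :: "(real^'n::finite \<Rightarrow> complex) \<Rightarrow> (real^'n \<Rightarrow> complex) \<Rightarrow> real^'n \<Rightarrow> complex" where
  "pconv a b y = cell_int (\<lambda>x. a (x + y) * b x)"

lemma pconv_Fubini:
  assumes a: "loc_int UNIV a" and b: "loc_int UNIV b" and \<phi>: "ptest l u \<phi>"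
  shows "pair_int (pconv a b) \<phi> = cell_int (\<lambda>x. b x * pair_int a (\<lambda>y. \<phi> (y - x)))"
    and "integrable lebesgue (\<lambda>y. pconv a b y * of_real (\<phi> y))"
proof -
  \<comment> \<open>For x in the unit cell and y in the support box, x + y lies in the box enlarged
    by 1; cutting a there makes it integrable without changing the pairing.\<close>
  define A where "A x = indicator (cbox l (u + 1)) x *\<^sub>R a x" for x
  define B where "B x = indicator (hcell 0) x *\<^sub>R b x" for x
  have A: "integrable lebesgue A" using a unfolding A_def loc_int_def set_integrable_def by blast
  have B: "integrable lebesgue B" using hcell_set_integrable[OF b, of 0] unfolding B_def set_integrable_def .
  obtain M where M: "\<And>x. \<bar>\<phi> x\<bar> \<le> M" using ptest_bounded[OF \<phi>] by blast
  have \<psi>m: "(\<lambda>y. complex_of_real (\<phi> y)) \<in> borel_measurable borel"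
    using ptest_measurable[OF \<phi>] by simp
  have in_box: "x + y \<in> cbox l (u + 1)" if "x \<in> hcell 0" "y \<in> cbox l u" for x y
  proof -
    have "l $ c \<le> x $ c + y $ c \<and> x $ c + y $ c \<le> u $ c + 1" for c
    proof -
      have "0 \<le> x $ c" "x $ c < 1" "l $ c \<le> y $ c" "y $ c \<le> u $ c"
        using that by (auto simp: hcell_def mem_box_cart)
      then show ?thesis by linarith
    qed
    then show ?thesis by (simp add: mem_box_cart)
  qed
  have pt: "complex_of_real (\<phi> y) * integral\<^sup>L lebesgue (\<lambda>x. A (x + y) * B x) = pconv a b y * of_real (\<phi> y)" for y
  proof (cases "y \<in> cbox l u")
    case True
    have "(\<lambda>x. A (x + y) * B x) = (\<lambda>x. indicator (hcell 0) x *\<^sub>R (a (x + y) * b x))"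
      using in_box[OF _ True] by (auto simp: A_def B_def indicator_def)
    then show ?thesis by (simp add: pconv_def)
  next
    case False then show ?thesis using ptest_zero[OF \<phi>] by simp
  qed
  have "B x * integral\<^sup>L lebesgue (\<lambda>y. A y * of_real (\<phi> (y - x))) = indicator (hcell 0) x *\<^sub>R (b x * pair_int a (\<lambda>y. \<phi> (y - x)))" for x
  proof (cases "x \<in> hcell 0")
    case True
    have eq: "A y * of_real (\<phi> (y - x)) = a y * of_real (\<phi> (y - x))" for y
    proof (cases "y - x \<in> cbox l u")
      case y: True
      then show ?thesis using in_box[OF True y] by (simp add: A_def)
    qed (use ptest_zero[OF \<phi>] in simp)
    show ?thesis unfolding eq using True by (simp add: B_def)
  qed (simp add: B_def)
  then show "pair_int (pconv a b) \<phi> = cell_int (\<lambda>x. b x * pair_int a (\<lambda>y. \<phi> (y - x)))"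
    using convolution_Fubini(1)[OF A B \<psi>m, of M] M unfolding pt by simp
  show "integrable lebesgue (\<lambda>y. pconv a b y * of_real (\<phi> y))"
    using convolution_Fubini(2)[OF A B \<psi>m, of M] M unfolding pt by simp
qed

text \<open>Correlating with a fixed b commutes with the weak derivative of the first factor. Only
  the first factor can be differentiated in this way, so a derivative of the second one has to be
  brought there by a reflection.\<close>

lemma pconv_weak:
  assumes a: "loc_int UNIV a" "loc_int UNIV g" "weak_pt UNIV a i g" and b: "loc_int UNIV b" and \<phi>: "ptest l u \<phi>"
  shows "pair_int (pconv g b) \<phi> = - pair_int (pconv a b) (pd i \<phi>)"
proof -
  have "pair_int g (\<lambda>y. \<phi> (y - x)) = - pair_int a (\<lambda>y. pd i \<phi> (y - x))" for x
  proof -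
    have "pair_int a (pd i (\<lambda>y. \<phi> (y - x))) = - pair_int g (\<lambda>y. \<phi> (y - x))"
      using a(3) ptest_translate[OF \<phi>, of x] unfolding weak_pt_def by blast
    then show ?thesis using pd_translate[OF \<phi>, of i x] by simp
  qed
  then show ?thesis
    unfolding pconv_Fubini(1)[OF a(2) b \<phi>] pconv_Fubini(1)[OF a(1) b ptest_pd[OF \<phi>]] by simp
qed

text \<open>The weighted form of the inequality between arithmetic and geometric mean. The free
  weight r later gives the Cauchy-Schwarz inequality by optimisation, and smallness of a product
  when one factor is small.\<close>

lemma sq_prod_bound: "cmod (x * y) \<le> (r / 2) * (cmod x)\<^sup>2 + (1 / (2 * r)) * (cmod y)\<^sup>2" if "r > 0" for x y :: complex
proof -
  have "0 \<le> (r * cmod x - cmod y)\<^sup>2" by simp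
  also have "\<dots> = r\<^sup>2 * (cmod x)\<^sup>2 - 2 * r * (cmod x * cmod y) + (cmod y)\<^sup>2"
    by (simp add: power2_diff power_mult_distrib)
  finally have "2 * r * (cmod x * cmod y) \<le> r\<^sup>2 * (cmod x)\<^sup>2 + (cmod y)\<^sup>2" by linarith
  then have "(2 * r * (cmod x * cmod y)) / (2 * r) \<le> (r\<^sup>2 * (cmod x)\<^sup>2 + (cmod y)\<^sup>2) / (2 * r)"
    using that by (intro divide_right_mono) auto
  then show ?thesis using that by (simp add: norm_mult add_divide_distrib power2_eq_square)
qed

lemma
  fixes f g :: "'a \<Rightarrow> complex"
  assumes m: "f \<in> borel_measurable M" "g \<in> borel_measurable M"
    and sq: "integrable M (\<lambda>x. (cmod (f x))\<^sup>2)" "integrable M (\<lambda>x. (cmod (g x))\<^sup>2)"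
  shows sq_prod_integrable: "integrable M (\<lambda>x. f x * g x)"
    and sq_prod_integral_bound: "\<And>r. r > 0 \<Longrightarrow> cmod (integral\<^sup>L M (\<lambda>x. f x * g x))
      \<le> (r / 2) * integral\<^sup>L M (\<lambda>x. (cmod (f x))\<^sup>2) + (1 / (2 * r)) * integral\<^sup>L M (\<lambda>x. (cmod (g x))\<^sup>2)"
proof -
  have int: "integrable M (\<lambda>x. (r / 2) * (cmod (f x))\<^sup>2 + (1 / (2 * r)) * (cmod (g x))\<^sup>2)" for r
    using sq by auto
  show i: "integrable M (\<lambda>x. f x * g x)"
  proof (rule Bochner_Integration.integrable_bound[OF int[of 1]])
    show "AE x in M. norm (f x * g x) \<le> norm ((1 / 2) * (cmod (f x))\<^sup>2 + (1 / (2 * 1)) * (cmod (g x))\<^sup>2)"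
      using sq_prod_bound[of 1] by (intro AE_I2) (auto simp: abs_of_nonneg)
  qed (use m in auto)
  fix r :: real assume r: "r > 0"
  have "cmod (integral\<^sup>L M (\<lambda>x. f x * g x)) \<le> integral\<^sup>L M (\<lambda>x. cmod (f x * g x))"
    by (rule integral_norm_bound)
  also have "\<dots> \<le> integral\<^sup>L M (\<lambda>x. (r / 2) * (cmod (f x))\<^sup>2 + (1 / (2 * r)) * (cmod (g x))\<^sup>2)"
    using i int sq_prod_bound[OF r] by (intro integral_mono) auto
  also have "\<dots> = (r / 2) * integral\<^sup>L M (\<lambda>x. (cmod (f x))\<^sup>2) + (1 / (2 * r)) * integral\<^sup>L M (\<lambda>x. (cmod (g x))\<^sup>2)"
    using sq by simp
  finally show "cmod (integral\<^sup>L M (\<lambda>x. f x * g x))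
      \<le> (r / 2) * integral\<^sup>L M (\<lambda>x. (cmod (f x))\<^sup>2) + (1 / (2 * r)) * integral\<^sup>L M (\<lambda>x. (cmod (g x))\<^sup>2)" .
qed

definition per_L2 :: "(real^'n::finite \<Rightarrow> complex) \<Rightarrow> bool" where
  "per_L2 f \<longleftrightarrow> periodic f \<and> L2 cell f"

lemma per_L2_D:
  assumes "per_L2 f"
  shows "periodic f" "f \<in> borel_measurable lebesgue" "loc_int UNIV f"
    "set_integrable lebesgue (cbox a b) (\<lambda>x. (cmod (f x))\<^sup>2)"
    "set_integrable lebesgue (hcell y) (\<lambda>x. (cmod (f x))\<^sup>2)"
proof -
  have f: "periodic f" "L2 cell f" using assms by (auto simp: per_L2_def)
  show "periodic f" "f \<in> borel_measurable lebesgue" "loc_int UNIV f"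
    "set_integrable lebesgue (cbox a b) (\<lambda>x. (cmod (f x))\<^sup>2)"
    using f periodic_L2_measurable[OF f] periodic_L2_loc_int[OF f] periodic_L2_sq_integrable[OF f] by auto
  show "set_integrable lebesgue (hcell y) (\<lambda>x. (cmod (f x))\<^sup>2)"
    by (rule set_integrable_subset[OF periodic_L2_sq_integrable[OF f] _ hcell_subset_cbox]) simp
qed

lemma per_L2_prod_loc_int:
  assumes a: "per_L2 a" and b: "per_L2 b"
  shows "loc_int UNIV (\<lambda>x. a (x + y) * b x)"
  unfolding loc_int_def
proof (intro allI impI)
  fix l u :: "real^'a"
  have "integrable lebesgue (\<lambda>x. (indicator (cbox l u) x *\<^sub>R a (x + y)) * (indicator (cbox l u) x *\<^sub>R b x))"
  proof (rule sq_prod_integrable)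
    have "integrable lebesgue (\<lambda>x. indicator (cbox (l + y) (u + y)) (x + y) *\<^sub>R (cmod (a (x + y)))\<^sup>2)"
      using integrable_translate[OF per_L2_D(4)[OF a, unfolded set_integrable_def, of "l + y" "u + y"], of y] .
    moreover have "indicator (cbox (l + y) (u + y)) (x + y) *\<^sub>R (cmod (a (x + y)))\<^sup>2
        = (cmod (indicat_real (cbox l u) x *\<^sub>R a (x + y)))\<^sup>2" for x
      by (simp add: indicator_def mem_box_cart)
    ultimately show "integrable lebesgue (\<lambda>x. (cmod (indicat_real (cbox l u) x *\<^sub>R a (x + y)))\<^sup>2)" by simp
    have "(cmod (indicat_real (cbox l u) x *\<^sub>R b x))\<^sup>2 = indicator (cbox l u) x *\<^sub>R (cmod (b x))\<^sup>2" for x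
      by (simp add: indicator_def)
    then show "integrable lebesgue (\<lambda>x. (cmod (indicat_real (cbox l u) x *\<^sub>R b x))\<^sup>2)"
      using per_L2_D(4)[OF b, of l u] by (simp add: set_integrable_def)
  qed (use per_L2_D(2)[OF a] per_L2_D(2)[OF b] in \<open>auto intro!: borel_measurable_scaleR borel_measurable_indicator measurable_lebesgue_translate\<close>)
  moreover have "(indicat_real (cbox l u) x *\<^sub>R a (x + y)) * (indicat_real (cbox l u) x *\<^sub>R b x)
      = indicator (cbox l u) x *\<^sub>R (a (x + y) * b x)" for x
    by (cases "x \<in> cbox l u") simp_all
  ultimately show "set_integrable lebesgue (cbox l u) (\<lambda>x. a (x + y) * b x)"
    by (simp only: set_integrable_def)
qed

text \<open>Exchanging the factors reflects the argument: move the integration variable by y and use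
  that the integrand is periodic.\<close>

lemma pconv_swap:
  assumes a: "per_L2 a" and b: "per_L2 b" and y: "\<And>c. \<bar>y $ c\<bar> \<le> 1"
  shows "pconv a b y = pconv b a (- y)"
proof -
  have "cell_int (\<lambda>x. (\<lambda>x. b (x + - y) * a x) (x + y)) = cell_int (\<lambda>x. b (x + - y) * a x)"
  proof (rule cell_int_shift[OF _ per_L2_prod_loc_int[OF b a] y])
    show "periodic (\<lambda>x. b (x + - y) * a x)"
      using per_L2_D(1)[OF a] per_L2_D(1)[OF b] unfolding periodic_def
      by (metis add.commute add.left_commute)
  qed
  then show ?thesis by (simp add: pconv_def mult.commute)
qed

text \<open>Continuity of translations in L2. Replacing a by a bounded continuous s costs an error
  uniform in small shifts, and for s dominated convergence applies.\<close>

lemma pconv_continuous_0: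
  fixes a b :: "real^'n::finite \<Rightarrow> complex"
  assumes a: "per_L2 a" and b: "per_L2 b"
  shows "(pconv a b \<longlongrightarrow> pconv a b 0) (at 0)"
proof (rule tendstoI)
  fix \<epsilon> :: real assume \<epsilon>: "\<epsilon> > 0"
  define \<beta> where "\<beta> = integral\<^sup>L lebesgue (\<lambda>x. indicator (hcell 0) x *\<^sub>R (cmod (b x))\<^sup>2)"
  have \<beta>: "\<beta> \<ge> 0" unfolding \<beta>_def by (intro Bochner_Integration.integral_nonneg) simp
  \<comment> \<open>With this weight the b part of the weighted bound is at most \<epsilon>/4 (the
    summand 1 covers b = 0), while the required closeness of s makes the other part at most
    \<epsilon>/8. Two replacements of 3\<epsilon>/8 and one limit error \<epsilon>/8 stay below
    \<epsilon>.\<close>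
  define r where "r = 2 * (\<beta> + 1) / \<epsilon>"
  have r: "r > 0" using \<beta> \<epsilon> by (simp add: r_def)
  have r\<beta>: "(1 / (2 * r)) * \<beta> \<le> \<epsilon> / 4"
  proof -
    have "(1 / (2 * r)) * \<beta> = (\<epsilon> / 4) * (\<beta> / (\<beta> + 1))" using \<epsilon> \<beta> by (simp add: r_def field_simps)
    also have "\<dots> \<le> (\<epsilon> / 4) * 1" using \<epsilon> \<beta> by (intro mult_left_mono) (auto simp: divide_le_eq)
    finally show ?thesis by simp
  qed
  \<comment> \<open>This box contains x + y for all x in the unit cell and all shifts with
    coordinates in [-1, 1].\<close>
  define C where "C = cbox (- 1 :: real^'n) 2"
  have C: "C \<in> lmeasurable" by (simp add: C_def)
  obtain s M where s: "continuous_on UNIV s" and sM: "\<And>x. cmod (s x) \<le> M"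
    and si: "set_integrable lebesgue C (\<lambda>x. (cmod (a x - s x))\<^sup>2)"
    and sl: "integral\<^sup>L lebesgue (\<lambda>x. indicator C x *\<^sub>R (cmod (a x - s x))\<^sup>2) < \<epsilon> / (4 * r)"
    using truncation_approx[OF per_L2_D(2)[OF a] C, of "\<epsilon> / (4 * r)"] per_L2_D(4)[OF a, of "- 1" 2] \<epsilon> r
    unfolding C_def by auto
  have sb: "s \<in> borel_measurable lebesgue"
    using borel_measurable_continuous_onI[OF s] by (intro measurable_completion) simp
  have am: "a \<in> borel_measurable lebesgue" and bm: "b \<in> borel_measurable lebesgue"
    using per_L2_D(2) a b by auto
  have bi: "integrable lebesgue (\<lambda>x. indicator (hcell 0) x *\<^sub>R b x)"
    using hcell_set_integrable[OF per_L2_D(3)[OF b], of 0] by (simp add: set_integrable_def)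
  have s_int: "integrable lebesgue (\<lambda>x. indicator (hcell 0) x *\<^sub>R (s (x + y) * b x))" for y
  proof -
    have "integrable lebesgue (\<lambda>x. (indicator (hcell 0) x *\<^sub>R b x) * s (x + y))"
      using sM by (intro integrable_bounded_mult[OF bi, where B = M] measurable_lebesgue_translate sb)
    then show ?thesis by (simp add: mult_ac)
  qed
  have a_int: "integrable lebesgue (\<lambda>x. indicator (hcell 0) x *\<^sub>R (a (x + y) * b x))" for y
    using hcell_set_integrable[OF per_L2_prod_loc_int[OF a b], of 0 y] by (simp add: set_integrable_def)
  have diff: "cmod (pconv a b y - pconv s b y) \<le> 3 * \<epsilon> / 8" if y: "\<And>c. \<bar>y $ c\<bar> \<le> 1" for y
  proof -
    define p where "p x = indicator (hcell 0) x *\<^sub>R (a (x + y) - s (x + y))" for x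
    define q where "q x = indicator (hcell 0) x *\<^sub>R b x" for x
    define P where "P x = indicator C (x + y) *\<^sub>R (cmod (a (x + y) - s (x + y)))\<^sup>2" for x
    have in_C: "x + y \<in> C" if "x \<in> hcell 0" for x
    proof -
      have "- 1 \<le> x $ c + y $ c \<and> x $ c + y $ c \<le> 2" for c
      proof -
        have "0 \<le> x $ c" "x $ c < 1" using that by (auto simp: hcell_def)
        then show ?thesis using y[of c] by linarith
      qed
      then show ?thesis by (simp add: C_def mem_box_cart)
    qed
    have P: "integrable lebesgue P"
      using integrable_translate[OF si[unfolded set_integrable_def], of y] unfolding P_def .
    have Pint: "integral\<^sup>L lebesgue P < \<epsilon> / (4 * r)"
      using sl integral_translate[of "\<lambda>x. indicator C x *\<^sub>R (cmod (a x - s x))\<^sup>2" y] unfolding P_def by simp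
    have pm: "p \<in> borel_measurable lebesgue" unfolding p_def
      using am sb by (intro borel_measurable_scaleR borel_measurable_indicator borel_measurable_diff measurable_lebesgue_translate) auto
    have qm: "q \<in> borel_measurable lebesgue" unfolding q_def
      using bm by (intro borel_measurable_scaleR borel_measurable_indicator) auto
    have pP: "(cmod (p x))\<^sup>2 \<le> P x" for x
      using in_C[of x] by (auto simp: p_def P_def indicator_def)
    have p2: "integrable lebesgue (\<lambda>x. (cmod (p x))\<^sup>2)"
    proof (rule Bochner_Integration.integrable_bound[OF P])
      show "AE x in lebesgue. norm ((cmod (p x))\<^sup>2) \<le> norm (P x)"
        using pP by (intro AE_I2) (auto intro: order_trans[OF _ abs_ge_self])
    qed (use pm in auto)
    have q2e: "(cmod (q x))\<^sup>2 = indicator (hcell 0) x *\<^sub>R (cmod (b x))\<^sup>2" for x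
      by (simp add: q_def indicator_def)
    have q2: "integrable lebesgue (\<lambda>x. (cmod (q x))\<^sup>2)"
      unfolding q2e using per_L2_D(5)[OF b, of 0] by (simp add: set_integrable_def)
    have "pconv a b y - pconv s b y = integral\<^sup>L lebesgue (\<lambda>x. p x * q x)"
    proof -
      have "p x * q x = indicator (hcell 0) x *\<^sub>R (a (x + y) * b x) - indicator (hcell 0) x *\<^sub>R (s (x + y) * b x)" for x
        by (simp add: p_def q_def indicator_def left_diff_distrib)
      then show ?thesis unfolding pconv_def using a_int[of y] s_int[of y] by simp
    qed
    also have "cmod \<dots> \<le> (r / 2) * integral\<^sup>L lebesgue (\<lambda>x. (cmod (p x))\<^sup>2) + (1 / (2 * r)) * integral\<^sup>L lebesgue (\<lambda>x. (cmod (q x))\<^sup>2)"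
      by (rule sq_prod_integral_bound[OF pm qm p2 q2 r])
    also have "\<dots> \<le> (r / 2) * (\<epsilon> / (4 * r)) + \<epsilon> / 4"
    proof (intro add_mono mult_left_mono)
      have "integral\<^sup>L lebesgue (\<lambda>x. (cmod (p x))\<^sup>2) \<le> integral\<^sup>L lebesgue P"
        using p2 P pP by (intro integral_mono)
      then show "integral\<^sup>L lebesgue (\<lambda>x. (cmod (p x))\<^sup>2) \<le> \<epsilon> / (4 * r)" using Pint by linarith
      show "(1 / (2 * r)) * integral\<^sup>L lebesgue (\<lambda>x. (cmod (q x))\<^sup>2) \<le> \<epsilon> / 4"
        using r\<beta> unfolding q2e \<beta>_def .
    qed (use r in simp)
    also have "\<dots> = 3 * \<epsilon> / 8" using r by (simp add: field_simps)
    finally show ?thesis .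
  qed
  have s_lim: "(pconv s b \<longlongrightarrow> pconv s b 0) (at 0)"
    unfolding tendsto_at_iff_sequentially
  proof (intro allI impI)
    fix y :: "nat \<Rightarrow> real^'n" assume "\<forall>i. y i \<in> UNIV - {0}" and y: "y \<longlonglongrightarrow> 0"
    have "(\<lambda>i. integral\<^sup>L lebesgue (\<lambda>x. indicator (hcell 0) x *\<^sub>R (s (x + y i) * b x)))
      \<longlonglongrightarrow> integral\<^sup>L lebesgue (\<lambda>x. indicator (hcell 0) x *\<^sub>R (s (x + 0) * b x))"
    proof (rule integral_dominated_convergence[where w = "\<lambda>x. M * norm (indicator (hcell 0) x *\<^sub>R b x)"])
      show "integrable lebesgue (\<lambda>x. M * norm (indicat_real (hcell 0) x *\<^sub>R b x))" using integrable_norm[OF bi] by simp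
      show "AE x in lebesgue. (\<lambda>i. indicator (hcell 0) x *\<^sub>R (s (x + y i) * b x)) \<longlonglongrightarrow> indicator (hcell 0) x *\<^sub>R (s (x + 0) * b x)"
      proof (rule AE_I2)
        fix x
        have "(\<lambda>i. s (x + y i)) \<longlonglongrightarrow> s (x + 0)"
          by (rule continuous_on_tendsto_compose[OF s tendsto_add[OF tendsto_const y]]) auto
        then show "(\<lambda>i. indicator (hcell 0) x *\<^sub>R (s (x + y i) * b x)) \<longlonglongrightarrow> indicator (hcell 0) x *\<^sub>R (s (x + 0) * b x)"
          by (intro tendsto_scaleR tendsto_mult tendsto_const)
      qed
      show "AE x in lebesgue. norm (indicat_real (hcell 0) x *\<^sub>R (s (x + y i) * b x)) \<le> M * norm (indicat_real (hcell 0) x *\<^sub>R b x)" for i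
        using sM by (intro AE_I2) (auto simp: indicator_def norm_mult mult_right_mono)
    qed (use borel_measurable_integrable[OF s_int] borel_measurable_integrable[OF s_int[of 0]] in auto)
    then show "(pconv s b \<circ> y) \<longlonglongrightarrow> pconv s b 0" by (simp add: o_def pconv_def)
  qed
  have "\<forall>\<^sub>F y in at 0. dist (pconv s b y) (pconv s b 0) < \<epsilon> / 8"
    using s_lim \<epsilon> by (intro tendstoD) auto
  moreover have "\<forall>\<^sub>F y in at 0. norm (y :: real^'n) < 1"
    unfolding eventually_at by (intro exI[of _ 1]) (simp add: dist_norm)
  ultimately show "\<forall>\<^sub>F y in at 0. dist (pconv a b y) (pconv a b 0) < \<epsilon>"
  proof eventually_elim
    case (elim y)
    have "\<bar>y $ c\<bar> \<le> 1" for c using component_le_norm_cart[of y c] elim(2) by linarith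
    then have "cmod (pconv a b y - pconv s b y) \<le> 3 * \<epsilon> / 8" by (rule diff)
    moreover have "cmod (pconv a b 0 - pconv s b 0) \<le> 3 * \<epsilon> / 8" by (rule diff) simp
    moreover have "cmod (pconv s b y - pconv s b 0) < \<epsilon> / 8" using elim(1) by (simp add: dist_norm)
    moreover have "pconv a b y - pconv a b 0 = (pconv a b y - pconv s b y) + (pconv s b y - pconv s b 0) - (pconv a b 0 - pconv s b 0)" by simp
    then have "cmod (pconv a b y - pconv a b 0) \<le> cmod (pconv a b y - pconv s b y) + cmod (pconv s b y - pconv s b 0) + cmod (pconv a b 0 - pconv s b 0)"
      by (metis norm_triangle_ineq norm_triangle_ineq4 order_trans add_right_mono)
    ultimately show ?case using \<epsilon> unfolding dist_norm by linarith
  qed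
qed

text \<open>Mollified integration by parts: the cross-correlations of the derivatives of u and v are both
  the mixed second derivative of the cross-correlation of u and v; evaluate them at 0.\<close>
lemma periodic_derivative_swap:
  fixes u v :: "real^'n::finite \<Rightarrow> complex"
  assumes u: "per_L2 u" "\<And>i. per_L2 (g i)" "\<And>i. weak_pt UNIV u i (g i)"
    and v: "per_L2 v" "\<And>i. per_L2 (h i)" "\<And>i. weak_pt UNIV v i (h i)"
  shows "cell_int (\<lambda>x. g i x * h j x) = cell_int (\<lambda>x. g j x * h i x)"
proof -
  \<comment> \<open>The right-hand side depends on i and j only through a mixed second derivative of
    the bump, so exchanging them changes nothing. Supports in the unit cube are required for
    \<open>pconv_swap\<close>.\<close>
  have mixed: "pair_int (pconv (g i) (h j)) \<phi> = - pair_int (pconv v u) (\<lambda>y. pd j (pd i \<phi>) (- y))"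
    if \<phi>: "ptest a b \<phi>" and ab: "cbox a b \<subseteq> ocube 0 1" for i j a b \<phi>
  proof -
    define \<psi> where "\<psi> y = pd i \<phi> (- y)" for y
    have \<psi>: "ptest (- b) (- a) \<psi>" unfolding \<psi>_def by (rule ptest_reflect[OF ptest_pd[OF \<phi>]])
    have d\<psi>: "pd j \<psi> y = - pd j (pd i \<phi>) (- y)" for y
      unfolding \<psi>_def by (rule pd_reflect[OF ptest_pd[OF \<phi>]])
    have "pair_int (pconv (g i) (h j)) \<phi> = - pair_int (pconv u (h j)) (pd i \<phi>)"
      by (rule pconv_weak[OF per_L2_D(3)[OF u(1)] per_L2_D(3)[OF u(2)] u(3) per_L2_D(3)[OF v(2)] \<phi>])
    also have "pair_int (pconv u (h j)) (pd i \<phi>) = pair_int (\<lambda>y. pconv (h j) u (- y)) (pd i \<phi>)"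
    proof (rule Bochner_Integration.integral_cong[OF refl])
      fix y
      show "pconv u (h j) y * of_real (pd i \<phi> y) = pconv (h j) u (- y) * of_real (pd i \<phi> y)"
      proof (cases "y \<in> cbox a b")
        case True
        then have "y \<in> ocube 0 1" using ab by blast
        then have "\<bar>y $ c\<bar> \<le> 1" for c by (auto simp: mem_ocube abs_le_iff less_imp_le minus_le_iff)
        then show ?thesis using pconv_swap[OF u(1) v(2), of y] by simp
      qed (use ptest_zero[OF ptest_pd[OF \<phi>]] in simp)
    qed
    also have "\<dots> = pair_int (pconv (h j) u) \<psi>"
      using integral_reflect[of "\<lambda>y. pconv (h j) u y * of_real (pd i \<phi> (- y))"] by (simp add: \<psi>_def)
    also have "\<dots> = - pair_int (pconv v u) (pd j \<psi>)"
      by (rule pconv_weak[OF per_L2_D(3)[OF v(1)] per_L2_D(3)[OF v(2)] v(3) per_L2_D(3)[OF u(1)] \<psi>])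
    finally show ?thesis by (simp add: d\<psi>)
  qed
  define D where "D y = pconv (g i) (h j) y - pconv (g j) (h i) y" for y
  have int: "integrable lebesgue (\<lambda>y. pconv (g i) (h j) y * of_real (\<phi> y))" if "ptest a b \<phi>" for i j a b \<phi>
    by (rule pconv_Fubini(2)[OF per_L2_D(3)[OF u(2)] per_L2_D(3)[OF v(2)] that])
  have D0: "pair_int D \<phi> = 0" if \<phi>: "ptest a b \<phi>" "cbox a b \<subseteq> ocube 0 1" for a b \<phi>
  proof -
    have "pair_int D \<phi> = pair_int (pconv (g i) (h j)) \<phi> - pair_int (pconv (g j) (h i)) \<phi>"
      unfolding D_def left_diff_distrib by (rule Bochner_Integration.integral_diff[OF int[OF \<phi>(1)] int[OF \<phi>(1)]])
    then show ?thesis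
      unfolding mixed[OF \<phi>] using ptest_pd_commute[OF \<phi>(1), of i j] by simp
  qed
  text \<open>A plateau function turns integrability against bumps into local integrability.\<close>
  define F where "F c t = step (2 * t + 4) * step (4 - 2 * t)" for c :: 'n and t :: real
  have F: "smooth1 (F c)" for c
    unfolding F_def using smooth1_affine[OF smooth1_step, of 4 2] smooth1_affine[OF smooth1_step, of 4 "-2"]
    by (intro smooth1_mult) (simp_all add: add.commute)
  have pF: "ptest (- 2) 2 (tensor F)"
  proof (rule ptestI[OF F])
    fix c t assume "t \<notin> {(- 2 :: real^'n) $ c..2 $ c}"
    then have "2 * t + 4 \<le> 0 \<or> 4 - 2 * t \<le> 0" by auto
    then show "F c t = 0" by (auto simp: F_def step_eq_0)
  qed
  have F1: "tensor F x = 1" if "x \<in> ocube 0 1" for x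
    unfolding tensor_def
  proof (rule prod.neutral, rule ballI)
    fix c
    have "1 \<le> 2 * x $ c + 4" "1 \<le> 4 - 2 * x $ c" using that[unfolded mem_ocube, rule_format, of c] by auto
    then show "F c (x $ c) = 1" by (simp add: F_def step_eq_1)
  qed
  have "AE y in lebesgue. y \<in> ocube 0 1 \<longrightarrow> D y = 0"
    unfolding ocube_def
  proof (rule fundamental_lemma_box)
    have "integrable lebesgue (\<lambda>y. D y * of_real (tensor F y))"
      unfolding D_def left_diff_distrib by (intro Bochner_Integration.integrable_diff int[OF pF])
    then have "integrable lebesgue (\<lambda>y. indicator (ocube 0 1) y *\<^sub>R (D y * of_real (tensor F y)))"
      by (intro integrable_mult_indicator) (simp_all add: ocube_def)
    moreover have "indicator (ocube 0 1) y *\<^sub>R (D y * of_real (tensor F y)) = indicator (ocube 0 1) y *\<^sub>R D y" for y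
      using F1 by (cases "y \<in> ocube 0 1") simp_all
    ultimately show "set_integrable lebesgue (box (0 - 1 *\<^sub>R 1) (0 + 1 *\<^sub>R 1)) D"
      by (simp only: set_integrable_def ocube_def)
  qed (use D0 in \<open>auto simp: ocube_def\<close>)
  \<comment> \<open>The value at the single point 0 is what is wanted, so vanishing almost
    everywhere near 0 has to be combined with continuity there.\<close>
  moreover have "(D \<longlongrightarrow> D 0) (at 0)"
    unfolding D_def by (intro tendsto_diff pconv_continuous_0 u(2) v(2))
  ultimately have "D 0 = 0"
  proof -
    assume AE: "AE y in lebesgue. y \<in> ocube 0 1 \<longrightarrow> D y = 0" and lim: "(D \<longlongrightarrow> D 0) (at 0)"
    show "D 0 = 0"
    proof (rule ccontr)
      assume nz: "D 0 \<noteq> 0"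
      then have "\<forall>\<^sub>F y in at 0. D y \<noteq> 0" by (rule tendsto_imp_eventually_ne[OF lim])
      then obtain S where S: "open S" "0 \<in> S" "\<And>y. y \<in> S \<Longrightarrow> y \<noteq> 0 \<Longrightarrow> D y \<noteq> 0"
        unfolding eventually_at_topological by blast
      define W where "W = S \<inter> ocube 0 1"
      have W: "open W" "W \<noteq> {}" using S by (auto simp: W_def ocube_def mem_box_cart)
      have "AE y in lebesgue. y \<notin> W"
        using AE by eventually_elim (use S(2,3) nz in \<open>auto simp: W_def\<close>)
      then have "W \<in> null_sets lebesgue"
        using W(1) by (subst (asm) AE_iff_null_sets[symmetric]) (auto intro: sets_completionI_sets)
      then show False using open_not_negligible[OF W] by (auto simp: negligible_iff_null_sets)
    qed
  qed
  then show ?thesis by (simp add: D_def pconv_def)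
qed

section \<open>Sobolev functions and the energy form\<close>

lemma test_fun_D:
  assumes "test_fun U \<phi>"
  shows "x \<notin> tsupport \<phi> \<Longrightarrow> \<phi> x = 0" "x \<notin> tsupport \<phi> \<Longrightarrow> pd i \<phi> x = 0"
    "continuous_on UNIV \<phi>" "continuous_on UNIV (pd i \<phi>)"
    "compact (tsupport \<phi>)" "tsupport \<phi> \<subseteq> U"
proof -
  have sm: "smooth \<phi>" and c: "compact (tsupport \<phi>)" and s: "tsupport \<phi> \<subseteq> U"
    using assms by (auto simp: test_fun_def)
  show 0: "\<phi> x = 0" if "x \<notin> tsupport \<phi>" for x
    using that closure_subset[of "{x. \<phi> x \<noteq> 0}"] by (auto simp: tsupport_def)
  show "pd i \<phi> x = 0" if x: "x \<notin> tsupport \<phi>"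
  proof -
    have "open (- tsupport \<phi>)" using c by (simp add: compact_imp_closed open_Compl)
    then have "(\<phi> has_derivative (\<lambda>h. 0)) (at x)"
      by (rule has_derivative_transform_within_open[OF has_derivative_const[of 0]]) (use x 0 in auto)
    then show ?thesis unfolding pd_def by (simp add: frechet_derivative_at[symmetric])
  qed
  have "Ck_on 1 UNIV \<phi>" using sm by (simp add: smooth_def)
  then have *: "continuous_on UNIV (pds is \<phi>)" if "length is \<le> 1" for "is"
    using that unfolding Ck_on_def by blast
  show "continuous_on UNIV \<phi>" using *[of "[]"] by simp
  show "continuous_on UNIV (pd i \<phi>)" using *[of "[i]"] by simp
qed (use assms in \<open>auto simp: test_fun_def\<close>)

lemma test_fun_mono: "test_fun V \<phi> \<Longrightarrow> V \<subseteq> U \<Longrightarrow> test_fun U \<phi>"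
  by (auto simp: test_fun_def)

lemma integral_on: "U \<in> sets lebesgue \<Longrightarrow> integral\<^sup>L (lebesgue_on U) F = integral\<^sup>L lebesgue (\<lambda>x. indicator U x *\<^sub>R F x)"
  for F :: "real^'n::finite \<Rightarrow> 'b::{banach, second_countable_topology}"
  by (simp add: integral_restrict_space)

lemma integrable_on: "U \<in> sets lebesgue \<Longrightarrow> integrable (lebesgue_on U) F \<longleftrightarrow> integrable lebesgue (\<lambda>x. indicator U x *\<^sub>R F x)"
  for F :: "real^'n::finite \<Rightarrow> 'b::{banach, second_countable_topology}"
  by (simp add: integrable_restrict_space)

lemma AE_on: "U \<in> sets lebesgue \<Longrightarrow> (AE x in lebesgue_on U. P x) \<longleftrightarrow> (AE x in lebesgue. x \<in> U \<longrightarrow> P x)"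
  by (simp add: AE_restrict_space_iff)

lemma open_leb [simp]: "open U \<Longrightarrow> U \<in> sets lebesgue"
  by (intro sets_completionI_sets) simp

lemma integral_on_eq:
  fixes F :: "real^'n::finite \<Rightarrow> complex"
  assumes "U \<in> sets lebesgue" "V \<in> sets lebesgue" "\<And>x. x \<in> U \<Longrightarrow> x \<notin> V \<Longrightarrow> F x = 0" "\<And>x. x \<in> V \<Longrightarrow> x \<notin> U \<Longrightarrow> F x = 0"
  shows "integral\<^sup>L (lebesgue_on U) F = integral\<^sup>L (lebesgue_on V) F"
proof -
  have "(\<lambda>x. indicator U x *\<^sub>R F x) = (\<lambda>x. indicator V x *\<^sub>R F x)"
    using assms(3,4) by (auto simp: indicator_def fun_eq_iff)
  then show ?thesis unfolding integral_on[OF assms(1)] integral_on[OF assms(2)] by simp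
qed

section \<open>Square-integrable functions on a subdomain\<close>

lemma L2_measurable: "L2 U f \<Longrightarrow> f \<in> borel_measurable (lebesgue_on U)"
  and L2_sq: "L2 U f \<Longrightarrow> integrable (lebesgue_on U) (\<lambda>x. (cmod (f x))\<^sup>2)"
  by (auto simp: L2_def)

lemma L2_prod_integrable: "L2 U f \<Longrightarrow> L2 U g \<Longrightarrow> integrable (lebesgue_on U) (\<lambda>x. f x * g x)"
  by (intro sq_prod_integrable L2_measurable L2_sq)

lemma L2_add:
  assumes "L2 U f" "L2 U g"
  shows "L2 U (\<lambda>x. f x + g x)"
  unfolding L2_def
proof
  have m: "f \<in> borel_measurable (lebesgue_on U)" "g \<in> borel_measurable (lebesgue_on U)"
    using assms by (auto simp: L2_def)
  then show "(\<lambda>x. f x + g x) \<in> borel_measurable (lebesgue_on U)" by (intro borel_measurable_add)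
  have "integrable (lebesgue_on U) (\<lambda>x. 2 * (cmod (f x))\<^sup>2 + 2 * (cmod (g x))\<^sup>2)"
    using assms by (auto simp: L2_def)
  then show "integrable (lebesgue_on U) (\<lambda>x. (cmod (f x + g x))\<^sup>2)"
  proof (rule Bochner_Integration.integrable_bound)
    show "AE x in lebesgue_on U. norm ((cmod (f x + g x))\<^sup>2) \<le> norm (2 * (cmod (f x))\<^sup>2 + 2 * (cmod (g x))\<^sup>2)"
    proof (rule AE_I2)
      fix x
      have "(cmod (f x + g x))\<^sup>2 \<le> (cmod (f x) + cmod (g x))\<^sup>2"
        by (intro power_mono norm_triangle_ineq) simp
      also have "\<dots> \<le> 2 * (cmod (f x))\<^sup>2 + 2 * (cmod (g x))\<^sup>2"
        using zero_le_power2[of "cmod (f x) - cmod (g x)"] by (simp add: power2_sum power2_diff)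
      finally show "norm ((cmod (f x + g x))\<^sup>2) \<le> norm (2 * (cmod (f x))\<^sup>2 + 2 * (cmod (g x))\<^sup>2)" by simp
    qed
  qed (use m in \<open>intro borel_measurable_power borel_measurable_add measurable_compose[OF _ borel_measurable_norm]; simp\<close>)
qed

lemma L2_scale: "L2 U f \<Longrightarrow> L2 U (\<lambda>x. a * f x)"
  unfolding L2_def by (auto simp: norm_mult power_mult_distrib intro!: borel_measurable_times)

lemma L2_cnj: "L2 U f \<Longrightarrow> L2 U (\<lambda>x. cnj (f x))"
  unfolding L2_def by (auto intro: measurable_compose[OF _ borel_measurable_continuous_onI] continuous_intros)

lemma L2_lin: "L2 U f \<Longrightarrow> L2 U g \<Longrightarrow> L2 U (\<lambda>x. a * f x + b * g x)"
  by (intro L2_add L2_scale)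

lemma L2_zero: "L2 U (\<lambda>x. 0)" by (simp add: L2_def)

lemma L2_mono:
  assumes "L2 U f" "U \<in> sets lebesgue" "V \<in> sets lebesgue" "V \<subseteq> U"
  shows "L2 V f"
proof -
  have *: "(\<lambda>x. indicator V x *\<^sub>R F x) = (\<lambda>x. indicator V x *\<^sub>R (indicator U x *\<^sub>R F x))" for F :: "_ \<Rightarrow> 'c::real_normed_vector"
    using assms(4) by (auto simp: indicator_def fun_eq_iff)
  have f: "(\<lambda>x. indicator U x *\<^sub>R f x) \<in> borel_measurable lebesgue"
    "integrable lebesgue (\<lambda>x. indicator U x *\<^sub>R (cmod (f x))\<^sup>2)"
    using assms(1) unfolding L2_iff[OF assms(2)] by auto
  show ?thesis
    unfolding L2_iff[OF assms(3)]
  proof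
    show "(\<lambda>x. indicator V x *\<^sub>R f x) \<in> borel_measurable lebesgue"
      by (subst *) (rule borel_measurable_scaleR[OF borel_measurable_indicator[OF assms(3)] f(1)])
    show "integrable lebesgue (\<lambda>x. indicator V x *\<^sub>R (cmod (f x))\<^sup>2)"
      by (subst *) (rule integrable_mult_indicator[OF assms(3) f(2)])
  qed
qed

lemma L2_cong_AE:
  assumes U: "U \<in> sets lebesgue" and f: "L2 U f" and eq: "AE x in lebesgue. x \<in> U \<longrightarrow> f x = g x"
  shows "L2 U g"
proof -
  have e1: "AE x in lebesgue. indicator U x *\<^sub>R f x = indicator U x *\<^sub>R g x"
    using eq by eventually_elim (auto simp: indicator_def)
  have m: "(\<lambda>x. indicator U x *\<^sub>R g x) \<in> borel_measurable lebesgue"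
    using f e1 unfolding L2_iff[OF U] by (blast intro: borel_measurable_AE)
  have e2: "AE x in lebesgue. indicator U x *\<^sub>R (cmod (f x))\<^sup>2 = indicator U x *\<^sub>R (cmod (g x))\<^sup>2"
    using eq by eventually_elim (auto simp: indicator_def)
  have "(\<lambda>x. indicator U x *\<^sub>R (cmod (g x))\<^sup>2) = (\<lambda>x. (cmod (indicator U x *\<^sub>R g x))\<^sup>2)"
    by (auto simp: indicator_def fun_eq_iff)
  then have "(\<lambda>x. indicator U x *\<^sub>R (cmod (g x))\<^sup>2) \<in> borel_measurable lebesgue"
    using borel_measurable_power[OF measurable_compose[OF m borel_measurable_norm], of 2] by (simp only:)
  then have "integrable lebesgue (\<lambda>x. indicator U x *\<^sub>R (cmod (g x))\<^sup>2)"
    using f e2 unfolding L2_iff[OF U] by (blast intro: integrable_cong_AE_imp)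
  with m show ?thesis unfolding L2_iff[OF U] by blast
qed

lemma L2_set_integrable:
  assumes f: "L2 U f" and U: "U \<in> sets lebesgue" and K: "K \<in> sets lebesgue" "bounded K" "K \<subseteq> U"
  shows "set_integrable lebesgue K f"
proof -
  have "L2 K f" by (rule L2_mono[OF f U K(1,3)])
  then show ?thesis
    using K unfolding L2_iff[OF K(1)] by (intro set_integrable_of_sq) (auto simp: set_integrable_def)
qed

lemma L2_loc_int: "L2 U f \<Longrightarrow> U \<in> sets lebesgue \<Longrightarrow> loc_int U f"
  unfolding loc_int_def by (auto intro: L2_set_integrable)

lemma test_integrable_gen:
  fixes f :: "real^'n::finite \<Rightarrow> complex"
  assumes K: "set_integrable lebesgue K f" "compact K" "K \<subseteq> U" and U: "U \<in> sets lebesgue"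
    and \<psi>: "continuous_on UNIV \<psi>" "\<And>x. x \<notin> K \<Longrightarrow> \<psi> x = 0"
  shows "integrable (lebesgue_on U) (\<lambda>x. f x * of_real (\<psi> x) :: complex)"
proof -
  have "compact (\<psi> ` K)" using K by (intro compact_continuous_image continuous_on_subset[OF \<psi>(1)]) auto
  then obtain B where B: "\<forall>y\<in>\<psi> ` K. norm y \<le> B" using compact_imp_bounded bounded_iff by blast
  have "norm (complex_of_real (\<psi> x)) \<le> max B 0" for x
  proof (cases "x \<in> K")
    case True then show ?thesis using B by (auto simp: le_max_iff_disj)
  qed (use \<psi>(2) in simp)
  moreover have "(\<lambda>x. complex_of_real (\<psi> x)) \<in> borel_measurable lebesgue"
    using borel_measurable_continuous_onI[OF \<psi>(1)] by (intro measurable_completion) simp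
  ultimately have "integrable lebesgue (\<lambda>x. (indicator K x *\<^sub>R f x) * complex_of_real (\<psi> x))"
    using K(1) unfolding set_integrable_def by (intro integrable_bounded_mult)
  moreover have "(indicator K x *\<^sub>R f x) * complex_of_real (\<psi> x) = indicator U x *\<^sub>R (f x * of_real (\<psi> x))" for x
    using \<psi>(2)[of x] K(3) by (auto simp: indicator_def)
  ultimately show ?thesis unfolding integrable_on[OF U] by (simp only:)
qed

lemma test_integrable:
  assumes f: "L2 U f" and U: "U \<in> sets lebesgue" and \<phi>: "test_fun U \<phi>"
  shows "integrable (lebesgue_on U) (\<lambda>x. f x * of_real (\<phi> x))" "integrable (lebesgue_on U) (\<lambda>x. f x * of_real (pd i \<phi> x))"
proof -
  note T = test_fun_D[OF \<phi>]
  have "set_integrable lebesgue (tsupport \<phi>) f"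
    using T(5,6) by (intro L2_set_integrable[OF f U]) (auto simp: compact_imp_bounded compact_imp_closed intro!: sets_completionI_sets)
  then show "integrable (lebesgue_on U) (\<lambda>x. f x * of_real (\<phi> x))" "integrable (lebesgue_on U) (\<lambda>x. f x * of_real (pd i \<phi> x))"
    using T by (auto intro: test_integrable_gen[OF _ T(5,6) U])
qed

section \<open>Weak derivatives and their chosen representative\<close>

lemma weak_pd_pt:
  assumes "U \<in> sets lebesgue" "weak_pd U f i g"
  shows "weak_pt U f i g"
  unfolding weak_pt_def
proof (intro allI impI)
  fix a b \<phi> assume \<phi>: "ptest a b \<phi>" and ab: "cbox a b \<subseteq> U"
  have *: "integral\<^sup>L (lebesgue_on U) (\<lambda>x. h x * of_real (\<psi> x)) = pair_int h \<psi>" if "ptest a b \<psi>" for h \<psi>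
  proof -
    have "(\<lambda>x. indicator U x *\<^sub>R (h x * of_real (\<psi> x))) = (\<lambda>x. h x * of_real (\<psi> x))"
      using ptest_zero[OF that] ab by (auto simp: indicator_def fun_eq_iff)
    then show ?thesis unfolding integral_on[OF assms(1)] by simp
  qed
  show "pair_int f (pd i \<phi>) = - pair_int g \<phi>"
    using assms(2)[unfolded weak_pd_def, rule_format, OF ptest_test_fun[OF \<phi> ab]]
    unfolding *[OF \<phi>] *[OF ptest_pd[OF \<phi>]] .
qed

lemma weak_pd_mono:
  assumes "weak_pd U f i g" "U \<in> sets lebesgue" "V \<in> sets lebesgue" "V \<subseteq> U"
  shows "weak_pd V f i g"
  unfolding weak_pd_def
proof (intro allI impI)
  fix \<phi> assume \<phi>: "test_fun V \<phi>"
  note T = test_fun_D[OF \<phi>]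
  have *: "integral\<^sup>L (lebesgue_on V) (\<lambda>x. h x * complex_of_real (\<psi> x)) = integral\<^sup>L (lebesgue_on U) (\<lambda>x. h x * of_real (\<psi> x))"
    if "\<And>x. x \<notin> tsupport \<phi> \<Longrightarrow> \<psi> x = 0" for h \<psi>
    using that T(6) assms(4) by (intro integral_on_eq assms(2,3)) auto
  show "integral\<^sup>L (lebesgue_on V) (\<lambda>x. f x * of_real (pd i \<phi> x)) = - integral\<^sup>L (lebesgue_on V) (\<lambda>x. g x * of_real (\<phi> x))"
    using assms(1)[unfolded weak_pd_def, rule_format, OF test_fun_mono[OF \<phi> assms(4)]]
      *[where \<psi> = \<phi> and h = g] *[where \<psi> = "pd i \<phi>" and h = f] T(1,2) by simp
qed

lemma weak_pd_unique:
  assumes U: "open U" and g: "loc_int U g" "weak_pd U f i g" and h: "loc_int U h" "weak_pd U f i h"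
  shows "AE x in lebesgue. x \<in> U \<longrightarrow> g x = h x"
proof -
  have "AE x in lebesgue. x \<in> U \<longrightarrow> g x - h x = 0"
  proof (rule fundamental_lemma[OF U])
    show "loc_int U (\<lambda>x. g x - h x)" using g(1) h(1) by (auto simp: loc_int_def)
    fix a b \<phi> assume \<phi>: "ptest a b \<phi>" and ab: "cbox a b \<subseteq> U"
    have "pair_int g \<phi> = pair_int h \<phi>"
      using weak_pd_pt[OF open_leb[OF U] g(2)] weak_pd_pt[OF open_leb[OF U] h(2)] \<phi> ab
      unfolding weak_pt_def by (auto dest!: spec[of _ a] spec[of _ b] spec[of _ \<phi>])
    then show "pair_int (\<lambda>x. g x - h x) \<phi> = 0"
      unfolding left_diff_distrib using ptest_integrable[OF \<phi> ab g(1)] ptest_integrable[OF \<phi> ab h(1)] by simp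
  qed
  then show ?thesis by eventually_elim simp
qed

text \<open>Integrability against test functions is a premise so that the rule serves both L2
  functions on a subdomain and periodic functions on the unbounded matrix, which are
  square-integrable only locally.\<close>

lemma weak_pd_lin:
  assumes U: "U \<in> sets lebesgue"
    and int: "\<And>\<phi>. test_fun U \<phi> \<Longrightarrow> integrable (lebesgue_on U) (\<lambda>x. f x * of_real (pd i \<phi> x)) \<and> integrable (lebesgue_on U) (\<lambda>x. f' x * of_real (pd i \<phi> x))
        \<and> integrable (lebesgue_on U) (\<lambda>x. g x * of_real (\<phi> x)) \<and> integrable (lebesgue_on U) (\<lambda>x. g' x * of_real (\<phi> x))"
    and w: "weak_pd U f i g" "weak_pd U f' i g'"
  shows "weak_pd U (\<lambda>x. a * f x + b * f' x) i (\<lambda>x. a * g x + b * g' x)"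
  unfolding weak_pd_def
proof (intro allI impI)
  fix \<phi> assume \<phi>: "test_fun U \<phi>"
  note i = int[OF \<phi>]
  have "integral\<^sup>L (lebesgue_on U) (\<lambda>x. (a * f x + b * f' x) * of_real (pd i \<phi> x))
      = a * integral\<^sup>L (lebesgue_on U) (\<lambda>x. f x * of_real (pd i \<phi> x)) + b * integral\<^sup>L (lebesgue_on U) (\<lambda>x. f' x * of_real (pd i \<phi> x))"
    using i by (simp add: distrib_right mult.assoc)
  moreover have "integral\<^sup>L (lebesgue_on U) (\<lambda>x. (a * g x + b * g' x) * of_real (\<phi> x))
      = a * integral\<^sup>L (lebesgue_on U) (\<lambda>x. g x * of_real (\<phi> x)) + b * integral\<^sup>L (lebesgue_on U) (\<lambda>x. g' x * of_real (\<phi> x))"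
    using i by (simp add: distrib_right mult.assoc)
  ultimately show "integral\<^sup>L (lebesgue_on U) (\<lambda>x. (a * f x + b * f' x) * of_real (pd i \<phi> x))
      = - integral\<^sup>L (lebesgue_on U) (\<lambda>x. (a * g x + b * g' x) * of_real (\<phi> x))"
    using w \<phi> unfolding weak_pd_def by (simp add: algebra_simps)
qed

lemma Dw_H1:
  assumes "H1 U f"
  shows "L2 U (Dw U f i)" "weak_pd U f i (Dw U f i)"
proof -
  have "\<exists>g. L2 U g \<and> weak_pd U f i g" using assms by (auto simp: H1_def)
  from someI_ex[OF this] show "L2 U (Dw U f i)" "weak_pd U f i (Dw U f i)" unfolding Dw_def by auto
qed

text \<open>\<open>Dw\<close> is some weak derivative picked by choice; by uniqueness any concrete
  L2 weak derivative determines it up to a null set. This is how derivatives on different domains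
  are compared.\<close>

lemma Dw_eq:
  assumes U: "open U" and g: "L2 U g" "weak_pd U f i g"
  shows "AE x in lebesgue. x \<in> U \<longrightarrow> Dw U f i x = g x"
proof -
  have "\<exists>g. L2 U g \<and> weak_pd U f i g" using g by blast
  from someI_ex[OF this] have "L2 U (Dw U f i)" "weak_pd U f i (Dw U f i)" unfolding Dw_def by auto
  then show ?thesis using g U by (intro weak_pd_unique[OF U]) (auto intro: L2_loc_int)
qed

text \<open>The equality of \<open>Dw\<close> holds literally: changing f on a null set changes none
  of the defining integrals, so the choice is made from the same predicate.\<close>

lemma Dw_cong:
  assumes U: "U \<in> sets lebesgue" and eq: "AE x in lebesgue. x \<in> U \<longrightarrow> f x = f' x"
    and m: "L2 U f"
  shows "Dw U f i = Dw U f' i" "weak_pd U f i g \<longleftrightarrow> weak_pd U f' i g"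
proof -
  have "L2 U f'" by (rule L2_cong_AE[OF U m eq])
  have "integral\<^sup>L (lebesgue_on U) (\<lambda>x. f x * of_real (pd i \<phi> x)) = integral\<^sup>L (lebesgue_on U) (\<lambda>x. f' x * of_real (pd i \<phi> x))"
    if \<phi>: "test_fun U \<phi>" for \<phi>
  proof (rule integral_cong_AE)
    show "AE x in lebesgue_on U. f x * of_real (pd i \<phi> x) = f' x * of_real (pd i \<phi> x)"
      unfolding AE_on[OF U] using eq by eventually_elim simp
  qed (use test_integrable(2)[OF m U \<phi>] test_integrable(2)[OF \<open>L2 U f'\<close> U \<phi>] in auto)
  then have "weak_pd U f i g \<longleftrightarrow> weak_pd U f' i g" for g unfolding weak_pd_def by auto
  then show "Dw U f i = Dw U f' i" "weak_pd U f i g \<longleftrightarrow> weak_pd U f' i g" unfolding Dw_def by auto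
qed

lemma H1_L2: "H1 U f \<Longrightarrow> L2 U f" by (simp add: H1_def)

lemma H1_mono:
  assumes "H1 U f" "U \<in> sets lebesgue" "V \<in> sets lebesgue" "V \<subseteq> U"
  shows "H1 V f"
  using assms unfolding H1_def by (blast intro: L2_mono weak_pd_mono)

lemma Dw_mono:
  assumes "H1 U f" "U \<in> sets lebesgue" "open V" "V \<subseteq> U"
  shows "AE x in lebesgue. x \<in> V \<longrightarrow> Dw V f i x = Dw U f i x"
  by (rule Dw_eq[OF assms(3) L2_mono[OF Dw_H1(1)[OF assms(1)] assms(2) open_leb[OF assms(3)] assms(4)]
        weak_pd_mono[OF Dw_H1(2)[OF assms(1)] assms(2) open_leb[OF assms(3)] assms(4)]])

lemma H1_lin:
  assumes U: "U \<in> sets lebesgue" and f: "H1 U f" and g: "H1 U g"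
  shows "H1 U (\<lambda>x. a * f x + b * g x)"
    and "weak_pd U (\<lambda>x. a * f x + b * g x) i (\<lambda>x. a * Dw U f i x + b * Dw U g i x)"
proof -
  show *: "weak_pd U (\<lambda>x. a * f x + b * g x) i (\<lambda>x. a * Dw U f i x + b * Dw U g i x)" for i
    using Dw_H1[OF f, of i] Dw_H1[OF g, of i] H1_L2[OF f] H1_L2[OF g]
    by (intro weak_pd_lin[OF U]) (auto intro!: test_integrable[OF _ U])
  show "H1 U (\<lambda>x. a * f x + b * g x)"
    unfolding H1_def
  proof (intro conjI allI exI)
    show "L2 U (\<lambda>x. a * f x + b * g x)" by (rule L2_lin[OF H1_L2[OF f] H1_L2[OF g]])
    show "L2 U (\<lambda>x. a * Dw U f i x + b * Dw U g i x)" for i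
      by (rule L2_lin[OF Dw_H1(1)[OF f] Dw_H1(1)[OF g]])
  qed (rule *)
qed

lemma Dw_lin:
  assumes U: "open U" and f: "H1 U f" and g: "H1 U g"
  shows "AE x in lebesgue. x \<in> U \<longrightarrow> Dw U (\<lambda>x. a * f x + b * g x) i x = a * Dw U f i x + b * Dw U g i x"
  by (rule Dw_eq[OF U L2_lin[OF Dw_H1(1)[OF f] Dw_H1(1)[OF g]] H1_lin(2)[OF open_leb[OF U] f g]])

section \<open>Vector fields and the energy form\<close>

definition H1v :: "(real^'n::finite) set \<Rightarrow> 'n field \<Rightarrow> bool" where
  "H1v U v \<longleftrightarrow> (\<forall>c. H1 U (comp v c))"

abbreviation lincomb :: "complex \<Rightarrow> 'n::finite field \<Rightarrow> complex \<Rightarrow> 'n field \<Rightarrow> 'n field" where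
  "lincomb a u b v \<equiv> (\<lambda>x. a *s u x + b *s v x)"

lemma comp_lincomb: "comp (lincomb a u b v) c = (\<lambda>x. a * comp u c x + b * comp v c x)"
  by (simp add: comp_def fun_eq_iff)

lemma H1v_lin: "open U \<Longrightarrow> H1v U u \<Longrightarrow> H1v U v \<Longrightarrow> H1v U (lincomb a u b v)"
  unfolding H1v_def comp_lincomb using H1_lin(1)[OF open_leb] by blast

lemma H1v_mono: "H1v U v \<Longrightarrow> open U \<Longrightarrow> open V \<Longrightarrow> V \<subseteq> U \<Longrightarrow> H1v V v"
  unfolding H1v_def by (auto intro: H1_mono)

lemma sym_grad_L2: "H1v U v \<Longrightarrow> L2 U (sym_grad U v c d)"
proof -
  assume "H1v U v"
  then have "L2 U (\<lambda>x. (1/2) * Dw U (comp v c) d x + (1/2) * Dw U (comp v d) c x)"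
    by (intro L2_lin) (auto simp: H1v_def intro: Dw_H1)
  then show ?thesis by (simp add: sym_grad_def[abs_def] add_divide_distrib)
qed

lemma sym_grad_lin:
  assumes "open U" "H1v U u" "H1v U v"
  shows "AE x in lebesgue. x \<in> U \<longrightarrow> sym_grad U (lincomb a u b v) c d x = a * sym_grad U u c d x + b * sym_grad U v c d x"
proof -
  have *: "AE x in lebesgue. x \<in> U \<longrightarrow> Dw U (comp (lincomb a u b v) c) d x = a * Dw U (comp u c) d x + b * Dw U (comp v c) d x" for c d
    unfolding comp_lincomb using assms by (intro Dw_lin) (auto simp: H1v_def)
  show ?thesis using *[of c d] *[of d c] by eventually_elim (simp add: sym_grad_def field_simps)
qed

lemma sym_grad_cong:
  assumes "open U" "H1v U u" "AE x in lebesgue. x \<in> U \<longrightarrow> u x = v x"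
  shows "sym_grad U u = sym_grad U v"
proof -
  have "Dw U (comp u c) d = Dw U (comp v c) d" for c d
  proof (rule Dw_cong(1))
    show "AE x in lebesgue. x \<in> U \<longrightarrow> comp u c x = comp v c x"
      using assms(3) by eventually_elim (simp add: comp_def)
  qed (use assms in \<open>auto simp: H1v_def H1_L2\<close>)
  then show ?thesis unfolding sym_grad_def[abs_def] by simp
qed

lemma aform_cong:
  assumes "open U" "H1v U u" "AE x in lebesgue. x \<in> U \<longrightarrow> u x = v x"
  shows "aform \<mu> U u w = aform \<mu> U v w" "aform \<mu> U w u = aform \<mu> U w v"
  unfolding aform_def sym_grad_cong[OF assms] by simp_all

lemma aform_sum:
  assumes "H1v U u" "H1v U v"
  shows "aform \<mu> U u v = (\<Sum>c\<in>UNIV. \<Sum>d\<in>UNIV. of_real (2 * \<mu>) * integral\<^sup>L (lebesgue_on U) (\<lambda>x. sym_grad U u c d x * cnj (sym_grad U v c d x)))"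
proof -
  have i: "integrable (lebesgue_on U) (\<lambda>x. sym_grad U u c d x * cnj (sym_grad U v c d x))" for c d
    using assms by (intro L2_prod_integrable L2_cnj sym_grad_L2)
  show ?thesis
    unfolding aform_def using i by (simp add: sum_distrib_left)
qed

lemma aform_herm:
  assumes "H1v U u" "H1v U v"
  shows "aform \<mu> U v u = cnj (aform \<mu> U u v)"
proof -
  have "integral\<^sup>L (lebesgue_on U) (\<lambda>x. sym_grad U v c d x * cnj (sym_grad U u c d x))
      = cnj (integral\<^sup>L (lebesgue_on U) (\<lambda>x. sym_grad U u c d x * cnj (sym_grad U v c d x)))" for c d
    by (simp add: Bochner_Integration.integral_cnj[symmetric] mult.commute del: Bochner_Integration.integral_cnj)
  then show ?thesis unfolding aform_sum[OF assms] aform_sum[OF assms(2,1)] by (simp add: cnj_sum)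
qed

lemma aform_lin_left:
  assumes U: "open U" and u: "H1v U u" and v: "H1v U v" and w: "H1v U w"
  shows "aform \<mu> U (lincomb a u b v) w = a * aform \<mu> U u w + b * aform \<mu> U v w"
proof -
  have i: "integrable (lebesgue_on U) (\<lambda>x. sym_grad U z c d x * cnj (sym_grad U w c d x))" if "H1v U z" for z c d
    using that w by (intro L2_prod_integrable L2_cnj sym_grad_L2)
  have l: "H1v U (lincomb a u b v)" by (rule H1v_lin[OF U u v])
  have "integral\<^sup>L (lebesgue_on U) (\<lambda>x. sym_grad U (lincomb a u b v) c d x * cnj (sym_grad U w c d x))
      = a * integral\<^sup>L (lebesgue_on U) (\<lambda>x. sym_grad U u c d x * cnj (sym_grad U w c d x))
      + b * integral\<^sup>L (lebesgue_on U) (\<lambda>x. sym_grad U v c d x * cnj (sym_grad U w c d x))" for c d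
  proof -
    have "integral\<^sup>L (lebesgue_on U) (\<lambda>x. sym_grad U (lincomb a u b v) c d x * cnj (sym_grad U w c d x))
      = integral\<^sup>L (lebesgue_on U) (\<lambda>x. a * (sym_grad U u c d x * cnj (sym_grad U w c d x)) + b * (sym_grad U v c d x * cnj (sym_grad U w c d x)))"
    proof (rule integral_cong_AE)
      show "AE x in lebesgue_on U. sym_grad U (lincomb a u b v) c d x * cnj (sym_grad U w c d x)
          = a * (sym_grad U u c d x * cnj (sym_grad U w c d x)) + b * (sym_grad U v c d x * cnj (sym_grad U w c d x))"
        unfolding AE_on[OF open_leb[OF U]] using sym_grad_lin[OF U u v, of a b c d]
        by eventually_elim (auto simp: algebra_simps)
    qed (use i[OF l] i[OF u] i[OF v] in auto)
    then show ?thesis using i[OF u] i[OF v] by simp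
  qed
  then show ?thesis
    unfolding aform_sum[OF l w] aform_sum[OF u w] aform_sum[OF v w]
    by (simp add: sum_distrib_left sum.distrib[symmetric] algebra_simps)
qed

lemma aform_lin_right:
  assumes U: "open U" and u: "H1v U u" and v: "H1v U v" and w: "H1v U w"
  shows "aform \<mu> U w (lincomb a u b v) = cnj a * aform \<mu> U w u + cnj b * aform \<mu> U w v"
proof -
  have "aform \<mu> U w (lincomb a u b v) = cnj (aform \<mu> U (lincomb a u b v) w)"
    by (rule aform_herm[OF H1v_lin[OF U u v] w])
  also have "\<dots> = cnj a * cnj (aform \<mu> U u w) + cnj b * cnj (aform \<mu> U v w)"
    by (simp add: aform_lin_left[OF U u v w])
  also have "\<dots> = cnj a * aform \<mu> U w u + cnj b * aform \<mu> U w v"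
    using aform_herm[OF u w] aform_herm[OF v w] by simp
  finally show ?thesis .
qed

lemma aform_diag:
  assumes u: "H1v U u" and \<mu>: "\<mu> > 0"
  shows "aform \<mu> U u u = of_real (\<Sum>c\<in>UNIV. \<Sum>d\<in>UNIV. 2 * \<mu> * integral\<^sup>L (lebesgue_on U) (\<lambda>x. (cmod (sym_grad U u c d x))\<^sup>2))"
    and "(enorm \<mu> U u)\<^sup>2 = (\<Sum>c\<in>UNIV. \<Sum>d\<in>UNIV. 2 * \<mu> * integral\<^sup>L (lebesgue_on U) (\<lambda>x. (cmod (sym_grad U u c d x))\<^sup>2))"
    and "aform \<mu> U u u = of_real ((enorm \<mu> U u)\<^sup>2)"
    and "enorm \<mu> U u \<ge> 0"
proof -
  let ?S = "\<Sum>c\<in>UNIV. \<Sum>d\<in>UNIV. 2 * \<mu> * integral\<^sup>L (lebesgue_on U) (\<lambda>x. (cmod (sym_grad U u c d x))\<^sup>2)"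
  have "integral\<^sup>L (lebesgue_on U) (\<lambda>x. sym_grad U u c d x * cnj (sym_grad U u c d x))
      = of_real (integral\<^sup>L (lebesgue_on U) (\<lambda>x. (cmod (sym_grad U u c d x))\<^sup>2))" for c d
    by (subst integral_complex_of_real[symmetric]) (simp only: complex_norm_square)
  then show 1: "aform \<mu> U u u = of_real ?S"
    unfolding aform_sum[OF u u] by simp
  have 0: "?S \<ge> 0" using \<mu> by (intro sum_nonneg mult_nonneg_nonneg Bochner_Integration.integral_nonneg) auto
  then show 2: "(enorm \<mu> U u)\<^sup>2 = ?S" unfolding enorm_def 1 Re_complex_of_real by (rule real_sqrt_pow2)
  show "aform \<mu> U u u = of_real ((enorm \<mu> U u)\<^sup>2)" unfolding 1 2 ..
  show "enorm \<mu> U u \<ge> 0" unfolding enorm_def 1 Re_complex_of_real by (rule real_sqrt_ge_zero[OF 0])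
qed

text \<open>The best weight is r = B/A. As A or B may vanish, both are first increased by a small
  \<delta>.\<close>

lemma amgm_le:
  fixes A B X :: real
  assumes "A \<ge> 0" "B \<ge> 0" "\<And>r. r > 0 \<Longrightarrow> X \<le> (r / 2) * A\<^sup>2 + (1 / (2 * r)) * B\<^sup>2"
  shows "X \<le> A * B"
proof (rule field_le_epsilon)
  fix \<epsilon> :: real assume \<epsilon>: "\<epsilon> > 0"
  define \<delta> where "\<delta> = min 1 (\<epsilon> / (A + B + 1))"
  have AB: "A + B + 1 > 0" using assms(1,2) by simp
  then have "\<delta> \<le> \<epsilon> / (A + B + 1)" "\<delta> > 0" "\<delta> \<le> 1" using \<epsilon> by (simp_all add: \<delta>_def)
  then have \<delta>: "\<delta> > 0" "\<delta> \<le> 1" "\<delta> * (A + B + 1) \<le> \<epsilon>"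
    using AB by (simp_all add: pos_le_divide_eq)
  have pos: "A + \<delta> > 0" "B + \<delta> > 0" using \<delta> assms by auto
  have "X \<le> (((B + \<delta>) / (A + \<delta>)) / 2) * A\<^sup>2 + (1 / (2 * ((B + \<delta>) / (A + \<delta>)))) * B\<^sup>2"
    using pos by (intro assms(3)) simp
  also have "\<dots> \<le> (((B + \<delta>) / (A + \<delta>)) / 2) * (A + \<delta>)\<^sup>2 + (1 / (2 * ((B + \<delta>) / (A + \<delta>)))) * (B + \<delta>)\<^sup>2"
    using pos \<delta> assms(1,2) by (intro add_mono mult_left_mono power_mono) (auto simp: less_imp_le)
  also have "\<dots> = (A + \<delta>) * (B + \<delta>)"
  proof -
    have "((Q / P) / 2) * P\<^sup>2 + (1 / (2 * (Q / P))) * Q\<^sup>2 = P * Q" if "P > 0" "Q > 0" for P Q :: real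
      using that by (simp add: field_simps power2_eq_square)
    from this[OF pos] show ?thesis .
  qed
  also have "\<dots> = A * B + \<delta> * (A + B + \<delta>)" by (simp add: algebra_simps)
  also have "\<dots> \<le> A * B + \<delta> * (A + B + 1)" using \<delta> by (intro add_left_mono mult_left_mono) auto
  finally show "X \<le> A * B + \<epsilon>" using \<delta>(3) by linarith
qed

text \<open>The weighted inequality is applied to each entry of the strain with the same r; after
  summation \<open>amgm_le\<close> optimises r once for the whole form.\<close>

lemma aform_CS:
  assumes \<mu>: "\<mu> > 0" and u: "H1v U u" and v: "H1v U v"
  shows "cmod (aform \<mu> U u v) \<le> enorm \<mu> U u * enorm \<mu> U v"
proof (rule amgm_le[OF aform_diag(4)[OF u \<mu>] aform_diag(4)[OF v \<mu>]])
  fix r :: real assume r: "r > 0"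
  let ?I = "\<lambda>w c d. integral\<^sup>L (lebesgue_on U) (\<lambda>x. (cmod (sym_grad U w c d x))\<^sup>2)"
  have b: "cmod (integral\<^sup>L (lebesgue_on U) (\<lambda>x. sym_grad U u c d x * cnj (sym_grad U v c d x)))
      \<le> (r / 2) * ?I u c d + (1 / (2 * r)) * ?I v c d" for c d
    using sq_prod_integral_bound[OF L2_measurable[OF sym_grad_L2[OF u]] L2_measurable[OF L2_cnj[OF sym_grad_L2[OF v]]]
        L2_sq[OF sym_grad_L2[OF u]] L2_sq[OF L2_cnj[OF sym_grad_L2[OF v]]] r, of c d c d] by simp
  have "cmod (aform \<mu> U u v) \<le> (\<Sum>c\<in>UNIV. \<Sum>d\<in>UNIV. 2 * \<mu> * ((r / 2) * ?I u c d + (1 / (2 * r)) * ?I v c d))"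
    unfolding aform_sum[OF u v]
  proof (intro sum_norm_le)
    fix c d
    show "cmod (of_real (2 * \<mu>) * integral\<^sup>L (lebesgue_on U) (\<lambda>x. sym_grad U u c d x * cnj (sym_grad U v c d x)))
      \<le> 2 * \<mu> * ((r / 2) * ?I u c d + (1 / (2 * r)) * ?I v c d)"
      using mult_left_mono[OF b[of c d], of "2 * \<mu>"] \<mu> by (simp add: norm_mult)
  qed
  also have "\<dots> = (r / 2) * (enorm \<mu> U u)\<^sup>2 + (1 / (2 * r)) * (enorm \<mu> U v)\<^sup>2"
    unfolding aform_diag(2)[OF u \<mu>] aform_diag(2)[OF v \<mu>] sum_distrib_left sum.distrib[symmetric]
    by (intro sum.cong refl) (simp add: algebra_simps)
  finally show "cmod (aform \<mu> U u v) \<le> (r / 2) * (enorm \<mu> U u)\<^sup>2 + (1 / (2 * r)) * (enorm \<mu> U v)\<^sup>2" .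
qed

lemma enorm_lin_le:
  assumes \<mu>: "\<mu> > 0" and U: "open U" and u: "H1v U u" and v: "H1v U v"
  shows "enorm \<mu> U (lincomb a u b v) \<le> cmod a * enorm \<mu> U u + cmod b * enorm \<mu> U v"
proof -
  define w where "w = lincomb a u b v"
  have w: "H1v U w" unfolding w_def by (rule H1v_lin[OF U u v])
  have w0: "enorm \<mu> U w \<ge> 0" by (rule aform_diag(4)[OF w \<mu>])
  have "(enorm \<mu> U w)\<^sup>2 = cmod (aform \<mu> U w w)"
    unfolding aform_diag(3)[OF w \<mu>] norm_of_real by simp
  also have "aform \<mu> U w w = a * aform \<mu> U u w + b * aform \<mu> U v w"
    using aform_lin_left[OF U u v w, of \<mu> a b] unfolding w_def .
  also have "cmod \<dots> \<le> cmod a * (enorm \<mu> U u * enorm \<mu> U w) + cmod b * (enorm \<mu> U v * enorm \<mu> U w)"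
    using aform_CS[OF \<mu> u w] aform_CS[OF \<mu> v w]
    by (intro order_trans[OF norm_triangle_ineq] add_mono) (auto simp: norm_mult mult_left_mono)
  also have "\<dots> = (cmod a * enorm \<mu> U u + cmod b * enorm \<mu> U v) * enorm \<mu> U w"
    by (simp add: algebra_simps)
  finally have le: "enorm \<mu> U w * enorm \<mu> U w \<le> (cmod a * enorm \<mu> U u + cmod b * enorm \<mu> U v) * enorm \<mu> U w"
    by (simp add: power2_eq_square)
  have "enorm \<mu> U w \<le> cmod a * enorm \<mu> U u + cmod b * enorm \<mu> U v"
  proof (cases "enorm \<mu> U w = 0")
    case True
    then show ?thesis using aform_diag(4)[OF u \<mu>] aform_diag(4)[OF v \<mu>] by simp
  next
    case False
    with w0 have "enorm \<mu> U w > 0" by simp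
    with le show ?thesis by (rule mult_right_le_imp_le)
  qed
  then show ?thesis unfolding w_def .
qed

lemma enorm_diff_le:
  assumes "\<mu> > 0" "open U" "H1v U u" "H1v U v"
  shows "enorm \<mu> U (\<lambda>x. u x - v x) \<le> enorm \<mu> U u + enorm \<mu> U v"
  using enorm_lin_le[OF assms, of 1 "-1"] by (simp add: vector_smult_lneg)

lemma enorm_scale:
  assumes "\<mu> > 0" "open U" "H1v U u"
  shows "enorm \<mu> U (\<lambda>x. a *s u x) = cmod a * enorm \<mu> U u"
proof (cases "a = 0")
  case True
  then show ?thesis using enorm_lin_le[OF assms(1,2,3,3), of 0 0] aform_diag(4)[OF H1v_lin[OF assms(2,3,3), of 0 0] assms(1)]
    by simp
next
  case False
  have 1: "enorm \<mu> U (\<lambda>x. b *s v x) \<le> cmod b * enorm \<mu> U v" if "H1v U v" for b v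
    using enorm_lin_le[OF assms(1,2) that that, of b 0] by simp
  have v: "H1v U (\<lambda>x. a *s u x)" using H1v_lin[OF assms(2,3,3), of a 0] by simp
  have "enorm \<mu> U u \<le> cmod (inverse a) * enorm \<mu> U (\<lambda>x. a *s u x)"
    using 1[OF v, of "inverse a"] False by simp
  then have "cmod a * enorm \<mu> U u \<le> enorm \<mu> U (\<lambda>x. a *s u x)"
    using False by (simp add: norm_divide norm_inverse field_simps)
  with 1[OF assms(3), of a] show ?thesis by simp
qed

lemma enorm_0_sym_grad:
  assumes \<mu>: "\<mu> > 0" and U: "open U" and u: "H1v U u" and 0: "enorm \<mu> U u = 0"
  shows "AE x in lebesgue. x \<in> U \<longrightarrow> sym_grad U u c d x = 0"
proof -
  let ?I = "\<lambda>c d. integral\<^sup>L (lebesgue_on U) (\<lambda>x. (cmod (sym_grad U u c d x))\<^sup>2)"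
  have I: "?I c d \<ge> 0" for c d by (intro Bochner_Integration.integral_nonneg) auto
  have "(\<Sum>c\<in>UNIV. \<Sum>d\<in>UNIV. 2 * \<mu> * ?I c d) = 0" using aform_diag(2)[OF u \<mu>] 0 by simp
  then have "(\<Sum>d\<in>UNIV. 2 * \<mu> * ?I c d) = 0"
    by (subst (asm) sum_nonneg_eq_0_iff) (use I \<mu> in \<open>auto intro!: sum_nonneg\<close>)
  then have "2 * \<mu> * ?I c d = 0"
    by (subst (asm) sum_nonneg_eq_0_iff) (use I \<mu> in \<open>auto\<close>)
  then have "?I c d = 0" using \<mu> by simp
  then have "AE x in lebesgue_on U. (cmod (sym_grad U u c d x))\<^sup>2 = 0"
    using L2_sq[OF sym_grad_L2[OF u]] by (subst (asm) integral_nonneg_eq_0_iff_AE) auto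
  then show ?thesis unfolding AE_on[OF open_leb[OF U]] by simp
qed

lemma enorm_mono:
  assumes \<mu>: "\<mu> > 0" and U: "open U" and V: "open V" "V \<subseteq> U" and u: "H1v U u"
  shows "enorm \<mu> V u \<le> enorm \<mu> U u"
proof (rule power2_le_imp_le[OF _ aform_diag(4)[OF u \<mu>]])
  have v: "H1v V u" by (rule H1v_mono[OF u U V])
  have "integral\<^sup>L (lebesgue_on V) (\<lambda>x. (cmod (sym_grad V u c d x))\<^sup>2) \<le> integral\<^sup>L (lebesgue_on U) (\<lambda>x. (cmod (sym_grad U u c d x))\<^sup>2)" for c d
    unfolding integral_on[OF open_leb[OF U]] integral_on[OF open_leb[OF V(1)]]
  proof (rule integral_mono_AE)
    show "integrable lebesgue (\<lambda>x. indicator V x *\<^sub>R (cmod (sym_grad V u c d x))\<^sup>2)"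
      using L2_sq[OF sym_grad_L2[OF v]] unfolding integrable_on[OF open_leb[OF V(1)]] .
    show "integrable lebesgue (\<lambda>x. indicator U x *\<^sub>R (cmod (sym_grad U u c d x))\<^sup>2)"
      using L2_sq[OF sym_grad_L2[OF u]] unfolding integrable_on[OF open_leb[OF U]] .
    have *: "AE x in lebesgue. x \<in> V \<longrightarrow> Dw V (comp u c) d x = Dw U (comp u c) d x" for c d
      using u U V by (intro Dw_mono) (auto simp: H1v_def)
    show "AE x in lebesgue. indicator V x *\<^sub>R (cmod (sym_grad V u c d x))\<^sup>2 \<le> indicator U x *\<^sub>R (cmod (sym_grad U u c d x))\<^sup>2"
      using *[of c d] *[of d c] by eventually_elim (use V(2) in \<open>auto simp: sym_grad_def indicator_def\<close>)
  qed
  then show "(enorm \<mu> V u)\<^sup>2 \<le> (enorm \<mu> U u)\<^sup>2"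
    unfolding aform_diag(2)[OF u \<mu>] aform_diag(2)[OF v \<mu>] using \<mu> by (intro sum_mono mult_left_mono) auto
qed

section \<open>Geometry of the periodic cell\<close>

lemma cell_open [simp]: "open cell"
  unfolding cell_def by (rule open_box)

lemma zero_lattice: "0 \<in> lattice" by (simp add: lattice_def)

lemma lattice_uminus: "k \<in> lattice \<Longrightarrow> - k \<in> lattice" by (auto simp: lattice_def)

lemma lattice_add: "k \<in> lattice \<Longrightarrow> l \<in> lattice \<Longrightarrow> k + l \<in> lattice" by (auto simp: lattice_def)

lemma axis_lattice: "axis i 1 \<in> lattice" by (auto simp: lattice_def axis_def)

lemma mem_per_ext: "x \<in> per_ext S \<longleftrightarrow> (\<exists>k\<in>lattice. x - k \<in> S)"
proof
  assume "\<exists>k\<in>lattice. x - k \<in> S"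
  then obtain k where "k \<in> lattice" "x - k \<in> S" by blast
  moreover have "x = (x - k) + k" by simp
  ultimately show "x \<in> per_ext S" unfolding per_ext_def by blast
qed (auto simp: per_ext_def intro!: bexI)

lemma per_ext_shift: "k \<in> lattice \<Longrightarrow> x + k \<in> per_ext S \<longleftrightarrow> x \<in> per_ext S"
proof -
  have *: "x + k \<in> per_ext S" if "x \<in> per_ext S" "k \<in> lattice" for x k
  proof -
    obtain l where l: "l \<in> lattice" "x - l \<in> S" using \<open>x \<in> per_ext S\<close> by (auto simp: mem_per_ext)
    then have "l + k \<in> lattice" "x + k - (l + k) \<in> S" using \<open>k \<in> lattice\<close> by (auto simp: lattice_add)
    then show ?thesis unfolding mem_per_ext by blast
  qed
  assume "k \<in> lattice"
  then show ?thesis using *[of x k] *[of "x + k" "- k"] by (auto simp: lattice_uminus)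
qed

text \<open>Two points of the open unit cell differ by less than 1 in every coordinate, so a lattice
  vector between them is 0.\<close>

lemma per_ext_cell:
  assumes "S \<subseteq> cell" "x \<in> cell"
  shows "x \<in> per_ext S \<longleftrightarrow> x \<in> S"
proof
  assume "x \<in> per_ext S"
  then obtain k where k: "k \<in> lattice" "x - k \<in> S" by (auto simp: mem_per_ext)
  have "k $ i = 0" for i
  proof -
    obtain m where m: "k $ i = of_int m" using k(1) by (auto simp: lattice_def elim: Ints_cases)
    have "x - k \<in> cell" using k assms by blast
    then have "0 < x $ i - k $ i" "x $ i - k $ i < 1" by (simp_all add: mem_cell)
    moreover have "0 < x $ i" "x $ i < 1" using assms(2) by (simp_all add: mem_cell)
    ultimately have "real_of_int m < 1" "- 1 < real_of_int m" unfolding m by linarith+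
    then have "m = 0" by linarith
    then show ?thesis using m by simp
  qed
  then have "k = 0" by (simp add: vec_eq_iff)
  with k show "x \<in> S" by simp
qed (use zero_lattice in \<open>force simp: mem_per_ext\<close>)

text \<open>Only countably many lattice translates of the exceptional null set occur.\<close>

lemma periodic_AE:
  assumes inv: "\<And>x k. k \<in> lattice \<Longrightarrow> R (x + k) \<longleftrightarrow> R x" and AE: "AE x in lebesgue. x \<in> cell \<longrightarrow> R x"
  shows "AE x in lebesgue. R x"
proof -
  have h: "AE x in lebesgue. x \<in> hcell 0 \<longrightarrow> R x"
    using AE AE_cell_hcell by eventually_elim simp
  have "AE x in lebesgue. \<forall>k\<in>lattice. x + - k \<in> hcell 0 \<longrightarrow> R (x + - k)"
    unfolding AE_ball_countable[OF countable_lattice]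
    using AE_translate[OF h] by blast
  then show ?thesis
  proof eventually_elim
    case (elim x)
    have "x + - fl x \<in> hcell 0" using fl_hcell[of x] mem_hcell_shift by blast
    then have "R (x + - fl x)" using elim fl_lattice[of x] by blast
    then show ?case using inv[OF lattice_uminus[OF fl_lattice]] by blast
  qed
qed

text \<open>The integral of a translate does not depend on the translation, and its derivative along
  the axis c is minus the integral of the partial derivative.\<close>

lemma ptest_integral_pd:
  assumes \<phi>: "ptest a b \<phi>"
  shows "integral\<^sup>L lebesgue (\<lambda>x. complex_of_real (pd c \<phi> x)) = 0"
proof -
  \<comment> \<open>Room of width 1 around the support, so that the translates with |t| < 1 still
    see F = 1.\<close>
  define C where "C = cbox (a - 1) (b + 1)"
  define F where "F x = indicator C x *\<^sub>R (1::complex)" for x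
  have F: "integrable lebesgue F"
    using absolutely_integrable_continuous[OF continuous_on_const, of "a - 1" "b + 1" "1::complex"]
    unfolding F_def C_def set_integrable_def .
  have cut: "pair_int F \<psi> = integral\<^sup>L lebesgue (\<lambda>x. complex_of_real (\<psi> x))"
    if "\<And>x. x \<notin> C \<Longrightarrow> \<psi> x = 0" for \<psi>
  proof -
    have "F x * complex_of_real (\<psi> x) = complex_of_real (\<psi> x)" for x
      using that[of x] by (cases "x \<in> C") (simp_all add: F_def)
    then show ?thesis by (simp only:)
  qed
  have sub: "cbox a b \<subseteq> C"
  proof
    fix x assume x: "x \<in> cbox a b"
    have "a $ d - 1 \<le> x $ d \<and> x $ d \<le> b $ d + 1" for d
    proof -
      have "a $ d \<le> x $ d" "x $ d \<le> b $ d" using x by (auto simp: mem_box_cart)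
      then show ?thesis by linarith
    qed
    then show "x \<in> C" by (simp add: C_def mem_box_cart)
  qed
  define y :: "real^'a" where "y = axis c 1"
  define G where "G t = pair_int F (\<lambda>x. \<phi> (x - t *\<^sub>R y))" for t
  have "(G has_vector_derivative - (\<Sum>d\<in>UNIV. of_real (y $ d) * pair_int F (\<lambda>x. pd d \<phi> (x - 0 *\<^sub>R y)))) (at 0)"
    unfolding G_def by (rule pair_int_line_deriv[OF F \<phi>])
  moreover have "(\<Sum>d\<in>UNIV. of_real (y $ d) * pair_int F (\<lambda>x. pd d \<phi> (x - 0 *\<^sub>R y))) = pair_int F (pd c \<phi>)"
    by (subst sum.remove[of _ c]) (auto simp: y_def axis_def intro!: sum.neutral)
  ultimately have d1: "(G has_vector_derivative - pair_int F (pd c \<phi>)) (at 0)" by simp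
  have G: "G t = integral\<^sup>L lebesgue (\<lambda>x. complex_of_real (\<phi> x))" if t: "t \<in> ball 0 1" for t
  proof -
    have "G t = integral\<^sup>L lebesgue (\<lambda>x. complex_of_real (\<phi> (x - t *\<^sub>R y)))"
      unfolding G_def
    proof (rule cut)
      fix x assume x: "x \<notin> C"
      have "x - t *\<^sub>R y \<notin> cbox a b"
      proof
        assume "x - t *\<^sub>R y \<in> cbox a b"
        then have *: "a $ d \<le> x $ d - t * y $ d \<and> x $ d - t * y $ d \<le> b $ d" for d by (simp add: mem_box_cart)
        have "a $ d - 1 \<le> x $ d \<and> x $ d \<le> b $ d + 1" for d
        proof -
          have "\<bar>t * y $ d\<bar> \<le> 1" using t by (simp add: y_def axis_def)
          then show ?thesis using *[of d] by linarith
        qed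
        then have "x \<in> C" by (simp add: C_def mem_box_cart)
        with x show False by simp
      qed
      then show "\<phi> (x - t *\<^sub>R y) = 0" by (rule ptest_zero[OF \<phi>])
    qed
    also have "\<dots> = integral\<^sup>L lebesgue (\<lambda>x. complex_of_real (\<phi> x))"
      using integral_translate[of "\<lambda>x. complex_of_real (\<phi> x)" "- t *\<^sub>R y"] by simp
    finally show ?thesis .
  qed
  have "((\<lambda>t. integral\<^sup>L lebesgue (\<lambda>x. complex_of_real (\<phi> x))) has_vector_derivative 0) (at 0)"
    by (rule has_vector_derivative_const)
  then have d2: "(G has_vector_derivative 0) (at 0)"
    by (rule has_vector_derivative_transform_within_open[where S = "ball 0 1"]) (use G in auto)
  have "pair_int F (pd c \<phi>) = 0"
    using vector_derivative_unique_at[OF d1 d2] by simp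
  moreover have "pair_int F (pd c \<phi>) = integral\<^sup>L lebesgue (\<lambda>x. complex_of_real (pd c \<phi> x))"
    by (rule cut) (use ptest_zero[OF ptest_pd[OF \<phi>]] sub in blast)
  ultimately show ?thesis by simp
qed

text \<open>The coordinate function x_c0 cut off near the boundary of the cell, which is still a
  product. Its gradient on S is a basis vector, so testing the weak normal condition with it
  isolates one component of a constant field.\<close>

lemma coordinate_test_fun:
  fixes S :: "(real^'n::finite) set"
  assumes S: "compact S" "S \<subseteq> cell"
  shows "\<exists>\<phi> a b. ptest a b \<phi> \<and> cbox a b \<subseteq> cell \<and> (\<forall>x\<in>S. \<forall>c. pd c \<phi> x = (if c = c0 then 1 else 0))"
proof -
  obtain e where e: "e > 0" "(\<Union>x\<in>S. ball x e) \<subseteq> cell"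
    using compact_subset_open_imp_ball_epsilon_subset[OF S(1) cell_open S(2)] by blast
  define \<eta> where "\<eta> = e / 2"
  have \<eta>: "\<eta> > 0" using e by (simp add: \<eta>_def)
  have in_S: "\<eta> < x $ c \<and> x $ c < 1 - \<eta>" if "x \<in> S" for x c
  proof -
    have "axis c \<eta> = \<eta> *\<^sub>R (axis c 1 :: real^'n)" by (simp add: axis_def vec_eq_iff)
    then have "norm (axis c \<eta> :: real^'n) < e" using e by (simp add: \<eta>_def norm_axis_1)
    then have "x + axis c \<eta> \<in> ball x e" "x - axis c \<eta> \<in> ball x e" by (simp_all add: dist_norm)
    then have "x + axis c \<eta> \<in> cell" "x - axis c \<eta> \<in> cell" using e(2) that by blast+
    then have "x $ c + \<eta> < 1" "0 < x $ c - \<eta>" by (auto simp: mem_cell axis_def dest!: spec[of _ c])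
    then show ?thesis by linarith
  qed
  \<comment> \<open>The two arguments are (4/\<eta>)(t - \<eta>/2) and (4/\<eta>)(1 - \<eta>/2 - t):
    nonpositive at or beyond distance \<eta>/2 from the ends and at least 2 once t has distance
    \<eta> from both. They are written as a + b t to suit \<open>smooth1_affine\<close>.\<close>
  define pl where "pl t = step (- 2 + (4 / \<eta>) * t) * step ((4 / \<eta> - 2) + (- (4 / \<eta>)) * t)" for t
  have pl_smooth: "smooth1 pl"
    unfolding pl_def[abs_def] by (intro smooth1_mult smooth1_affine smooth1_step)
  have pl_0: "pl t = 0" if "t \<notin> {\<eta> / 2..1 - \<eta> / 2}" for t
  proof -
    have "t < \<eta> / 2 \<or> t > 1 - \<eta> / 2" using that by auto
    moreover have "- 2 + (4 / \<eta>) * t = (4 / \<eta>) * (t - \<eta> / 2)"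
      "(4 / \<eta> - 2) + (- (4 / \<eta>)) * t = (4 / \<eta>) * (1 - \<eta> / 2 - t)"
      using \<eta> by (simp_all add: field_simps)
    ultimately have "- 2 + (4 / \<eta>) * t \<le> 0 \<or> (4 / \<eta> - 2) + (- (4 / \<eta>)) * t \<le> 0"
      using \<eta> by (auto intro!: mult_nonneg_nonpos simp del: times_divide_eq_left)
    then show ?thesis by (auto simp: pl_def step_eq_0)
  qed
  have pl_1: "pl t = 1" if "\<eta> < t" "t < 1 - \<eta>" for t
  proof -
    have "(4 / \<eta>) * (\<eta> / 2) \<le> (4 / \<eta>) * (t - \<eta> / 2)" "(4 / \<eta>) * (\<eta> / 2) \<le> (4 / \<eta>) * (1 - \<eta> / 2 - t)"
      using that \<eta> by (intro mult_left_mono; simp)+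
    moreover have "- 2 + (4 / \<eta>) * t = (4 / \<eta>) * (t - \<eta> / 2)"
      "(4 / \<eta> - 2) + (- (4 / \<eta>)) * t = (4 / \<eta>) * (1 - \<eta> / 2 - t)" "(4 / \<eta>) * (\<eta> / 2) = 2"
      using \<eta> by (simp_all add: field_simps)
    ultimately have "1 \<le> - 2 + (4 / \<eta>) * t" "1 \<le> (4 / \<eta> - 2) + (- (4 / \<eta>)) * t" by linarith+
    then show ?thesis by (simp add: pl_def step_eq_1)
  qed
  define F where "F c t = (if c = c0 then t * pl t else pl t)" for c :: 'n and t
  define \<phi> where "\<phi> = tensor F"
  define a b :: "real^'n" where "a = (\<chi> i. \<eta> / 2)" and "b = (\<chi> i. 1 - \<eta> / 2)"
  have F: "smooth1 (F c)" for c
    unfolding F_def[abs_def] using pl_smooth by (cases "c = c0") (auto intro: smooth1_mult)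
  have "ptest a b \<phi>"
    unfolding \<phi>_def
  proof (rule ptestI[OF F])
    fix c t assume "t \<notin> {a $ c..b $ c}"
    then have "pl t = 0" by (intro pl_0) (simp add: a_def b_def)
    then show "F c t = 0" by (simp add: F_def)
  qed
  moreover have "cbox a b \<subseteq> cell"
  proof
    fix x assume x: "x \<in> cbox a b"
    have "0 < x $ i \<and> x $ i < 1" for i
    proof -
      have "\<eta> / 2 \<le> x $ i" "x $ i \<le> 1 - \<eta> / 2" using x by (auto simp: mem_box_cart a_def b_def)
      then show ?thesis using \<eta> by linarith
    qed
    then show "x \<in> cell" by (simp add: mem_cell)
  qed
  moreover have "pd c \<phi> x = (if c = c0 then 1 else 0)" if x: "x \<in> S" for x c
  proof -
    define W where "W = box (\<chi> i. \<eta>) (\<chi> i. 1 - \<eta> :: real^'n)"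
    have W: "open W" unfolding W_def by (rule open_box)
    have xW: "x \<in> W" using in_S[OF x] by (simp add: W_def mem_box_cart)
    have eq: "z $ c0 = \<phi> z" if "z \<in> W" for z
    proof -
      have "pl (z $ d) = 1" for d using that by (intro pl_1) (auto simp: W_def mem_box_cart)
      then have "F d (z $ d) = (if d = c0 then z $ d else 1)" for d by (simp add: F_def)
      then show ?thesis by (simp add: \<phi>_def tensor_def prod.delta)
    qed
    have "((\<lambda>z. z $ c0) has_derivative (\<lambda>h. h $ c0)) (at x)"
      by (rule bounded_linear.has_derivative[OF bounded_linear_vec_nth]) simp
    then have "(\<phi> has_derivative (\<lambda>h. h $ c0)) (at x)"
      by (rule has_derivative_transform_within_open[OF _ W xW]) (rule eq)
    from frechet_derivative_at[OF this] have "frechet_derivative \<phi> (at x) = (\<lambda>h. h $ c0)" by simp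
    then show ?thesis by (simp add: pd_def axis_def)
  qed
  ultimately show ?thesis by blast
qed

text \<open>Translates of a graph in the direction in which it is a graph are disjoint; infinitely many of
  them fit into a bounded set.\<close>
lemma graph_null:
  fixes h :: "real^'n::finite \<Rightarrow> real"
  assumes h: "continuous_on (ball p r) h" and inv: "\<And>x t. h (x + t *\<^sub>R \<nu>) = h x" and \<nu>: "norm \<nu> = 1"
  shows "negligible {x \<in> ball p r. x \<bullet> \<nu> = h x}"
proof -
  define S where "S = {x \<in> ball p r. x \<bullet> \<nu> = h x}"
  have Sb: "S \<in> sets borel"
  proof -
    have "closedin (top_of_set (ball p r)) (ball p r \<inter> (\<lambda>x. x \<bullet> \<nu> - h x) -` {0})"
      by (intro continuous_closedin_preimage continuous_intros h closed_singleton)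
    moreover have "ball p r \<inter> (\<lambda>x. x \<bullet> \<nu> - h x) -` {0} = S" by (auto simp: S_def)
    ultimately obtain T where "closed T" "S = ball p r \<inter> T" by (auto simp: closedin_closed)
    then show ?thesis by auto
  qed
  have Sl: "S \<in> lmeasurable"
    using Sb by (intro bounded_set_imp_lmeasurable bounded_subset[OF bounded_ball[of p r]])
      (auto simp: S_def intro: sets_completionI_sets)
  define T where "T n = (+) ((1 / real (Suc n)) *\<^sub>R \<nu>) ` S" for n
  have Tl: "T n \<in> lmeasurable" and Tm: "measure lebesgue (T n) = measure lebesgue S" for n
    unfolding T_def using Sl by (auto simp: measurable_translation measure_translation)
  have disj: "T m \<inter> T n = {}" if "m \<noteq> n" for m n
  proof (rule ccontr)
    assume "T m \<inter> T n \<noteq> {}"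
    then obtain x y where xy: "x \<in> S" "y \<in> S" "(1 / real (Suc m)) *\<^sub>R \<nu> + x = (1 / real (Suc n)) *\<^sub>R \<nu> + y"
      by (auto simp: T_def)
    then have y: "y = x + (1 / real (Suc m) - 1 / real (Suc n)) *\<^sub>R \<nu>" by (simp add: algebra_simps)
    have "y \<bullet> \<nu> = x \<bullet> \<nu>" using xy(1,2) inv unfolding S_def y by simp
    then have "1 / real (Suc m) - 1 / real (Suc n) = 0"
      using \<nu> unfolding y by (simp add: inner_add_left dot_square_norm)
    then have "1 / real (Suc m) = 1 / real (Suc n)" by simp
    then have "inverse (real (Suc m)) = inverse (real (Suc n))" by (simp only: inverse_eq_divide)
    then have "real (Suc m) = real (Suc n)" by (simp only: inverse_eq_iff_eq)
    with that show False by simp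
  qed
  have sub: "T n \<subseteq> ball p (r + 1)" for n
  proof
    fix z assume "z \<in> T n"
    then obtain x where x: "x \<in> S" "z = (1 / real (Suc n)) *\<^sub>R \<nu> + x" by (auto simp: T_def)
    have "dist p z \<le> dist p x + norm ((1 / real (Suc n)) *\<^sub>R \<nu>)"
      using norm_triangle_ineq4[of "p - x" "(1 / real (Suc n)) *\<^sub>R \<nu>"] by (simp add: x dist_norm algebra_simps)
    also have "\<dots> < r + 1" using x(1) \<nu> by (auto simp: S_def intro!: add_less_le_mono)
    finally show "z \<in> ball p (r + 1)" by simp
  qed
  have "real n * measure lebesgue S \<le> measure lebesgue (ball p (r + 1))" for n
  proof -
    have "measure lebesgue (\<Union>i<n. T i) = (\<Sum>i<n. measure lebesgue (T i))"
      by (rule measure_finite_Union)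
        (use fmeasurableD[OF Tl] fmeasurableD2[OF Tl] disj in \<open>auto simp: disjoint_family_on_def simp del: emeasure_completion\<close>)
    also have "\<dots> = real n * measure lebesgue S" by (simp add: Tm)
    finally show ?thesis
      using sub Tl measure_mono_fmeasurable[of "\<Union>i<n. T i" "ball p (r + 1)" lebesgue]
      by (auto simp: fmeasurableD)
  qed
  then have "measure lebesgue S = 0"
  proof -
    assume *: "\<And>n. real n * measure lebesgue S \<le> measure lebesgue (ball p (r + 1))"
    show ?thesis
    proof (rule ccontr)
      assume "measure lebesgue S \<noteq> 0"
      then have pos: "measure lebesgue S > 0" by (simp add: zero_less_measure_iff)
      obtain n :: nat where "measure lebesgue (ball p (r + 1)) / measure lebesgue S < n" using reals_Archimedean2 by blast
      then have "measure lebesgue (ball p (r + 1)) < n * measure lebesgue S" using pos by (simp add: field_simps)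
      with *[of n] show False by simp
    qed
  qed
  then show ?thesis using Sl unfolding S_def[symmetric] by (simp add: negligible_iff_measure0)
qed

text \<open>Near a frontier point the frontier lies on the graph: a point strictly below it belongs
  to \<Omega>, which is open, and a point strictly above it has a neighbourhood that misses
  \<Omega>. Local nullity then gives nullity.\<close>

lemma graph_boundary_null:
  fixes \<Omega> :: "(real^'n::finite) set"
  assumes \<Omega>: "open \<Omega>" "graph_boundary P \<Omega>" and P: "\<And>p r h. P (ball p r) h \<Longrightarrow> continuous_on (ball p r) h"
  shows "negligible (frontier \<Omega>)"
proof (rule locally_negligible_alt[THEN iffD2], rule ballI)
  fix p assume p: "p \<in> frontier \<Omega>"
  then obtain r \<nu> h where r: "r > 0" "norm \<nu> = 1" "\<forall>x t. h (x + t *\<^sub>R \<nu>) = h x" "P (ball p r) h"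
    "\<Omega> \<inter> ball p r = {x \<in> ball p r. x \<bullet> \<nu> < h x}"
    using \<Omega>(2) unfolding graph_boundary_def by blast
  have h: "continuous_on (ball p r) h" by (rule P[OF r(4)])
  have "frontier \<Omega> \<inter> ball p r \<subseteq> {x \<in> ball p r. x \<bullet> \<nu> = h x}"
  proof
    fix x assume x: "x \<in> frontier \<Omega> \<inter> ball p r"
    then have "x \<notin> \<Omega>" using \<Omega>(1) by (simp add: frontier_def interior_open)
    then have ge: "x \<bullet> \<nu> \<ge> h x" using x r(5) by force
    have "\<not> x \<bullet> \<nu> > h x"
    proof
      assume gt: "x \<bullet> \<nu> > h x"
      define V where "V = ball p r \<inter> (\<lambda>y. y \<bullet> \<nu> - h y) -` {0<..}"
      have "open V" unfolding V_def
        by (intro continuous_open_preimage continuous_intros h) auto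
      moreover have "x \<in> V" using x gt by (auto simp: V_def)
      moreover have "x \<in> closure \<Omega>" using x by (simp add: frontier_def)
      ultimately have "\<Omega> \<inter> V \<noteq> {}"
        using open_Int_closure_eq_empty[of V \<Omega>] by blast
      then obtain y where "y \<in> \<Omega>" "y \<in> ball p r" "y \<bullet> \<nu> > h y" by (auto simp: V_def)
      then show False using r(5) by force
    qed
    with ge x show "x \<in> {x \<in> ball p r. x \<bullet> \<nu> = h x}" by auto
  qed
  then have "negligible (frontier \<Omega> \<inter> ball p r)"
    using graph_null[OF h _ r(2)] r(3) by (blast intro: negligible_subset)
  moreover have "openin (top_of_set (frontier \<Omega>)) (frontier \<Omega> \<inter> ball p r)"
    by (intro openin_open_Int) simp
  ultimately show "\<exists>U. openin (top_of_set (frontier \<Omega>)) U \<and> p \<in> U \<and> negligible U"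
    using p r(1) by (intro exI[of _ "frontier \<Omega> \<inter> ball p r"]) auto
qed

section \<open>Fields of zero energy\<close>

text \<open>The integrals over U that define a weak derivative coincide, so the choice returns the
  same function. This transfers the conditions on Q_2 or Q_1 from a field to its extensions.\<close>

lemma Dw_field_cong:
  fixes U :: "(real^'n::finite) set" and v v' :: "'n field"
  assumes U: "U \<in> sets lebesgue" and eq: "\<And>x. x \<in> U \<Longrightarrow> v x = v' x"
  shows "Dw U (comp v c) = Dw U (comp v' c)"
proof -
  have "integral\<^sup>L (lebesgue_on U) (\<lambda>x. comp v c x * of_real (pd i \<phi> x))
      = integral\<^sup>L (lebesgue_on U) (\<lambda>x. comp v' c x * of_real (pd i \<phi> x))" for i \<phi>
    by (rule Bochner_Integration.integral_cong) (use eq in \<open>auto simp: comp_def\<close>)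
  then show ?thesis by (simp add: Dw_def[abs_def] weak_pd_def)
qed

lemma normal_zero_cong:
  fixes U :: "(real^'n::finite) set" and v v' :: "'n field"
  assumes U: "U \<in> sets lebesgue" and eq: "\<And>x. x \<in> U \<Longrightarrow> v x = v' x" and v: "normal_zero U v"
  shows "normal_zero U v'"
  unfolding normal_zero_def
proof (intro allI impI)
  fix \<phi> :: "real^'n \<Rightarrow> real" assume \<phi>: "test_fun cell \<phi>"
  have D: "Dw U (comp v' c) = Dw U (comp v c)" for c by (rule Dw_field_cong[OF U eq, symmetric])
  have "integral\<^sup>L (lebesgue_on U) (\<lambda>x. (\<Sum>c\<in>UNIV. v' x $ c * of_real (pd c \<phi> x)) + (\<Sum>c\<in>UNIV. Dw U (comp v' c) c x) * of_real (\<phi> x))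
    = integral\<^sup>L (lebesgue_on U) (\<lambda>x. (\<Sum>c\<in>UNIV. v x $ c * of_real (pd c \<phi> x)) + (\<Sum>c\<in>UNIV. Dw U (comp v c) c x) * of_real (\<phi> x))"
    unfolding D by (rule Bochner_Integration.integral_cong) (use eq in auto)
  then show "integral\<^sup>L (lebesgue_on U) (\<lambda>x. (\<Sum>c\<in>UNIV. v' x $ c * of_real (pd c \<phi> x)) + (\<Sum>c\<in>UNIV. Dw U (comp v' c) c x) * of_real (\<phi> x)) = 0"
    using v \<phi> unfolding normal_zero_def by simp
qed

lemma orth_rigid_cong:
  fixes U :: "(real^'n::finite) set" and v v' :: "'n field"
  assumes U: "U \<in> sets lebesgue" and eq: "\<And>x. x \<in> U \<Longrightarrow> v x = v' x" and v: "orth_rigid U v"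
  shows "orth_rigid U v'"
  unfolding orth_rigid_def
proof (intro allI impI)
  fix r :: "'n field" assume r: "rigid r"
  have D: "Dw U (comp v' c) = Dw U (comp v c)" for c by (rule Dw_field_cong[OF U eq, symmetric])
  have "integral\<^sup>L (lebesgue_on U) (\<lambda>x. (\<Sum>c\<in>UNIV. v' x $ c * cnj (r x $ c)) + (\<Sum>c\<in>UNIV. \<Sum>d\<in>UNIV. Dw U (comp v' c) d x * cnj (Dw U (comp r c) d x)))
    = integral\<^sup>L (lebesgue_on U) (\<lambda>x. (\<Sum>c\<in>UNIV. v x $ c * cnj (r x $ c)) + (\<Sum>c\<in>UNIV. \<Sum>d\<in>UNIV. Dw U (comp v c) d x * cnj (Dw U (comp r c) d x)))"
    unfolding D by (rule Bochner_Integration.integral_cong) (use eq in auto)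
  then show "integral\<^sup>L (lebesgue_on U) (\<lambda>x. (\<Sum>c\<in>UNIV. v' x $ c * cnj (r x $ c)) + (\<Sum>c\<in>UNIV. \<Sum>d\<in>UNIV. Dw U (comp v' c) d x * cnj (Dw U (comp r c) d x))) = 0"
    using v r unfolding orth_rigid_def by simp
qed

lemma Dw_zero:
  assumes U: "open U"
  shows "AE x in lebesgue. x \<in> U \<longrightarrow> Dw U (comp (\<lambda>x. 0) c) i x = 0"
  by (rule Dw_eq[OF U L2_zero]) (simp add: weak_pd_def comp_def)

lemma normal_zero_zero: "open (U :: (real^'a::finite) set) \<Longrightarrow> normal_zero U (\<lambda>x. 0)"
  unfolding normal_zero_def
proof (intro allI impI)
  fix \<phi> :: "real^'a \<Rightarrow> real" assume U: "open U"
  have "AE x in lebesgue. \<forall>c\<in>UNIV. x \<in> U \<longrightarrow> Dw U (comp (\<lambda>x. 0 :: complex^'a) c) c x = 0"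
    by (intro AE_finite_allI) (auto intro: Dw_zero[OF U])
  then have "AE x in lebesgue_on U. (\<Sum>c\<in>UNIV. (0 :: complex^'a) $ c * of_real (pd c \<phi> x)) + (\<Sum>c\<in>UNIV. Dw U (comp (\<lambda>x. 0 :: complex^'a) c) c x) * of_real (\<phi> x) = 0"
    unfolding AE_on[OF open_leb[OF U]] by eventually_elim simp
  then show "integral\<^sup>L (lebesgue_on U) (\<lambda>x. (\<Sum>c\<in>UNIV. (0 :: complex^'a) $ c * of_real (pd c \<phi> x)) + (\<Sum>c\<in>UNIV. Dw U (comp (\<lambda>x. 0 :: complex^'a) c) c x) * of_real (\<phi> x)) = 0"
    by (rule integral_eq_zero_AE)
qed

lemma orth_rigid_zero: "open (U :: (real^'a::finite) set) \<Longrightarrow> orth_rigid U (\<lambda>x. 0)"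
  unfolding orth_rigid_def
proof (intro allI impI)
  fix r :: "'a field" assume U: "open U"
  have "AE x in lebesgue. \<forall>c\<in>UNIV. \<forall>d\<in>UNIV. x \<in> U \<longrightarrow> Dw U (comp (\<lambda>x. 0 :: complex^'a) c) d x = 0"
    by (intro AE_finite_allI) (auto intro: Dw_zero[OF U])
  then have "AE x in lebesgue_on U. (\<Sum>c\<in>UNIV. (0 :: complex^'a) $ c * cnj (r x $ c)) + (\<Sum>c\<in>UNIV. \<Sum>d\<in>UNIV. Dw U (comp (\<lambda>x. 0 :: complex^'a) c) d x * cnj (Dw U (comp r c) d x)) = 0"
    unfolding AE_on[OF open_leb[OF U]] by eventually_elim simp
  then show "integral\<^sup>L (lebesgue_on U) (\<lambda>x. (\<Sum>c\<in>UNIV. (0 :: complex^'a) $ c * cnj (r x $ c)) + (\<Sum>c\<in>UNIV. \<Sum>d\<in>UNIV. Dw U (comp (\<lambda>x. 0 :: complex^'a) c) d x * cnj (Dw U (comp r c) d x))) = 0"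
    by (rule integral_eq_zero_AE)
qed

lemma div_free_mono:
  assumes v: "H1v U v" and U: "open U" "open V" "V \<subseteq> U" and d: "div_free U v"
  shows "div_free V v"
proof -
  have "AE x in lebesgue. \<forall>c\<in>UNIV. x \<in> V \<longrightarrow> Dw V (comp v c) c x = Dw U (comp v c) c x"
    using v U by (intro AE_finite_allI) (auto simp: H1v_def intro: Dw_mono)
  moreover have "AE x in lebesgue. x \<in> U \<longrightarrow> (\<Sum>c\<in>UNIV. Dw U (comp v c) c x) = 0"
    using d unfolding div_free_def AE_on[OF open_leb[OF U(1)]] .
  ultimately have "AE x in lebesgue. x \<in> V \<longrightarrow> (\<Sum>c\<in>UNIV. Dw V (comp v c) c x) = 0"
    by eventually_elim (use U(3) in auto)
  then show ?thesis unfolding div_free_def AE_on[OF open_leb[OF U(2)]] .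
qed

lemma div_free_Un:
  assumes v: "H1v (U \<union> V) v" and U: "open U" "open V" and d: "div_free U v" "div_free V v"
  shows "div_free (U \<union> V) v"
proof -
  have o: "open (U \<union> V)" using U by auto
  have *: "AE x in lebesgue. \<forall>c\<in>UNIV. x \<in> W \<longrightarrow> Dw W (comp v c) c x = Dw (U \<union> V) (comp v c) c x"
    if "open W" "W \<subseteq> U \<union> V" for W
    using v o that by (intro AE_finite_allI) (auto simp: H1v_def intro!: Dw_mono)
  have "AE x in lebesgue. x \<in> U \<longrightarrow> (\<Sum>c\<in>UNIV. Dw U (comp v c) c x) = 0" "AE x in lebesgue. x \<in> V \<longrightarrow> (\<Sum>c\<in>UNIV. Dw V (comp v c) c x) = 0"
    using d unfolding div_free_def AE_on[OF open_leb[OF U(1)]] AE_on[OF open_leb[OF U(2)]] by auto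
  then have "AE x in lebesgue. x \<in> U \<union> V \<longrightarrow> (\<Sum>c\<in>UNIV. Dw (U \<union> V) (comp v c) c x) = 0"
    using *[OF U(1) Un_upper1] *[OF U(2) Un_upper2] by eventually_elim auto
  then show ?thesis unfolding div_free_def AE_on[OF open_leb[OF o]] .
qed

lemma div_free_cong:
  fixes U :: "(real^'n::finite) set" and v v' :: "'n field"
  assumes "U \<in> sets lebesgue" "\<And>x. x \<in> U \<Longrightarrow> v x = v' x" "div_free U v"
  shows "div_free U v'"
proof -
  have D: "Dw U (comp v' c) = Dw U (comp v c)" for c by (rule Dw_field_cong[OF assms(1,2), symmetric])
  show ?thesis using assms(3) unfolding div_free_def D .
qed

lemma div_free_zero: "open (U :: (real^'a::finite) set) \<Longrightarrow> div_free U (\<lambda>x. 0)"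
proof -
  assume U: "open U"
  have "AE x in lebesgue. \<forall>c\<in>UNIV. x \<in> U \<longrightarrow> Dw U (comp (\<lambda>x. 0 :: complex^'a) c) c x = 0"
    by (intro AE_finite_allI) (auto intro: Dw_zero[OF U])
  then show ?thesis unfolding div_free_def AE_on[OF open_leb[OF U]] by eventually_elim simp
qed

section \<open>Restriction of periodic Sobolev functions to one cell\<close>

lemma H1_perE:
  assumes "H1_per W f"
  obtains g where "\<And>i. periodic (g i)" "\<And>i. L2 (W \<inter> cell) (g i)" "\<And>i. weak_pd W f i (g i)"
proof -
  have "\<forall>i. \<exists>g. periodic g \<and> L2 (W \<inter> cell) g \<and> weak_pd W f i g" using assms by (auto simp: H1_per_def)
  from choice[OF this] show thesis using that by blast
qed

text \<open>The second claim identifies the derivative chosen on V with any square-integrable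
  derivative on W; later W is the matrix, the phases together or the whole space, and V a part of
  one cell.\<close>

lemma H1_per_H1:
  assumes f: "H1_per W f" and W: "open W" and V: "open V" "V \<subseteq> W \<inter> cell"
  shows "H1 V f"
    and "\<And>g. L2 (W \<inter> cell) g \<Longrightarrow> weak_pd W f i g \<Longrightarrow> AE x in lebesgue. x \<in> V \<longrightarrow> Dw V f i x = g x"
proof -
  have WV: "W \<inter> cell \<in> sets lebesgue" "V \<in> sets lebesgue" "W \<in> sets lebesgue" "V \<subseteq> W"
    using W V by auto
  have m: "L2 V g" if "L2 (W \<inter> cell) g" for g by (rule L2_mono[OF that WV(1,2) V(2)])
  have w: "weak_pd V f i g" if "weak_pd W f i g" for g i by (rule weak_pd_mono[OF that WV(3,2,4)])
  show "H1 V f" using f m w unfolding H1_per_def H1_def by blast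
  fix g assume "L2 (W \<inter> cell) g" "weak_pd W f i g"
  then show "AE x in lebesgue. x \<in> V \<longrightarrow> Dw V f i x = g x" by (intro Dw_eq[OF V(1)] m w)
qed

lemma H1_per_mono:
  assumes f: "H1_per W f" and W: "open W" and V: "open V" "V \<subseteq> W"
  shows "H1_per V f"
proof -
  have s: "W \<inter> cell \<in> sets lebesgue" "V \<inter> cell \<in> sets lebesgue" "V \<inter> cell \<subseteq> W \<inter> cell"
    using W V by auto
  show ?thesis
    using f weak_pd_mono[OF _ open_leb[OF W] open_leb[OF V(1)] V(2)] L2_mono[OF _ s]
    unfolding H1_per_def by blast
qed

text \<open>The geometric facts that the energy arguments consume; the regularity of the interface
  enters as the nullity of \<open>frontier Q2\<close>.\<close>

locale two_phase =
  fixes Q1 Q2 :: "(real^'n::finite) set" and \<mu> :: real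
  assumes Q1_def: "Q1 = cell - closure Q2"
    and \<mu>: "\<mu> > 0"
    and Q2_open: "open Q2" and Q2_conn: "connected Q2" and Q2_sub: "closure Q2 \<subseteq> cell"
    and Gamma_null: "negligible (frontier Q2)"
    and Q2_pos: "emeasure lebesgue Q2 > 0" and Q1_pos: "emeasure lebesgue Q1 > 0"
    and per_open: "open (per_ext Q2)" "open (per_ext_matrix Q2)"
    and per_conn: "connected (per_ext_matrix Q2)"
begin

abbreviation P where "P \<equiv> per_ext_matrix Q2"

lemma Q1_open: "open Q1"
  unfolding Q1_def by (intro open_Diff) auto

lemma Q2_cell: "Q2 \<subseteq> cell" using Q2_sub closure_subset by blast

lemma P_cell: "P \<inter> cell = Q1"
  using per_ext_cell[OF Q2_sub] by (auto simp: per_ext_matrix_def Q1_def)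

lemma R_cell: "(P \<union> per_ext Q2) \<inter> cell = Q1 \<union> Q2"
  using P_cell per_ext_cell[OF Q2_cell] Q2_cell by blast

lemma P_shift: "k \<in> lattice \<Longrightarrow> x + k \<in> P \<longleftrightarrow> x \<in> P"
  by (simp add: per_ext_matrix_def per_ext_shift)

lemma Q2_not_P: "x \<in> Q2 \<Longrightarrow> x \<notin> P"
  using Q2_cell P_cell closure_subset[of Q2] unfolding Q1_def by blast

lemma Q1_P: "x \<in> Q1 \<Longrightarrow> x \<in> P" using P_cell by blast

lemma Q12_open: "open (Q1 \<union> Q2)" using Q1_open Q2_open by auto

lemma Q12_cell: "Q1 \<union> Q2 \<subseteq> cell" using Q2_cell Q1_def by auto

lemma AE_cell_Q12: "AE x in lebesgue. x \<in> cell \<longleftrightarrow> x \<in> Q1 \<union> Q2"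
proof -
  have "AE x in lebesgue. x \<notin> frontier Q2"
    using Gamma_null by (intro AE_not_in) (simp add: negligible_iff_null_sets)
  then show ?thesis
    by eventually_elim (use Q12_cell Q2_open in \<open>auto simp: Q1_def frontier_def interior_open\<close>)
qed

text \<open>Zero strain on the connected Q_2 makes v a rigid displacement r almost everywhere.
  Orthogonality to this r says that the squared H1 norm of v vanishes.\<close>

lemma HQ2_zero:
  assumes v: "HQ2 Q2 v" and 0: "enorm \<mu> Q2 v = 0"
  shows "AE x in lebesgue_on Q2. v x = 0"
proof -
  have vH: "H1v Q2 v" using v by (simp add: HQ2_def H1v_def)
  have H: "H1 Q2 (comp v c)" for c using vH by (simp add: H1v_def)
  note L = open_leb[OF Q2_open]
  have ne: "Q2 \<noteq> {}" using Q2_pos by auto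
  have e: "AE x in lebesgue. x \<in> Q2 \<longrightarrow> Dw Q2 (comp v k) i x + Dw Q2 (comp v i) k x = 0" for k i
    using enorm_0_sym_grad[OF \<mu> Q2_open vH 0, of k i] by eventually_elim (simp add: sym_grad_def)
  obtain A :: "complex^'n" and B :: "complex^'n^'n" where AB: "\<And>k i. B $ k $ i = - B $ i $ k"
    and vA: "\<And>k. AE x in lebesgue. x \<in> Q2 \<longrightarrow> comp v k x = A $ k + (\<Sum>i\<in>UNIV. B $ k $ i * of_real (x $ i))"
    using zero_strain_rigid[where u = "comp v" and g = "\<lambda>k i. Dw Q2 (comp v k) i", OF Q2_open Q2_conn ne
        L2_loc_int[OF H1_L2[OF H] L] L2_loc_int[OF Dw_H1(1)[OF H] L] weak_pd_pt[OF L Dw_H1(2)[OF H]] e] by blast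
  define r :: "'n field" where "r y = A + B *v (\<chi> d. of_real (y $ d))" for y
  have r: "rigid r" unfolding rigid_def r_def using AB by blast
  have vr: "AE x in lebesgue. x \<in> Q2 \<longrightarrow> comp v k x = comp r k x" for k
    using vA[of k] by eventually_elim (simp add: comp_def r_def matrix_vector_mult_def)
  \<comment> \<open>A literal equality, so in the orthogonality relation the gradient of r may be
    replaced by that of v.\<close>
  have Dr: "Dw Q2 (comp r c) = Dw Q2 (comp v c)" for c
    using Dw_cong(1)[OF L vr H1_L2[OF H]] by auto
  have vr_all: "AE x in lebesgue. \<forall>k\<in>UNIV. x \<in> Q2 \<longrightarrow> comp v k x = comp r k x"
    using vr by (intro AE_finite_allI) auto
  define h where "h x = (\<Sum>c\<in>UNIV. (cmod (v x $ c))\<^sup>2) + (\<Sum>c\<in>UNIV. \<Sum>d\<in>UNIV. (cmod (Dw Q2 (comp v c) d x))\<^sup>2)" for x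
  have vi: "integrable (lebesgue_on Q2) (\<lambda>x. (cmod (v x $ c))\<^sup>2)" for c
    using L2_sq[OF H1_L2[OF H[of c]]] by (simp add: comp_def)
  have hi: "integrable (lebesgue_on Q2) h"
    unfolding h_def using vi L2_sq[OF Dw_H1(1)[OF H]] by auto
  have h_nonneg: "h x \<ge> 0" for x unfolding h_def by (intro add_nonneg_nonneg sum_nonneg) auto
  have "complex_of_real (integral\<^sup>L (lebesgue_on Q2) h) = integral\<^sup>L (lebesgue_on Q2) (\<lambda>x. complex_of_real (h x))"
    by simp
  also have "\<dots> = integral\<^sup>L (lebesgue_on Q2) (\<lambda>x. (\<Sum>c\<in>UNIV. v x $ c * cnj (r x $ c)) +
        (\<Sum>c\<in>UNIV. \<Sum>d\<in>UNIV. Dw Q2 (comp v c) d x * cnj (Dw Q2 (comp r c) d x)))"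
  proof (rule integral_cong_AE)
    have pt: "complex_of_real (h x) = (\<Sum>c\<in>UNIV. v x $ c * cnj (v x $ c)) + (\<Sum>c\<in>UNIV. \<Sum>d\<in>UNIV. Dw Q2 (comp v c) d x * cnj (Dw Q2 (comp v c) d x))" for x
      unfolding h_def by (simp add: complex_norm_square del: of_real_power)
    show "AE x in lebesgue_on Q2. complex_of_real (h x) = (\<Sum>c\<in>UNIV. v x $ c * cnj (r x $ c)) +
        (\<Sum>c\<in>UNIV. \<Sum>d\<in>UNIV. Dw Q2 (comp v c) d x * cnj (Dw Q2 (comp r c) d x))"
      unfolding AE_on[OF L] pt Dr using vr_all by eventually_elim (auto simp: comp_def)
    show "(\<lambda>x. complex_of_real (h x)) \<in> borel_measurable (lebesgue_on Q2)" using hi by auto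
    have rm: "(\<lambda>x. r x $ c) \<in> borel_measurable (lebesgue_on Q2)" for c
      using L2_measurable[OF L2_cong_AE[OF L H1_L2[OF H[of c]] vr]] by (simp add: comp_def)
    have vm: "(\<lambda>x. v x $ c) \<in> borel_measurable (lebesgue_on Q2)" for c
      using L2_measurable[OF H1_L2[OF H[of c]]] by (simp add: comp_def)
    note [measurable] = rm vm L2_measurable[OF Dw_H1(1)[OF H]]
    have [measurable]: "cnj \<in> borel_measurable borel"
      by (intro borel_measurable_continuous_onI continuous_intros)
    show "(\<lambda>x. (\<Sum>c\<in>UNIV. v x $ c * cnj (r x $ c)) +
        (\<Sum>c\<in>UNIV. \<Sum>d\<in>UNIV. Dw Q2 (comp v c) d x * cnj (Dw Q2 (comp r c) d x))) \<in> borel_measurable (lebesgue_on Q2)"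
      unfolding Dr by measurable
  qed
  also have "\<dots> = 0" using v r unfolding HQ2_def orth_rigid_def by blast
  finally have "integral\<^sup>L (lebesgue_on Q2) h = 0" by simp
  then have "AE x in lebesgue_on Q2. h x = 0"
    using hi h_nonneg by (subst (asm) integral_nonneg_eq_0_iff_AE) auto
  then show ?thesis
  proof eventually_elim
    case (elim x)
    have "(\<Sum>c\<in>UNIV. (cmod (v x $ c))\<^sup>2) = 0"
    proof -
      have "(\<Sum>c\<in>UNIV. (cmod (v x $ c))\<^sup>2) \<ge> 0" "(\<Sum>c\<in>UNIV. \<Sum>d\<in>UNIV. (cmod (Dw Q2 (comp v c) d x))\<^sup>2) \<ge> 0"
        by (auto intro!: sum_nonneg)
      then show ?thesis using elim unfolding h_def by linarith
    qed
    then show "v x = 0" by (subst (asm) sum_nonneg_eq_0_iff) (auto simp: vec_eq_iff)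
  qed
qed

text \<open>Continuation by 0 into the inclusions turns a function on the periodic matrix into one
  on the torus, which makes the local integrability results for periodic functions available on
  P.\<close>

lemma mask_per_L2:
  assumes "periodic f" "L2 Q1 f"
  shows "per_L2 (\<lambda>x. if x \<in> P then f x else 0)"
  unfolding per_L2_def
proof
  show "periodic (\<lambda>x. if x \<in> P then f x else 0)"
    using assms(1) P_shift[OF axis_lattice] by (simp add: periodic_def)
  have "(\<lambda>x. indicator cell x *\<^sub>R (if x \<in> P then f x else 0)) = (\<lambda>x. indicator Q1 x *\<^sub>R f x)"
    "(\<lambda>x. indicator cell x *\<^sub>R (cmod (if x \<in> P then f x else 0))\<^sup>2) = (\<lambda>x. indicator Q1 x *\<^sub>R (cmod (f x))\<^sup>2)"
    using P_cell by (auto simp: indicator_def fun_eq_iff)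
  then show "L2 cell (\<lambda>x. if x \<in> P then f x else 0)"
    using assms(2) unfolding L2_iff[OF cell_lebesgue] L2_iff[OF open_leb[OF Q1_open]] by simp
qed

lemma loc_int_P:
  assumes "periodic f" "L2 Q1 f"
  shows "loc_int P f"
  unfolding loc_int_def
proof (intro allI impI)
  fix a b assume ab: "cbox a b \<subseteq> P"
  have "set_integrable lebesgue (cbox a b) (\<lambda>x. if x \<in> P then f x else 0)"
    using per_L2_D(3)[OF mask_per_L2[OF assms]] unfolding loc_int_def by blast
  then show "set_integrable lebesgue (cbox a b) f"
    using ab by (subst set_integrable_cong[OF refl refl]) auto
qed

lemma HQ1_H1v: "HQ1 Q1 Q2 v \<Longrightarrow> H1v Q1 v"
  unfolding HQ1_def H1v_def using H1_per_H1(1)[OF _ per_open(2) Q1_open] P_cell by blast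

lemma AE_P_of_Q1:
  assumes inv: "\<And>x k. k \<in> lattice \<Longrightarrow> x \<in> P \<Longrightarrow> Z x \<Longrightarrow> Z (x + k)" and AE: "AE x in lebesgue. x \<in> Q1 \<longrightarrow> Z x"
  shows "AE x in lebesgue. x \<in> P \<longrightarrow> Z x"
proof (rule periodic_AE)
  show "AE x in lebesgue. x \<in> cell \<longrightarrow> x \<in> P \<longrightarrow> Z x"
    using AE by eventually_elim (use P_cell in blast)
  have *: "x + k \<in> P \<longrightarrow> Z (x + k)" if k: "k \<in> lattice" and "x \<in> P \<longrightarrow> Z x" for x k
    using that(2) inv[OF k] P_shift[OF k] by blast
  show "(x + k \<in> P \<longrightarrow> Z (x + k)) \<longleftrightarrow> (x \<in> P \<longrightarrow> Z x)" if k: "k \<in> lattice" for x k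
    using *[OF k, of x] *[OF lattice_uminus[OF k], of "x + k"] by auto
qed

lemma P_not_null: "\<not> (AE x in lebesgue. x \<notin> P)"
proof
  assume "AE x in lebesgue. x \<notin> P"
  then have "AE x in lebesgue. x \<notin> Q1" by eventually_elim (use Q1_P in blast)
  then have "Q1 \<in> null_sets lebesgue"
    using Q1_open by (subst (asm) AE_iff_null_sets[symmetric]) auto
  then show False using Q1_pos by auto
qed

text \<open>A rigid displacement of the connected periodic matrix is constant; a nonzero constant field has
  a nonzero normal component somewhere on the interface.\<close>
lemma HQ1_zero:
  assumes v: "HQ1 Q1 Q2 v" and 0: "enorm \<mu> Q1 v = 0"
  shows "AE x in lebesgue. x \<in> Q1 \<longrightarrow> v x = 0"
proof -
  have vH: "H1v Q1 v" by (rule HQ1_H1v[OF v])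
  have Hp: "H1_per P (comp v c)" for c using v by (simp add: HQ1_def)
  have per: "periodic (comp v c)" for c using Hp[of c] by (simp add: H1_per_def)
  have "\<forall>c. \<exists>g. (\<forall>i. periodic (g i)) \<and> (\<forall>i. L2 Q1 (g i)) \<and> (\<forall>i. weak_pd P (comp v c) i (g i))"
  proof
    fix c
    obtain g where "\<And>i. periodic (g i)" "\<And>i. L2 (P \<inter> cell) (g i)" "\<And>i. weak_pd P (comp v c) i (g i)"
      by (rule H1_perE[OF Hp[of c]]) (rule that; assumption)
    then show "\<exists>g. (\<forall>i. periodic (g i)) \<and> (\<forall>i. L2 Q1 (g i)) \<and> (\<forall>i. weak_pd P (comp v c) i (g i))"
      unfolding P_cell by (intro exI[of _ g]) simp
  qed
  from choice[OF this] obtain g where gp: "\<And>c i. periodic (g c i)" and gL: "\<And>c i. L2 Q1 (g c i)"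
    and gw: "\<And>c i. weak_pd P (comp v c) i (g c i)" by blast
  have Dg: "AE x in lebesgue. x \<in> Q1 \<longrightarrow> Dw Q1 (comp v c) i x = g c i x" for c i
    by (rule H1_per_H1(2)[OF Hp per_open(2) Q1_open _ _ gw]) (simp_all add: P_cell gL)
  have vL: "L2 Q1 (comp v c)" for c using Hp[of c] unfolding H1_per_def P_cell by blast
  note L = open_leb[OF Q1_open] and LP = open_leb[OF per_open(2)]
  have e: "AE x in lebesgue. x \<in> P \<longrightarrow> g k i x + g i k x = 0" for k i
  proof (rule AE_P_of_Q1)
    show "AE x in lebesgue. x \<in> Q1 \<longrightarrow> g k i x + g i k x = 0"
      using enorm_0_sym_grad[OF \<mu> Q1_open vH 0, of k i] Dg[of k i] Dg[of i k]
      by eventually_elim (auto simp: sym_grad_def)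
    show "g k i (x + l) + g i k (x + l) = 0" if "l \<in> lattice" "g k i x + g i k x = 0" for x l
      using that periodic_lattice[OF gp] by simp
  qed
  have ne: "P \<noteq> {}" using P_not_null by auto
  obtain A :: "complex^'n" and B :: "complex^'n^'n" where
    vA: "\<And>k. AE x in lebesgue. x \<in> P \<longrightarrow> comp v k x = A $ k + (\<Sum>i\<in>UNIV. B $ k $ i * of_real (x $ i))"
    using zero_strain_rigid[where u = "comp v" and g = g, OF per_open(2) per_conn ne loc_int_P[OF per vL] loc_int_P[OF gp gL]
        weak_pd_pt[OF LP gw] e] by blast
  \<comment> \<open>A translation by one period along the axis j changes the affine function by the
    entry (k, j) of B, but leaves v unchanged.\<close>
  have B0: "B $ k $ j = 0" for k j
  proof (rule ccontr)
    assume nz: "B $ k $ j \<noteq> 0"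
    have "AE x in lebesgue. x \<notin> P"
      using vA[of k] AE_translate[OF vA[of k], of "axis j 1"]
    proof eventually_elim
      case (elim x)
      show "x \<notin> P"
      proof
        assume x: "x \<in> P"
        then have "x + axis j 1 \<in> P" using P_shift[OF axis_lattice] by blast
        then have "(\<Sum>i\<in>UNIV. B $ k $ i * of_real ((x + axis j 1) $ i)) = (\<Sum>i\<in>UNIV. B $ k $ i * of_real (x $ i))"
          using elim x per[of k] unfolding periodic_def by simp
        moreover have "(\<Sum>i\<in>UNIV. B $ k $ i * of_real ((x + axis j 1) $ i))
            = (\<Sum>i\<in>UNIV. B $ k $ i * of_real (x $ i)) + (\<Sum>i\<in>UNIV. B $ k $ i * of_real (axis j 1 $ i))"
          by (simp add: algebra_simps sum.distrib)
        moreover have "(\<Sum>i\<in>UNIV. B $ k $ i * of_real (axis j 1 $ i)) = B $ k $ j"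
          by (subst sum.remove[of _ j]) (auto simp: axis_def intro!: sum.neutral)
        ultimately show False using nz by simp
      qed
    qed
    with P_not_null show False by blast
  qed
  have vc: "AE x in lebesgue. \<forall>k\<in>UNIV. x \<in> P \<longrightarrow> v x $ k = A $ k"
    using vA by (intro AE_finite_allI) (auto simp: B0 comp_def)
  \<comment> \<open>The test function has gradient e_c0 on the closed inclusion. The integral of A .
    grad \<phi> over the cell is 0, and its part over Q_1 is 0 by the normal condition; what remains
    is the measure of the inclusion times the component c0 of A.\<close>
  have A0: "A $ c0 = 0" for c0
  proof -
    obtain \<phi> a b where \<phi>: "ptest a b \<phi>" "cbox a b \<subseteq> cell"
      and d\<phi>: "\<And>x c. x \<in> closure Q2 \<Longrightarrow> pd c \<phi> x = (if c = c0 then 1 else 0)"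
    proof -
      have "compact (closure Q2)"
        by (rule compact_closure[THEN iffD2]) (rule bounded_subset[OF bounded_box, of _ 0 One], use Q2_cell cell_def in auto)
      from coordinate_test_fun[OF this Q2_sub, of c0] show thesis using that by blast
    qed
    have t: "test_fun cell \<phi>" by (rule ptest_test_fun[OF \<phi>])
    define F where "F x = (\<Sum>c\<in>UNIV. A $ c * complex_of_real (pd c \<phi> x))" for x
    have pi: "integrable lebesgue (\<lambda>x. complex_of_real (pd c \<phi> x))" for c
      using ptest_integrable[OF ptest_pd[OF \<phi>(1)], of UNIV "\<lambda>_. 1"] by (simp add: loc_int_continuous)
    have Fi: "integrable lebesgue F" unfolding F_def using pi by auto
    have "integral\<^sup>L lebesgue F = 0"
      unfolding F_def using pi ptest_integral_pd[OF \<phi>(1)] by simp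
    have F_out: "F x = 0" if "x \<notin> cell" for x
    proof -
      have "x \<notin> cbox a b" using that \<phi>(2) by blast
      then have "pd c \<phi> x = 0" for c by (rule ptest_zero[OF ptest_pd[OF \<phi>(1)]])
      then show ?thesis by (simp add: F_def)
    qed
    have Q1F: "integral\<^sup>L lebesgue (\<lambda>x. indicator Q1 x *\<^sub>R F x) = 0"
    proof -
      have di: "AE x in lebesgue. x \<in> Q1 \<longrightarrow> (\<Sum>c\<in>UNIV. Dw Q1 (comp v c) c x) = 0"
        using v unfolding HQ1_def div_free_def AE_on[OF L] by blast
      have vm: "(\<lambda>x. v x $ c) \<in> borel_measurable (lebesgue_on Q1)" for c
        using L2_measurable[OF vL[of c]] by (simp add: comp_def)
      have pm: "(\<lambda>x. complex_of_real (\<psi> x)) \<in> borel_measurable (lebesgue_on Q1)" if "ptest a b \<psi>" for \<psi>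
        by (intro measurable_restrict_space1 ptest_lebesgue_measurable[OF that])
      note [measurable] = vm pm[OF \<phi>(1)] pm[OF ptest_pd[OF \<phi>(1)]] L2_measurable[OF Dw_H1(1)]
      have Dm [measurable]: "Dw Q1 (comp v c) c \<in> borel_measurable (lebesgue_on Q1)" for c
        using vH by (intro L2_measurable Dw_H1(1)) (simp add: H1v_def)
      have "integral\<^sup>L lebesgue (\<lambda>x. indicator Q1 x *\<^sub>R F x) = integral\<^sup>L (lebesgue_on Q1) F"
        by (rule integral_on[OF L, symmetric])
      also have "\<dots> = integral\<^sup>L (lebesgue_on Q1) (\<lambda>x. (\<Sum>c\<in>UNIV. v x $ c * of_real (pd c \<phi> x))
          + (\<Sum>c\<in>UNIV. Dw Q1 (comp v c) c x) * of_real (\<phi> x))"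
      proof (rule integral_cong_AE)
        show "AE x in lebesgue_on Q1. F x = (\<Sum>c\<in>UNIV. v x $ c * of_real (pd c \<phi> x)) + (\<Sum>c\<in>UNIV. Dw Q1 (comp v c) c x) * of_real (\<phi> x)"
          unfolding AE_on[OF L] using di vc by eventually_elim (use Q1_P in \<open>auto simp: F_def\<close>)
        show "F \<in> borel_measurable (lebesgue_on Q1)" using Fi by (intro measurable_restrict_space1) auto
        show "(\<lambda>x. (\<Sum>c\<in>UNIV. v x $ c * of_real (pd c \<phi> x)) + (\<Sum>c\<in>UNIV. Dw Q1 (comp v c) c x) * of_real (\<phi> x)) \<in> borel_measurable (lebesgue_on Q1)"
          by measurable
      qed
      also have "\<dots> = 0" using v t unfolding HQ1_def normal_zero_def by blast
      finally show ?thesis .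
    qed
    have "F x = indicator Q1 x *\<^sub>R F x + indicator (closure Q2) x *\<^sub>R (A $ c0)" for x
    proof -
      have "F x = A $ c0" if "x \<in> closure Q2"
        unfolding F_def d\<phi>[OF that] by (subst sum.remove[of _ c0]) (auto intro!: sum.neutral)
      then show ?thesis using F_out[of x] Q2_sub by (auto simp: Q1_def indicator_def)
    qed
    then have "integral\<^sup>L lebesgue F = integral\<^sup>L lebesgue (\<lambda>x. indicator Q1 x *\<^sub>R F x + indicator (closure Q2) x *\<^sub>R (A $ c0))"
      by (rule Bochner_Integration.integral_cong[OF refl])
    moreover have cl: "closure Q2 \<in> lmeasurable"
      using bounded_subset[OF bounded_box[of 0 One] Q2_sub[unfolded cell_def]] by (intro bounded_set_imp_lmeasurable) auto
    moreover have "integrable lebesgue (\<lambda>x. indicator Q1 x *\<^sub>R F x)"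
      using Fi L by (intro integrable_mult_indicator)
    ultimately have "integral\<^sup>L lebesgue (\<lambda>x. indicator (closure Q2) x *\<^sub>R (A $ c0)) = 0"
      using Q1F \<open>integral\<^sup>L lebesgue F = 0\<close> by (simp add: lmeasurable_iff_integrable)
    then have "measure lebesgue (closure Q2) *\<^sub>R (A $ c0) = 0"
    proof -
      have "has_bochner_integral lebesgue (\<lambda>x. indicator (closure Q2) x *\<^sub>R (A $ c0)) (measure lebesgue (closure Q2) *\<^sub>R (A $ c0))"
        using cl by (intro has_bochner_integral_indicator) (auto simp: fmeasurable_def simp del: emeasure_completion)
      then show ?thesis
        using \<open>integral\<^sup>L lebesgue (\<lambda>x. indicator (closure Q2) x *\<^sub>R (A $ c0)) = 0\<close>
        by (simp only: has_bochner_integral_integral_eq)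
    qed
    moreover have "measure lebesgue (closure Q2) > 0"
    proof -
      have "emeasure lebesgue Q2 \<le> emeasure lebesgue (closure Q2)"
        using cl by (intro emeasure_mono closure_subset) (simp add: fmeasurableD)
      then have "emeasure lebesgue (closure Q2) > 0" using Q2_pos by order
      then have "0 < ennreal (measure lebesgue (closure Q2))" using emeasure_eq_measure2[OF cl] by simp
      then show ?thesis by (simp add: ennreal_less_zero_iff)
    qed
    ultimately show ?thesis by simp
  qed
  show ?thesis using vc by eventually_elim (use Q1_P in \<open>auto simp: vec_eq_iff A0\<close>)
qed

end

section \<open>Power series in the energy norm\<close>

lemma H1_zero: "H1 U (\<lambda>x. 0)"
  unfolding H1_def by (auto intro!: exI[of _ "\<lambda>x. 0"] simp: L2_zero weak_pd_def)

lemma H1v_zero: "H1v U (\<lambda>x. 0)"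
  unfolding H1v_def comp_def by (simp add: H1_zero)

lemma H1v_diff: "open U \<Longrightarrow> H1v U u \<Longrightarrow> H1v U v \<Longrightarrow> H1v U (\<lambda>x. u x - v x)"
  using H1v_lin[of U u v 1 "-1"] by (simp add: vector_smult_lneg)

lemma H1v_add: "open U \<Longrightarrow> H1v U u \<Longrightarrow> H1v U v \<Longrightarrow> H1v U (\<lambda>x. u x + v x)"
  using H1v_lin[of U u v 1 1] by simp

lemma H1v_scale: "open U \<Longrightarrow> H1v U u \<Longrightarrow> H1v U (\<lambda>x. a *s u x)"
  using H1v_lin[of U u u a 0] by simp

lemma H1v_sum:
  fixes N :: nat
  assumes "open U" "\<And>m. H1v U (a m)"
  shows "H1v U (\<lambda>x. \<Sum>m<N. (w m) *s a m x)"
proof (induction N)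
  case (Suc N)
  then show ?case using H1v_add[OF assms(1) Suc H1v_scale[OF assms(1,2)]] by simp
qed (simp add: H1v_zero)

lemma enorm_zero: "\<mu> > 0 \<Longrightarrow> open U \<Longrightarrow> enorm \<mu> U (\<lambda>x. 0) = 0"
  using enorm_scale[OF _ _ H1v_zero, of \<mu> U 0] by simp

lemma enorm_add_le:
  assumes "\<mu> > 0" "open U" "H1v U u" "H1v U v"
  shows "enorm \<mu> U (\<lambda>x. u x + v x) \<le> enorm \<mu> U u + enorm \<mu> U v"
  using enorm_lin_le[OF assms, of 1 1] by simp

lemma enorm_minus:
  assumes "\<mu> > 0" "open U" "H1v U u"
  shows "enorm \<mu> U (\<lambda>x. - u x) = enorm \<mu> U u"
  using enorm_scale[OF assms, of "-1"] by (simp add: vector_smult_lneg)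

lemma aform_diff:
  assumes U: "open U" and u: "H1v U u" "H1v U v" "H1v U w"
  shows "aform \<mu> U (\<lambda>x. u x - v x) w = aform \<mu> U u w - aform \<mu> U v w"
    and "aform \<mu> U w (\<lambda>x. u x - v x) = aform \<mu> U w u - aform \<mu> U w v"
  using aform_lin_left[OF U u, of \<mu> 1 "-1"] aform_lin_right[OF U u, of \<mu> 1 "-1"]
  by (simp_all add: vector_smult_lneg)

lemma enorm_cong:
  assumes "open U" "H1v U u" "AE x in lebesgue. x \<in> U \<longrightarrow> u x = v x"
  shows "enorm \<mu> U u = enorm \<mu> U v"
  unfolding enorm_def aform_def sym_grad_cong[OF assms] ..

text \<open>Convergence of the series at one point of the disc bounds its terms there, so the tail is
  dominated by a geometric series closer to the centre.\<close>
lemma power_series_at_0: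
  fixes a :: "nat \<Rightarrow> 'n::finite field" and u :: "complex \<Rightarrow> 'n field"
  assumes \<mu>: "\<mu> > 0" and U: "open U" and a: "\<And>m. H1v U (a m)" and r: "r > 0"
    and u: "\<And>w. cmod w < r \<Longrightarrow> H1v U (u w)"
    and lim: "\<And>w. cmod w < r \<Longrightarrow> (\<lambda>N. enorm \<mu> U (\<lambda>x. (\<Sum>m<N. (w ^ m) *s a m x) - u w x)) \<longlonglongrightarrow> 0"
  shows "((\<lambda>w. enorm \<mu> U (\<lambda>x. u w x - a 0 x)) \<longlongrightarrow> 0) (at 0)"
proof -
  define S where "S w N = (\<lambda>x. \<Sum>m<N. (w ^ m) *s a m x)" for w N
  have S: "H1v U (S w N)" for w N unfolding S_def by (rule H1v_sum[OF U a])
  define r0 where "r0 = r / 2"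
  have r0: "r0 > 0" "r0 < r" using r by (auto simp: r0_def)
  define w0 where "w0 = complex_of_real r0"
  have w0: "cmod w0 < r" "cmod w0 = r0" using r0 by (auto simp: w0_def)
  define e where "e N = enorm \<mu> U (\<lambda>x. S w0 N x - u w0 x)" for N
  have "e \<longlonglongrightarrow> 0" using lim[OF w0(1)] unfolding e_def S_def .
  then have "Bseq e" by (intro convergent_imp_Bseq convergentI)
  then obtain M where M: "M > 0" "\<And>N. norm (e N) \<le> M" unfolding Bseq_def by blast
  \<comment> \<open>Each term is a difference of two consecutive partial sums, whose distances to
    the limit are at most M.\<close>
  have terms: "r0 ^ m * enorm \<mu> U (a m) \<le> 2 * M" for m
  proof -
    have d: "H1v U (\<lambda>x. S w0 N x - u w0 x)" for N by (rule H1v_diff[OF U S u[OF w0(1)]])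
    have "(\<lambda>x. (w0 ^ m) *s a m x) = (\<lambda>x. (S w0 (Suc m) x - u w0 x) - (S w0 m x - u w0 x))"
      by (simp add: S_def)
    then have "enorm \<mu> U (\<lambda>x. (w0 ^ m) *s a m x) \<le> e (Suc m) + e m"
      unfolding e_def using enorm_diff_le[OF \<mu> U d d, of "Suc m" m] by simp
    also have "\<dots> \<le> 2 * M" using M(2)[of m] M(2)[of "Suc m"] by (simp add: abs_le_iff)
    finally show ?thesis by (simp add: enorm_scale[OF \<mu> U a] norm_power w0(2))
  qed
  have bound: "enorm \<mu> U (\<lambda>x. u w x - a 0 x) \<le> (4 * M / r0) * cmod w" if w: "cmod w \<le> r0 / 2" for w
  proof -
    define q where "q = cmod w / r0"
    have q: "0 \<le> q" "q \<le> 1 / 2" using w r0 by (auto simp: q_def field_simps)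
    have wr: "cmod w < r" using w r0 by linarith
    \<comment> \<open>By |w| <= r0/2 the ratio q is at most 1/2, so the term of index N+1 is at most
      4 M q 2^-(N+1). The factor 1 - 2^-N is the exact partial sum of this majorant, and the factor
      q, linear in |w|, is kept.\<close>
    have part: "enorm \<mu> U (\<lambda>x. S w (Suc N) x - a 0 x) \<le> 4 * M * q * (1 - (1 / 2) ^ N)" for N
    proof (induction N)
      case 0
      have "(\<lambda>x. S w (Suc 0) x - a 0 x) = (\<lambda>x. 0)" by (simp add: S_def)
      then show ?case by (simp add: enorm_zero[OF \<mu> U])
    next
      case (Suc N)
      have "(\<lambda>x. S w (Suc (Suc N)) x - a 0 x) = (\<lambda>x. (S w (Suc N) x - a 0 x) + (w ^ Suc N) *s a (Suc N) x)"
        unfolding S_def sum.lessThan_Suc[of _ "Suc N"] by (rule ext) (simp only: diff_conv_add_uminus ac_simps)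
      then have "enorm \<mu> U (\<lambda>x. S w (Suc (Suc N)) x - a 0 x)
          \<le> enorm \<mu> U (\<lambda>x. S w (Suc N) x - a 0 x) + enorm \<mu> U (\<lambda>x. (w ^ Suc N) *s a (Suc N) x)"
        using enorm_add_le[OF \<mu> U H1v_diff[OF U S a] H1v_scale[OF U a], of w "Suc N" 0 "w ^ Suc N" "Suc N"] by simp
      moreover have "enorm \<mu> U (\<lambda>x. (w ^ Suc N) *s a (Suc N) x) \<le> 4 * M * q * (1 / 2) ^ Suc N"
      proof -
        have "cmod w ^ Suc N = q ^ Suc N * r0 ^ Suc N" using r0 by (simp add: q_def power_divide)
        then have "enorm \<mu> U (\<lambda>x. (w ^ Suc N) *s a (Suc N) x) = q ^ Suc N * (r0 ^ Suc N * enorm \<mu> U (a (Suc N)))"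
          unfolding enorm_scale[OF \<mu> U a] norm_power by simp
        also have "\<dots> \<le> q ^ Suc N * (2 * M)" using q by (intro mult_left_mono terms) auto
        also have "\<dots> = q * (2 * M) * q ^ N" by simp
        also have "\<dots> \<le> q * (2 * M) * (1 / 2) ^ N"
          using q M by (intro mult_left_mono power_mono) auto
        also have "\<dots> = 4 * M * q * (1 / 2) ^ Suc N" by simp
        finally show ?thesis .
      qed
      ultimately have "enorm \<mu> U (\<lambda>x. S w (Suc (Suc N)) x - a 0 x)
          \<le> 4 * M * q * (1 - (1 / 2) ^ N) + 4 * M * q * (1 / 2) ^ Suc N" using Suc by linarith
      also have "\<dots> = 4 * M * q * (1 - (1 / 2) ^ Suc N)" by (simp add: algebra_simps)
      finally show ?case .
    qed
    have le: "enorm \<mu> U (\<lambda>x. u w x - a 0 x) \<le> 4 * M * q + enorm \<mu> U (\<lambda>x. S w (Suc N) x - u w x)" for N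
    proof -
      have "(\<lambda>x. u w x - a 0 x) = (\<lambda>x. (S w (Suc N) x - a 0 x) - (S w (Suc N) x - u w x))" by simp
      then have "enorm \<mu> U (\<lambda>x. u w x - a 0 x) \<le> enorm \<mu> U (\<lambda>x. S w (Suc N) x - a 0 x) + enorm \<mu> U (\<lambda>x. S w (Suc N) x - u w x)"
        using enorm_diff_le[OF \<mu> U H1v_diff[OF U S a] H1v_diff[OF U S u[OF wr]], of w "Suc N" 0 w "Suc N"] by simp
      moreover have "4 * M * q * (1 - (1 / 2) ^ N) \<le> 4 * M * q * 1"
        using q M by (intro mult_left_mono) auto
      ultimately show ?thesis using part[of N] by linarith
    qed
    have "(\<lambda>N. enorm \<mu> U (\<lambda>x. S w (Suc N) x - u w x)) \<longlonglongrightarrow> 0"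
      using lim[OF wr] unfolding S_def by (rule LIMSEQ_Suc)
    then have "(\<lambda>N. 4 * M * q + enorm \<mu> U (\<lambda>x. S w (Suc N) x - u w x)) \<longlonglongrightarrow> 4 * M * q + 0"
      by (intro tendsto_intros)
    then have "enorm \<mu> U (\<lambda>x. u w x - a 0 x) \<le> 4 * M * q + 0"
      by (rule LIMSEQ_le_const) (use le in blast)
    then show ?thesis by (simp add: q_def)
  qed
  have "((\<lambda>w. (4 * M / r0) * cmod w) \<longlongrightarrow> (4 * M / r0) * cmod 0) (at 0)"
    by (intro tendsto_intros)
  then have z: "((\<lambda>w. (4 * M / r0) * cmod w) \<longlongrightarrow> 0) (at 0)" by simp
  have near: "\<forall>\<^sub>F w in at 0. cmod w \<le> r0 / 2"
    unfolding eventually_at using r0 by (intro exI[of _ "r0 / 2"]) (auto simp: dist_norm)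
  show ?thesis
  proof (rule tendsto_sandwich[OF _ _ tendsto_const z])
    show "\<forall>\<^sub>F w in at 0. enorm \<mu> U (\<lambda>x. u w x - a 0 x) \<le> (4 * M / r0) * cmod w"
      using near by eventually_elim (rule bound)
    show "\<forall>\<^sub>F w in at 0. 0 \<le> enorm \<mu> U (\<lambda>x. u w x - a 0 x)"
      using near
    proof eventually_elim
      case (elim w)
      then have "cmod w < r" using r0 by linarith
      then show ?case by (intro aform_diag(4)[OF H1v_diff[OF U u a] \<mu>])
    qed
  qed
qed

text \<open>The load conjugates its test field, so the component integrals that define the
  permeability appear conjugated.\<close>

lemma load_axis: "load U (axis i 1) v = cnj (integral\<^sup>L (lebesgue_on U) (\<lambda>x. v x $ i))"
proof -
  have "(\<Sum>c\<in>UNIV. complex_of_real (axis i 1 $ c) * cnj (v x $ c)) = cnj (v x $ i)" for x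
    by (subst sum.remove[of _ i]) (auto simp: axis_def intro!: sum.neutral)
  then show ?thesis unfolding load_def by simp
qed

section \<open>The cell problems\<close>

context two_phase
begin

section \<open>Admissible fields in H(Q)\<close>

lemma R_open: "open (P \<union> per_ext Q2)" using per_open by auto

lemma HQ_H1v:
  assumes "HQ Q1 Q2 v"
  shows "H1v (Q1 \<union> Q2) v" "H1v Q1 v" "H1v Q2 v"
proof -
  have *: "H1_per (P \<union> per_ext Q2) (comp v c)" for c using assms by (simp add: HQ_def)
  show "H1v (Q1 \<union> Q2) v"
    unfolding H1v_def using H1_per_H1(1)[OF * R_open Q12_open] R_cell by blast
  then show "H1v Q1 v" "H1v Q2 v"
    using H1v_mono[OF _ Q12_open Q1_open] H1v_mono[OF _ Q12_open Q2_open] by auto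
qed

lemma HQ_HQ2:
  assumes "HQ Q1 Q2 v"
  shows "HQ2 Q2 v"
  using assms HQ_H1v(3)[OF assms] div_free_mono[OF HQ_H1v(1)[OF assms] Q12_open Q2_open Un_upper2]
  by (simp add: HQ_def HQ2_def H1v_def)

lemma integral_cell_Q12:
  fixes F :: "real^'n \<Rightarrow> complex"
  assumes F: "integrable (lebesgue_on cell) F"
  shows "integral\<^sup>L (lebesgue_on (Q1 \<union> Q2)) F = integral\<^sup>L (lebesgue_on cell) F"
  unfolding integral_on[OF open_leb[OF Q12_open]] integral_on[OF cell_lebesgue]
proof (rule integral_cong_AE)
  have i: "integrable lebesgue (\<lambda>x. indicator cell x *\<^sub>R F x)" using F unfolding integrable_on[OF cell_lebesgue] .
  then show "(\<lambda>x. indicator cell x *\<^sub>R F x) \<in> borel_measurable lebesgue" by auto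
  have "(\<lambda>x. indicator (Q1 \<union> Q2) x *\<^sub>R F x) = (\<lambda>x. indicator (Q1 \<union> Q2) x *\<^sub>R (indicator cell x *\<^sub>R F x))"
    using Q12_cell by (auto simp: indicator_def fun_eq_iff)
  then show "(\<lambda>x. indicator (Q1 \<union> Q2) x *\<^sub>R F x) \<in> borel_measurable lebesgue"
    using borel_measurable_integrable[OF integrable_mult_indicator[OF open_leb[OF Q12_open] i]] by simp
  show "AE x in lebesgue. indicator (Q1 \<union> Q2) x *\<^sub>R F x = indicator cell x *\<^sub>R F x"
    using AE_cell_Q12 by eventually_elim (auto simp: indicator_def)
qed

text \<open>A periodic field with weak derivatives across the interface has no jump: the derivative
  chosen on Q_1 and Q_2 together agrees with the global one, and the interface is null.\<close>

lemma HQ_of_periodic: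
  assumes w: "\<And>c. H1_per UNIV (comp w c)" and d: "div_free Q1 w" "div_free Q2 w"
    and nz: "normal_zero Q2 w" and orth: "orth_rigid Q2 w"
  shows "HQ Q1 Q2 w"
proof -
  have Hv: "H1v (Q1 \<union> Q2) w"
    unfolding H1v_def using H1_per_H1(1)[OF w open_UNIV Q12_open] Q12_cell by auto
  have "no_jump Q1 Q2 w"
    unfolding no_jump_def
  proof (intro allI impI)
    fix c i :: 'n and \<phi> :: "real^'n \<Rightarrow> real" assume \<phi>: "test_fun cell \<phi>"
    obtain g where g: "L2 (UNIV \<inter> cell) g" "weak_pd UNIV (comp w c) i g"
      using w[of c] unfolding H1_per_def by blast
    then have gc: "L2 cell g" by simp
    have wc: "L2 cell (comp w c)" using w[of c] unfolding H1_per_def by simp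
    have Dg: "AE x in lebesgue. x \<in> Q1 \<union> Q2 \<longrightarrow> Dw (Q1 \<union> Q2) (comp w c) i x = g x"
      by (rule H1_per_H1(2)[OF w open_UNIV Q12_open _ g]) (use Q12_cell in simp)
    have i1: "integrable (lebesgue_on cell) (\<lambda>x. comp w c x * of_real (pd i \<phi> x))"
      by (rule test_integrable(2)[OF wc cell_lebesgue \<phi>])
    have i2: "integrable (lebesgue_on cell) (\<lambda>x. g x * of_real (\<phi> x))"
      by (rule test_integrable(1)[OF gc cell_lebesgue \<phi>])
    have i12: "integrable (lebesgue_on cell) (\<lambda>x. comp w c x * of_real (pd i \<phi> x) + g x * of_real (\<phi> x))"
      using i1 i2 by simp
    have eq: "AE x in lebesgue_on (Q1 \<union> Q2). w x $ c * of_real (pd i \<phi> x) + Dw (Q1 \<union> Q2) (comp w c) i x * of_real (\<phi> x)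
        = comp w c x * of_real (pd i \<phi> x) + g x * of_real (\<phi> x)"
      unfolding AE_on[OF open_leb[OF Q12_open]] using Dg by eventually_elim (simp add: comp_def)
    have pm: "(\<lambda>x. complex_of_real (\<psi> x)) \<in> borel_measurable (lebesgue_on (Q1 \<union> Q2))" if "continuous_on UNIV \<psi>" for \<psi>
      using borel_measurable_continuous_onI[OF that] by (intro measurable_restrict_space1 measurable_completion) simp
    note pm1 = pm[OF test_fun_D(3)[OF \<phi>]] and pm2 = pm[OF test_fun_D(4)[OF \<phi>]]
    have mono: "f \<in> borel_measurable (lebesgue_on (Q1 \<union> Q2))" if "L2 cell f" for f
      by (rule L2_measurable[OF L2_mono[OF that cell_lebesgue open_leb[OF Q12_open] Q12_cell]])
    have Dm: "Dw (Q1 \<union> Q2) (comp w c) i \<in> borel_measurable (lebesgue_on (Q1 \<union> Q2))"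
      using Hv by (intro L2_measurable Dw_H1(1)) (simp add: H1v_def)
    have wm: "(\<lambda>x. w x $ c) \<in> borel_measurable (lebesgue_on (Q1 \<union> Q2))"
      using mono[OF wc] by (simp add: comp_def)
    have "integral\<^sup>L (lebesgue_on (Q1 \<union> Q2)) (\<lambda>x. w x $ c * of_real (pd i \<phi> x) + Dw (Q1 \<union> Q2) (comp w c) i x * of_real (\<phi> x))
        = integral\<^sup>L (lebesgue_on (Q1 \<union> Q2)) (\<lambda>x. comp w c x * of_real (pd i \<phi> x) + g x * of_real (\<phi> x))"
      using pm1 pm2 Dm wm mono[OF wc] mono[OF gc]
      by (intro integral_cong_AE eq borel_measurable_add borel_measurable_times)
    also have "\<dots> = integral\<^sup>L (lebesgue_on cell) (\<lambda>x. comp w c x * of_real (pd i \<phi> x) + g x * of_real (\<phi> x))"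
      by (rule integral_cell_Q12[OF i12])
    also have "\<dots> = 0"
      using i1 i2 weak_pd_mono[OF g(2) _ cell_lebesgue] \<phi> unfolding weak_pd_def by simp
    finally show "integral\<^sup>L (lebesgue_on (Q1 \<union> Q2)) (\<lambda>x. w x $ c * of_real (pd i \<phi> x) + Dw (Q1 \<union> Q2) (comp w c) i x * of_real (\<phi> x)) = 0" .
  qed
  moreover have "div_free (Q1 \<union> Q2) w" by (rule div_free_Un[OF Hv Q1_open Q2_open d])
  moreover have "H1_per (P \<union> per_ext Q2) (comp w c)" for c by (rule H1_per_mono[OF w open_UNIV R_open]) simp
  ultimately show ?thesis using nz orth by (simp add: HQ_def)
qed

text \<open>Continuation by 0 into all inclusions. It embeds the matrix fields vanishing on the
  interface into H(Q), so that u^out_0 can be used as a test field for the contrast problem.\<close>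

definition ext0 :: "'n field \<Rightarrow> 'n field" where
  "ext0 v = (\<lambda>x. if x \<in> P then v x else 0)"

lemma ext0_Q1: "x \<in> Q1 \<Longrightarrow> ext0 v x = v x" and ext0_Q2: "x \<in> Q2 \<Longrightarrow> ext0 v x = 0"
  using Q1_P Q2_not_P by (auto simp: ext0_def)

lemma comp_ext0: "comp (ext0 v) c = (\<lambda>x. if x \<in> P then v x $ c else 0)"
  by (auto simp: comp_def ext0_def)

lemma ext0_HQ:
  assumes v: "HQ1_0 Q1 Q2 v"
  shows "HQ Q1 Q2 (ext0 v)"
proof (rule HQ_of_periodic)
  show "H1_per UNIV (comp (ext0 v) c)" for c using v unfolding comp_ext0 HQ1_0_def by blast
  have "div_free Q1 v" using v by (simp add: HQ1_0_def HQ1_def)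
  then show "div_free Q1 (ext0 v)" by (rule div_free_cong[OF open_leb[OF Q1_open], rotated]) (simp add: ext0_Q1)
  show "div_free Q2 (ext0 v)"
    by (rule div_free_cong[OF open_leb[OF Q2_open] _ div_free_zero[OF Q2_open]]) (simp add: ext0_Q2)
  show "normal_zero Q2 (ext0 v)"
    by (rule normal_zero_cong[OF open_leb[OF Q2_open] _ normal_zero_zero[OF Q2_open]]) (simp add: ext0_Q2)
  show "orth_rigid Q2 (ext0 v)"
    by (rule orth_rigid_cong[OF open_leb[OF Q2_open] _ orth_rigid_zero[OF Q2_open]]) (simp add: ext0_Q2)
qed

text \<open>Applied to the output of the extension operator: the normal condition and the
  orthogonality concern only Q_2, where the extension agrees with v.\<close>

lemma extension_HQ:
  assumes w: "\<And>c. H1_per UNIV (comp w c)" and d: "div_free cell w" and v: "HQ2 Q2 v" and eq: "\<And>x. x \<in> Q2 \<Longrightarrow> w x = v x"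
  shows "HQ Q1 Q2 w" "H1v cell w"
proof -
  show H: "H1v cell w"
    unfolding H1v_def using H1_per_H1(1)[OF w open_UNIV cell_open] by auto
  show "HQ Q1 Q2 w"
  proof (rule HQ_of_periodic[OF w])
    show "div_free Q1 w" "div_free Q2 w"
      using div_free_mono[OF H cell_open _ _ d] Q1_open Q2_open Q12_cell by auto
    show "normal_zero Q2 w"
      by (rule normal_zero_cong[OF open_leb[OF Q2_open], of v]) (use eq v in \<open>auto simp: HQ2_def\<close>)
    show "orth_rigid Q2 w"
      by (rule orth_rigid_cong[OF open_leb[OF Q2_open], of v]) (use eq v in \<open>auto simp: HQ2_def\<close>)
  qed
qed

lemma aform_vanish_right:
  assumes u: "H1v Q2 u" and v: "\<And>x. x \<in> Q2 \<Longrightarrow> v x = 0" and vH: "H1v Q2 v"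
  shows "aform \<mu> Q2 u v = 0"
proof -
  have "aform \<mu> Q2 u v = aform \<mu> Q2 u (\<lambda>x. 0 *s u x)"
    by (rule aform_cong(2)[OF Q2_open vH]) (use v in simp)
  also have "\<dots> = 0" using aform_lin_right[OF Q2_open u u u, of \<mu> 0 0] by simp
  finally show ?thesis .
qed

section \<open>Energy estimate for the contrast problem\<close>

context
  fixes e :: "real^'n" and uin uout :: "nat \<Rightarrow> 'n field"
  assumes coeff: "coeff_solutions \<mu> Q1 Q2 e uin uout"
begin

lemma coeff_H1v: "H1v Q1 (uout m)" "H1v Q2 (uin (Suc m))"
proof -
  show "H1v Q1 (uout m)"
    using coeff by (cases m) (auto simp: coeff_solutions_def HQ1_0_def intro: HQ1_H1v)
  show "H1v Q2 (uin (Suc m))"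
    using coeff by (auto simp: coeff_solutions_def HQ2_def H1v_def)
qed

text \<open>The case k = 0 of the inner problems, read as a representation of the load on H(Q) by
  two energy products that do not involve z.\<close>

lemma load_representation:
  assumes "HQ Q1 Q2 v"
  shows "load cell e v = aform \<mu> Q2 (uin 1) v + aform \<mu> Q1 (uout 0) v"
proof -
  have "\<forall>k v. HQ Q1 Q2 v \<longrightarrow> aform \<mu> Q2 (uin (Suc k)) v = (if k = 0 then load cell e v else 0) - aform \<mu> Q1 (uout k) v"
    using coeff unfolding coeff_solutions_def by blast
  from this[rule_format, OF assms, of 0] show ?thesis by simp
qed

text \<open>Tested with d - T u, where d = u - ext0 (uout 0) and T is the extension operator, the cell problem
  controls d on the matrix by u on the inclusion; tested with d it then controls u itself.\<close>
lemma permeability_estimate: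
  assumes perm: "perm_solution \<mu> Q1 Q2 z e u" and E: "is_extension_constant \<mu> Q1 Q2 E" and z: "E\<^sup>2 < cmod z"
  shows "enorm \<mu> Q2 u \<le> enorm \<mu> Q2 (uin 1) / (cmod z - E\<^sup>2)"
    and "enorm \<mu> Q1 (\<lambda>x. u x - uout 0 x) \<le> E * enorm \<mu> Q2 u"
proof -
  have u: "HQ Q1 Q2 u" and eq: "\<And>v. HQ Q1 Q2 v \<Longrightarrow> aform \<mu> Q1 u v + z * aform \<mu> Q2 u v = load cell e v"
    using perm by (auto simp: perm_solution_def)
  obtain T1 :: "'n field \<Rightarrow> 'n field" where E1: "E \<ge> 1" and T1: "\<And>v. HQ2 Q2 v \<Longrightarrow> (\<forall>x\<in>Q2. T1 v x = v x) \<and>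
          (\<forall>c. H1_per UNIV (comp (T1 v) c)) \<and> div_free cell (T1 v) \<and> enorm \<mu> cell (T1 v) \<le> E * enorm \<mu> Q2 v"
    using E unfolding is_extension_constant_def by blast
  define t where "t = T1 u"
  have u2: "HQ2 Q2 u" by (rule HQ_HQ2[OF u])
  have t: "HQ Q1 Q2 t" "H1v cell t" and tE: "enorm \<mu> cell t \<le> E * enorm \<mu> Q2 u" and tQ2: "\<And>x. x \<in> Q2 \<Longrightarrow> t x = u x"
    using extension_HQ[of t u] T1[OF u2] u2 unfolding t_def by auto
  have s0: "HQ1_0 Q1 Q2 (uout 0)" using coeff by (simp add: coeff_solutions_def)
  define s where "s = ext0 (uout 0)"
  have s: "HQ Q1 Q2 s" unfolding s_def by (rule ext0_HQ[OF s0])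
  note H = HQ_H1v(2)[OF u] HQ_H1v(3)[OF u] HQ_H1v(2)[OF t(1)] HQ_H1v(3)[OF t(1)] HQ_H1v(2)[OF s] HQ_H1v(3)[OF s]
  have w1: "H1v Q2 (uin 1)" using coeff_H1v(2)[of 0] by simp
  have s_out: "AE x in lebesgue. x \<in> Q1 \<longrightarrow> s x = uout 0 x" by (simp add: s_def ext0_Q1)
  define d where "d = (\<lambda>x. u x - s x)"
  have d: "H1v Q1 d" "H1v Q2 d" unfolding d_def using H Q1_open Q2_open by (auto intro: H1v_diff)
  have id: "aform \<mu> Q1 d v + z * aform \<mu> Q2 u v = aform \<mu> Q2 (uin 1) v" if v: "HQ Q1 Q2 v" for v
  proof -
    have "aform \<mu> Q1 (uout 0) v = aform \<mu> Q1 s v"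
      by (rule aform_cong(1)[OF Q1_open H(5) s_out, symmetric])
    moreover have "aform \<mu> Q1 d v = aform \<mu> Q1 u v - aform \<mu> Q1 s v"
      unfolding d_def by (rule aform_diff(1)[OF Q1_open H(1) H(5) HQ_H1v(2)[OF v]])
    moreover have "aform \<mu> Q1 u v + z * aform \<mu> Q2 u v = aform \<mu> Q2 (uin 1) v + aform \<mu> Q1 (uout 0) v"
      using eq[OF v] load_representation[OF v] by simp
    moreover have "xd + y = b" if "x0 = x2" "xd = x1 - x2" "x1 + y = b + x0" for x0 x1 x2 xd y b :: complex
    proof -
      have "xd + y = (x1 + y) - x2" using that(2) by simp
      also have "\<dots> = b" unfolding that(3,1) by simp
      finally show ?thesis .
    qed
    ultimately show ?thesis by blast
  qed
  have s2: "aform \<mu> Q2 w s = 0" if "H1v Q2 w" for w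
    by (rule aform_vanish_right[OF that _ H(6)]) (simp add: s_def ext0_Q2)
  have t2: "aform \<mu> Q2 w t = aform \<mu> Q2 w u" if "H1v Q2 w" for w
    by (rule aform_cong(2)[OF Q2_open H(4)]) (simp add: tQ2)
  have dd: "aform \<mu> Q1 d d = aform \<mu> Q1 d u - aform \<mu> Q1 d s"
    using aform_diff(2)[OF Q1_open H(1) H(5) d(1), of \<mu>] by (simp add: d_def[symmetric])
  \<comment> \<open>Tested with s all Q_2 terms vanish, so d is orthogonal to s on Q_1. Tested with
    t and with u the Q_2 terms coincide, hence so do the Q_1 terms, and a_1(d, d) = a_1(d,
    t).\<close>
  have us: "aform \<mu> Q1 d s = 0" using id[OF s] s2[OF H(2)] s2[OF w1] by simp
  have ut: "aform \<mu> Q1 d t = aform \<mu> Q1 d u" using id[OF t(1)] id[OF u] unfolding t2[OF H(2)] t2[OF w1]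
    by (metis add_right_cancel)
  define D U A where "D = enorm \<mu> Q1 d" and "U = enorm \<mu> Q2 u" and "A = enorm \<mu> Q2 (uin 1)"
  have nonneg: "D \<ge> 0" "U \<ge> 0" "A \<ge> 0"
    unfolding D_def U_def A_def using aform_diag(4)[OF _ \<mu>] d H w1 by auto
  have tle: "enorm \<mu> Q1 t \<le> E * U"
    using enorm_mono[OF \<mu> cell_open Q1_open _ t(2)] Q12_cell tE unfolding U_def by auto
  have "D\<^sup>2 = cmod (aform \<mu> Q1 d d)"
    unfolding aform_diag(3)[OF d(1) \<mu>] norm_of_real D_def by simp
  also have "aform \<mu> Q1 d d = aform \<mu> Q1 d t" using dd us ut by simp
  also have "cmod \<dots> \<le> D * enorm \<mu> Q1 t" unfolding D_def by (rule aform_CS[OF \<mu> d(1) H(3)])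
  also have "\<dots> \<le> D * (E * U)" using tle nonneg by (intro mult_left_mono)
  finally have D2: "D * D \<le> D * (E * U)" by (simp add: power2_eq_square)
  have DU: "D \<le> E * U"
  proof (cases "D = 0")
    case True then show ?thesis using nonneg E1 by simp
  next
    case False
    with nonneg have "D > 0" by simp
    with D2 show ?thesis by (simp add: mult_le_cancel_left_pos)
  qed
  \<comment> \<open>The identity tested with u. Taking moduli gives |z| U^2 <= A U + (E U)^2, and
    dividing by U leaves the denominator |z| - E^2.\<close>
  have "z * aform \<mu> Q2 u u = aform \<mu> Q2 (uin 1) u - aform \<mu> Q1 d d"
    using id[OF u] dd us by (simp add: algebra_simps)
  then have "cmod z * U\<^sup>2 = cmod (aform \<mu> Q2 (uin 1) u - aform \<mu> Q1 d d)"
    using aform_diag(3)[OF H(2) \<mu>] unfolding U_def by (metis norm_mult norm_of_real abs_of_nonneg zero_le_power2)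
  also have "\<dots> \<le> cmod (aform \<mu> Q2 (uin 1) u) + cmod (aform \<mu> Q1 d d)" by (rule norm_triangle_ineq4)
  also have "\<dots> \<le> A * U + D\<^sup>2"
    using aform_CS[OF \<mu> w1 H(2)] unfolding aform_diag(3)[OF d(1) \<mu>] norm_of_real A_def U_def D_def by simp
  also have "\<dots> \<le> A * U + (E * U)\<^sup>2" using DU nonneg by (intro add_left_mono power_mono)
  finally have fin: "U * ((cmod z - E\<^sup>2) * U) \<le> U * A" by (simp add: algebra_simps power2_eq_square)
  have "(cmod z - E\<^sup>2) * U \<le> A"
  proof (cases "U = 0")
    case True then show ?thesis using nonneg by simp
  next
    case False
    with nonneg have "U > 0" by simp
    with fin show ?thesis by (simp add: mult_le_cancel_left_pos)
  qed
  then have "U \<le> A / (cmod z - E\<^sup>2)" using z by (simp add: pos_le_divide_eq mult.commute)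
  then show "enorm \<mu> Q2 u \<le> enorm \<mu> Q2 (uin 1) / (cmod z - E\<^sup>2)" by (simp add: U_def A_def)
  have "enorm \<mu> Q1 (\<lambda>x. u x - uout 0 x) = D"
    unfolding D_def by (rule enorm_cong[OF Q1_open d(1), symmetric]) (auto simp: d_def s_def ext0_Q1)
  then show "enorm \<mu> Q1 (\<lambda>x. u x - uout 0 x) \<le> E * enorm \<mu> Q2 u" using DU by (simp add: U_def)
qed

end

section \<open>Differences of matrix fields and the Darcy form\<close>

lemma mask_set_integrable:
  assumes f: "periodic f" "L2 Q1 f" and K: "compact K" "K \<subseteq> P"
  shows "set_integrable lebesgue K f"
proof -
  obtain a b where ab: "K \<subseteq> cbox a b" using bounded_subset_cbox_symmetric[OF compact_imp_bounded[OF K(1)]] by blast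
  have "set_integrable lebesgue (cbox a b) (\<lambda>x. if x \<in> P then f x else 0)"
    using per_L2_D(3)[OF mask_per_L2[OF f]] unfolding loc_int_def by blast
  moreover have Kl: "K \<in> sets lebesgue" using K(1) by (intro sets_completionI_sets) (simp add: compact_imp_closed)
  ultimately have "set_integrable lebesgue K (\<lambda>x. if x \<in> P then f x else 0)"
    by (rule set_integrable_subset[OF _ _ ab])
  then show ?thesis using K(2) by (subst set_integrable_cong[OF refl refl, of _ f "\<lambda>x. if x \<in> P then f x else 0"]) auto
qed

text \<open>A test function on the unbounded set P has compact support, and on compact subsets of P
  the periodic functions are integrable through their continuation by 0.\<close>

lemma H1_per_lin:
  assumes f: "H1_per P f" and g: "H1_per P g"
  shows "H1_per P (\<lambda>x. a * f x + b * g x)"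
proof -
  have fp: "periodic f" "L2 Q1 f" and gp: "periodic g" "L2 Q1 g"
    using f g unfolding H1_per_def P_cell by auto
  have ti: "integrable (lebesgue_on P) (\<lambda>x. h x * of_real (\<phi> x)) \<and> integrable (lebesgue_on P) (\<lambda>x. h x * of_real (pd i \<phi> x))"
    if "periodic h" "L2 Q1 h" "test_fun P \<phi>" for h \<phi> i
    using test_fun_D[OF that(3)] mask_set_integrable[OF that(1,2) test_fun_D(5,6)[OF that(3)]]
    by (intro conjI test_integrable_gen[OF _ _ _ open_leb[OF per_open(2)]]) auto
  show ?thesis
    unfolding H1_per_def P_cell
  proof (intro conjI allI)
    show "periodic (\<lambda>x. a * f x + b * g x)" using fp gp by (simp add: periodic_def)
    show "L2 Q1 (\<lambda>x. a * f x + b * g x)" using fp gp by (intro L2_lin)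
    fix i
    obtain f' g' where f': "periodic f'" "L2 Q1 f'" "weak_pd P f i f'" and g': "periodic g'" "L2 Q1 g'" "weak_pd P g i g'"
      using f g unfolding H1_per_def P_cell by blast
    have "weak_pd P (\<lambda>x. a * f x + b * g x) i (\<lambda>x. a * f' x + b * g' x)"
      using ti[OF fp] ti[OF gp] ti[OF f'(1,2)] ti[OF g'(1,2)]
      by (intro weak_pd_lin[OF open_leb[OF per_open(2)] _ f'(3) g'(3)]) blast
    moreover have "periodic (\<lambda>x. a * f' x + b * g' x)" using f' g' by (simp add: periodic_def)
    ultimately show "\<exists>h. periodic h \<and> L2 Q1 h \<and> weak_pd P (\<lambda>x. a * f x + b * g x) i h"
      using L2_lin[OF f'(2) g'(2)] by blast
  qed
qed

lemma Q1_test_integrable: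
  assumes f: "L2 Q1 f" and \<psi>: "continuous_on UNIV \<psi>" "compact K" "\<And>x. x \<notin> K \<Longrightarrow> \<psi> x = 0"
  shows "integrable (lebesgue_on Q1) (\<lambda>x. f x * of_real (\<psi> x) :: complex)"
proof -
  have "compact (\<psi> ` K)" using \<psi> by (intro compact_continuous_image continuous_on_subset[OF \<psi>(1)]) auto
  then obtain B where B: "\<forall>y\<in>\<psi> ` K. norm y \<le> B" using compact_imp_bounded bounded_iff by blast
  have nb: "norm (complex_of_real (\<psi> x)) \<le> max B 0" for x
    using B \<psi>(3)[of x] by (cases "x \<in> K") (auto simp: le_max_iff_disj)
  have bQ1: "bounded Q1" using bounded_subset[OF bounded_box[of 0 One]] Q12_cell unfolding cell_def by auto
  have "set_integrable lebesgue Q1 f"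
    by (rule L2_set_integrable[OF f open_leb[OF Q1_open] open_leb[OF Q1_open] bQ1 subset_refl])
  then have "integrable (lebesgue_on Q1) f"
    unfolding integrable_on[OF open_leb[OF Q1_open]] set_integrable_def .
  then show ?thesis
    using borel_measurable_continuous_onI[OF \<psi>(1)] nb
    by (intro integrable_bounded_mult[where B = "max B 0"] measurable_restrict_space1 measurable_completion) auto
qed

text \<open>Equality of two matrix fields is shown by applying \<open>HQ1_zero\<close> to their
  difference, which therefore has to satisfy every condition of H(Q_1), including the weak normal
  condition.\<close>

lemma HQ1_diff:
  assumes u: "HQ1 Q1 Q2 u" and v: "HQ1 Q1 Q2 v"
  shows "HQ1 Q1 Q2 (\<lambda>x. u x - v x)"
proof -
  define w where "w = (\<lambda>x. u x - v x)"
  have comp_w: "comp w c = (\<lambda>x. 1 * comp u c x + (- 1) * comp v c x)" for c by (simp add: comp_def w_def fun_eq_iff)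
  note uH = HQ1_H1v[OF u] and vH = HQ1_H1v[OF v]
  note L = open_leb[OF Q1_open]
  have H: "H1 Q1 (comp u c)" "H1 Q1 (comp v c)" for c using uH vH by (auto simp: H1v_def)
  have D1: "AE x in lebesgue. x \<in> Q1 \<longrightarrow> Dw Q1 (comp w c) i x = Dw Q1 (comp u c) i x - Dw Q1 (comp v c) i x" for c i
    unfolding comp_w using Dw_lin[OF Q1_open H(1)[of c] H(2)[of c], of 1 "- 1" i] by simp
  have D: "AE x in lebesgue. \<forall>c\<in>UNIV. x \<in> Q1 \<longrightarrow> Dw Q1 (comp w c) c x = Dw Q1 (comp u c) c x - Dw Q1 (comp v c) c x"
    using D1 by (intro AE_finite_allI) auto
  have "div_free Q1 w"
  proof -
    have "AE x in lebesgue. x \<in> Q1 \<longrightarrow> (\<Sum>c\<in>UNIV. Dw Q1 (comp u c) c x) = 0" "AE x in lebesgue. x \<in> Q1 \<longrightarrow> (\<Sum>c\<in>UNIV. Dw Q1 (comp v c) c x) = 0"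
      using u v unfolding HQ1_def div_free_def AE_on[OF L] by auto
    then have "AE x in lebesgue. x \<in> Q1 \<longrightarrow> (\<Sum>c\<in>UNIV. Dw Q1 (comp w c) c x) = 0"
      using D by eventually_elim (auto simp: sum_subtractf)
    then show ?thesis unfolding div_free_def AE_on[OF L] .
  qed
  moreover have "normal_zero Q1 w"
    unfolding normal_zero_def
  proof (intro allI impI)
    fix \<phi> :: "real^'n \<Rightarrow> real" assume \<phi>: "test_fun cell \<phi>"
    define I where "I z x = (\<Sum>c\<in>UNIV. z x $ c * of_real (pd c \<phi> x)) + (\<Sum>c\<in>UNIV. Dw Q1 (comp z c) c x) * of_real (\<phi> x)" for z :: "'n field" and x
    have int: "integrable (lebesgue_on Q1) (I z)" if "H1v Q1 z" for z
    proof -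
      have "integrable (lebesgue_on Q1) (\<lambda>x. comp z c x * of_real (pd c \<phi> x))" for c
        using that test_fun_D[OF \<phi>] by (intro Q1_test_integrable[where K = "tsupport \<phi>"]) (auto simp: H1v_def H1_L2)
      then have "integrable (lebesgue_on Q1) (\<lambda>x. z x $ c * of_real (pd c \<phi> x))" for c by (simp add: comp_def)
      moreover have "integrable (lebesgue_on Q1) (\<lambda>x. Dw Q1 (comp z c) c x * of_real (\<phi> x))" for c
        using that test_fun_D[OF \<phi>] by (intro Q1_test_integrable[where K = "tsupport \<phi>"]) (auto simp: H1v_def Dw_H1)
      ultimately show ?thesis unfolding I_def[abs_def] sum_distrib_right by (intro Bochner_Integration.integrable_add Bochner_Integration.integrable_sum)
    qed
    have wH: "H1v Q1 w" unfolding w_def by (rule H1v_diff[OF Q1_open uH vH])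
    have "integral\<^sup>L (lebesgue_on Q1) (I w) = integral\<^sup>L (lebesgue_on Q1) (\<lambda>x. I u x - I v x)"
    proof (rule integral_cong_AE)
      show "AE x in lebesgue_on Q1. I w x = I u x - I v x"
        unfolding AE_on[OF L] using D
      proof eventually_elim
        case (elim x)
        show ?case
        proof
          assume "x \<in> Q1"
          then have "(\<Sum>c\<in>UNIV. Dw Q1 (comp w c) c x) = (\<Sum>c\<in>UNIV. Dw Q1 (comp u c) c x) - (\<Sum>c\<in>UNIV. Dw Q1 (comp v c) c x)"
            using elim unfolding sum_subtractf[symmetric] by (intro sum.cong) auto
          moreover have "(\<Sum>c\<in>UNIV. w x $ c * of_real (pd c \<phi> x))
              = (\<Sum>c\<in>UNIV. u x $ c * of_real (pd c \<phi> x)) - (\<Sum>c\<in>UNIV. v x $ c * complex_of_real (pd c \<phi> x))"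
            unfolding sum_subtractf[symmetric] by (simp add: w_def left_diff_distrib)
          ultimately show "I w x = I u x - I v x" unfolding I_def by (simp only: left_diff_distrib add_diff_add)
        qed
      qed
    qed (use int[OF uH] int[OF vH] int[OF wH] in auto)
    also have "\<dots> = integral\<^sup>L (lebesgue_on Q1) (I u) - integral\<^sup>L (lebesgue_on Q1) (I v)"
      by (rule Bochner_Integration.integral_diff[OF int[OF uH] int[OF vH]])
    also have "\<dots> = 0" using u v \<phi> unfolding HQ1_def normal_zero_def I_def by simp
    finally show "integral\<^sup>L (lebesgue_on Q1) (\<lambda>x. (\<Sum>c\<in>UNIV. w x $ c * of_real (pd c \<phi> x)) + (\<Sum>c\<in>UNIV. Dw Q1 (comp w c) c x) * of_real (\<phi> x)) = 0"
      unfolding I_def .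
  qed
  moreover have "H1_per P (comp w c)" for c
    unfolding comp_w using u v by (intro H1_per_lin) (auto simp: HQ1_def)
  ultimately show ?thesis unfolding w_def[symmetric] by (simp add: HQ1_def)
qed

text \<open>2 e(u) : e(v) = grad u : grad v + grad u : (grad v)^T, and the last term integrates to the integral
  of div u div v, which vanishes.\<close>
lemma darcy_form:
  assumes u: "HQ1_0 Q1 Q2 u" and v: "HQ1_0 Q1 Q2 v"
  shows "integral\<^sup>L (lebesgue_on Q1) (\<lambda>x. of_real \<mu> * (\<Sum>c\<in>UNIV. \<Sum>d\<in>UNIV. Dw Q1 (comp u c) d x * cnj (Dw Q1 (comp v c) d x)))
    = aform \<mu> Q1 u v"
proof -
  have u1: "HQ1 Q1 Q2 u" and v1: "HQ1 Q1 Q2 v" using u v by (auto simp: HQ1_0_def)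
  note uH = HQ1_H1v[OF u1] and vH = HQ1_H1v[OF v1]
  note L = open_leb[OF Q1_open]
  define G where "G z c d = Dw Q1 (comp z c) d" for z :: "'n field" and c d
  have GL: "L2 Q1 (G u c d)" "L2 Q1 (G v c d)" for c d
    using uH vH unfolding G_def by (auto simp: H1v_def intro: Dw_H1)
  have i: "integrable (lebesgue_on Q1) (\<lambda>x. G u c d x * cnj (G v c' d' x))" for c d c' d'
    using GL by (intro L2_prod_integrable L2_cnj)
  \<comment> \<open>The continuation by 0 has periodic weak derivatives on the whole space; they
    restrict to those of z on Q_1 and to 0 on Q_2, so integrals over Q_1 become integrals over the
    full cell.\<close>
  have ex: "\<exists>g. (\<forall>c i. per_L2 (g c i) \<and> weak_pd UNIV (comp (ext0 z) c) i (g c i)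
      \<and> (AE x in lebesgue. x \<in> Q1 \<longrightarrow> g c i x = G z c i x) \<and> (AE x in lebesgue. x \<in> Q2 \<longrightarrow> g c i x = 0)) \<and> (\<forall>c. per_L2 (comp (ext0 z) c))"
    if z: "HQ1_0 Q1 Q2 z" for z
  proof -
    have Hp: "H1_per UNIV (comp (ext0 z) c)" for c using z unfolding comp_ext0 HQ1_0_def by blast
    have "\<forall>c i. \<exists>g. periodic g \<and> L2 cell g \<and> weak_pd UNIV (comp (ext0 z) c) i g"
      using Hp unfolding H1_per_def by simp
    then obtain g where g: "\<And>c i. periodic (g c i)" "\<And>c i. L2 cell (g c i)" "\<And>c i. weak_pd UNIV (comp (ext0 z) c) i (g c i)"
      by metis
    have gU: "L2 (UNIV \<inter> cell) (g c i)" for c i using g(2) by simp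
    have "AE x in lebesgue. x \<in> Q1 \<longrightarrow> g c i x = G z c i x" for c i
    proof -
      have "AE x in lebesgue. x \<in> Q1 \<longrightarrow> Dw Q1 (comp (ext0 z) c) i x = g c i x"
        by (rule H1_per_H1(2)[OF Hp open_UNIV Q1_open _ gU g(3)]) (use Q12_cell in auto)
      moreover have "Dw Q1 (comp (ext0 z) c) = Dw Q1 (comp z c)"
        by (rule Dw_field_cong[OF L]) (simp add: ext0_Q1)
      ultimately have "AE x in lebesgue. x \<in> Q1 \<longrightarrow> Dw Q1 (comp z c) i x = g c i x" by simp
      then show ?thesis unfolding G_def by eventually_elim simp
    qed
    moreover have "AE x in lebesgue. x \<in> Q2 \<longrightarrow> g c i x = 0" for c i
    proof -
      have "AE x in lebesgue. x \<in> Q2 \<longrightarrow> Dw Q2 (comp (ext0 z) c) i x = g c i x"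
        by (rule H1_per_H1(2)[OF Hp open_UNIV Q2_open _ gU g(3)]) (use Q12_cell in auto)
      moreover have "Dw Q2 (comp (ext0 z) c) = Dw Q2 (comp (\<lambda>x. 0) c)"
        by (rule Dw_field_cong[OF open_leb[OF Q2_open]]) (simp add: ext0_Q2)
      ultimately have "AE x in lebesgue. x \<in> Q2 \<longrightarrow> Dw Q2 (comp (\<lambda>x. 0) c) i x = g c i x" by simp
      then show ?thesis using Dw_zero[OF Q2_open, of c i] by eventually_elim simp
    qed
    moreover have "per_L2 (comp (ext0 z) c)" for c using Hp[of c] by (simp add: H1_per_def per_L2_def)
    ultimately show ?thesis using g by (intro exI[of _ g]) (auto simp: per_L2_def)
  qed
  obtain g where g: "\<And>c i. per_L2 (g c i)" "\<And>c i. weak_pd UNIV (comp (ext0 u) c) i (g c i)"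
    "\<And>c i. AE x in lebesgue. x \<in> Q1 \<longrightarrow> g c i x = G u c i x" "\<And>c i. AE x in lebesgue. x \<in> Q2 \<longrightarrow> g c i x = 0"
    "\<And>c. per_L2 (comp (ext0 u) c)"
    using ex[OF u] by blast
  obtain h where h: "\<And>c i. per_L2 (h c i)" "\<And>c i. weak_pd UNIV (comp (ext0 v) c) i (h c i)"
    "\<And>c i. AE x in lebesgue. x \<in> Q1 \<longrightarrow> h c i x = G v c i x" "\<And>c i. AE x in lebesgue. x \<in> Q2 \<longrightarrow> h c i x = 0"
    "\<And>c. per_L2 (comp (ext0 v) c)"
    using ex[OF v] by blast
  have cnj_per: "per_L2 (\<lambda>x. cnj (f x))" if "per_L2 f" for f :: "real^'n \<Rightarrow> complex"
    using that by (auto simp: per_L2_def periodic_def intro: L2_cnj)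
  have weak_cnj: "weak_pd UNIV (\<lambda>x. cnj (f x)) i (\<lambda>x. cnj (f' x))" if "weak_pd UNIV f i f'" for f f' :: "real^'n \<Rightarrow> complex" and i :: 'n
    unfolding weak_pd_def
  proof (intro allI impI)
    fix \<phi> :: "real^'n \<Rightarrow> real" assume "test_fun UNIV \<phi>"
    then have *: "integral\<^sup>L (lebesgue_on UNIV) (\<lambda>x. f x * of_real (pd i \<phi> x)) = - integral\<^sup>L (lebesgue_on UNIV) (\<lambda>x. f' x * of_real (\<phi> x))"
      using that unfolding weak_pd_def by blast
    have "integral\<^sup>L (lebesgue_on UNIV) (\<lambda>x. cnj (f x) * of_real (pd i \<phi> x)) = cnj (integral\<^sup>L (lebesgue_on UNIV) (\<lambda>x. f x * of_real (pd i \<phi> x)))"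
      unfolding Bochner_Integration.integral_cnj[symmetric] by simp
    also have "\<dots> = - integral\<^sup>L (lebesgue_on UNIV) (\<lambda>x. cnj (f' x) * of_real (\<phi> x))"
      unfolding * complex_cnj_minus Bochner_Integration.integral_cnj[symmetric] by simp
    finally show "integral\<^sup>L (lebesgue_on UNIV) (\<lambda>x. cnj (f x) * of_real (pd i \<phi> x)) = - integral\<^sup>L (lebesgue_on UNIV) (\<lambda>x. cnj (f' x) * of_real (\<phi> x))" .
  qed
  have pt: "weak_pt UNIV f i f'" if "weak_pd UNIV f i f'" for f f' :: "real^'n \<Rightarrow> complex" and i :: 'n
    by (rule weak_pd_pt[OF _ that]) simp
  \<comment> \<open>The exchange lemma is bilinear while the form is sesquilinear, so it is applied
    to the conjugate of the second field.\<close>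
  have swap: "cell_int (\<lambda>x. g c d x * cnj (h d c x)) = cell_int (\<lambda>x. g c c x * cnj (h d d x))" for c d
    by (rule periodic_derivative_swap[where u = "comp (ext0 u) c" and v = "\<lambda>x. cnj (comp (ext0 v) d x)" and h = "\<lambda>i x. cnj (h d i x)"])
      (intro g h cnj_per pt weak_cnj)+
  have to_cell: "integral\<^sup>L (lebesgue_on Q1) (\<lambda>x. G u c d x * cnj (G v c' d' x)) = cell_int (\<lambda>x. g c d x * cnj (h c' d' x))" for c d c' d'
  proof -
    have gh: "loc_int UNIV (\<lambda>x. g c d x * cnj (h c' d' x))"
      using per_L2_prod_loc_int[OF g(1)[of c d] cnj_per[OF h(1)[of c' d']], of 0] by simp
    from hcell_set_integrable[OF this, of 0]
    have *: "integrable lebesgue (\<lambda>x. indicator (hcell 0) x *\<^sub>R (g c d x * cnj (h c' d' x)))"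
      unfolding set_integrable_def .
    show "integral\<^sup>L (lebesgue_on Q1) (\<lambda>x. G u c d x * cnj (G v c' d' x)) = cell_int (\<lambda>x. g c d x * cnj (h c' d' x))"
      unfolding integral_on[OF L]
    proof (rule integral_cong_AE)
      show "(\<lambda>x. indicator Q1 x *\<^sub>R (G u c d x * cnj (G v c' d' x))) \<in> borel_measurable lebesgue"
        using i[of c d c' d'] unfolding integrable_on[OF L] by auto
      show "AE x in lebesgue. indicator Q1 x *\<^sub>R (G u c d x * cnj (G v c' d' x)) = indicator (hcell 0) x *\<^sub>R (g c d x * cnj (h c' d' x))"
        using g(3)[of c d] g(4)[of c d] h(3)[of c' d'] AE_cell_hcell AE_cell_Q12
        by eventually_elim (auto simp: indicator_def)
    qed (use * in auto)
  qed
  have cross: "(\<Sum>c\<in>UNIV. \<Sum>d\<in>UNIV. integral\<^sup>L (lebesgue_on Q1) (\<lambda>x. G u c d x * cnj (G v d c x))) = 0"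
  proof -
    have "(\<Sum>c\<in>UNIV. \<Sum>d\<in>UNIV. integral\<^sup>L (lebesgue_on Q1) (\<lambda>x. G u c d x * cnj (G v d c x)))
        = (\<Sum>c\<in>UNIV. \<Sum>d\<in>UNIV. integral\<^sup>L (lebesgue_on Q1) (\<lambda>x. G u c c x * cnj (G v d d x)))"
      unfolding to_cell swap ..
    also have "\<dots> = integral\<^sup>L (lebesgue_on Q1) (\<lambda>x. (\<Sum>c\<in>UNIV. G u c c x) * cnj (\<Sum>d\<in>UNIV. G v d d x))"
      using i by (simp add: cnj_sum sum_product)
    also have "\<dots> = 0"
    proof (rule integral_eq_zero_AE)
      have "AE x in lebesgue_on Q1. (\<Sum>c\<in>UNIV. G u c c x) = 0"
        using u1 unfolding HQ1_def div_free_def G_def by blast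
      then show "AE x in lebesgue_on Q1. (\<Sum>c\<in>UNIV. G u c c x) * cnj (\<Sum>d\<in>UNIV. G v d d x) = 0"
        by eventually_elim simp
    qed
    finally show ?thesis .
  qed
  have pt_id: "of_real (2 * \<mu>) * (\<Sum>c\<in>UNIV. \<Sum>d\<in>UNIV. sym_grad Q1 u c d x * cnj (sym_grad Q1 v c d x))
      = of_real \<mu> * (\<Sum>c\<in>UNIV. \<Sum>d\<in>UNIV. G u c d x * cnj (G v c d x)) + of_real \<mu> * (\<Sum>c\<in>UNIV. \<Sum>d\<in>UNIV. G u c d x * cnj (G v d c x))" for x
  proof -
    let ?a = "\<lambda>c d. G u c d x" and ?b = "\<lambda>c d. cnj (G v c d x)"
    have "(\<Sum>c\<in>UNIV. \<Sum>d\<in>UNIV. sym_grad Q1 u c d x * cnj (sym_grad Q1 v c d x))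
        = (\<Sum>c\<in>UNIV. \<Sum>d\<in>UNIV. (?a c d * ?b c d + ?a c d * ?b d c + ?a d c * ?b c d + ?a d c * ?b d c) / 4)"
      by (intro sum.cong refl) (simp add: sym_grad_def G_def field_simps)
    also have "\<dots> = ((\<Sum>c\<in>UNIV. \<Sum>d\<in>UNIV. ?a c d * ?b c d) + (\<Sum>c\<in>UNIV. \<Sum>d\<in>UNIV. ?a c d * ?b d c)
        + (\<Sum>c\<in>UNIV. \<Sum>d\<in>UNIV. ?a d c * ?b c d) + (\<Sum>c\<in>UNIV. \<Sum>d\<in>UNIV. ?a d c * ?b d c)) / 4"
      by (simp add: sum.distrib sum_divide_distrib[symmetric])
    also have "(\<Sum>c\<in>UNIV. \<Sum>d\<in>UNIV. ?a d c * ?b c d) = (\<Sum>c\<in>UNIV. \<Sum>d\<in>UNIV. ?a c d * ?b d c)"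
      by (rule sum.swap)
    also have "(\<Sum>c\<in>UNIV. \<Sum>d\<in>UNIV. ?a d c * ?b d c) = (\<Sum>c\<in>UNIV. \<Sum>d\<in>UNIV. ?a c d * ?b c d)"
      by (rule sum.swap)
    also have "(A + B + B + A) / 4 = (A + B) / 2" for A B :: complex by simp
    finally have *: "(\<Sum>c\<in>UNIV. \<Sum>d\<in>UNIV. sym_grad Q1 u c d x * cnj (sym_grad Q1 v c d x))
        = ((\<Sum>c\<in>UNIV. \<Sum>d\<in>UNIV. ?a c d * ?b c d) + (\<Sum>c\<in>UNIV. \<Sum>d\<in>UNIV. ?a c d * ?b d c)) / 2" .
    show ?thesis unfolding * by (simp add: distrib_left)
  qed
  have "aform \<mu> Q1 u v = integral\<^sup>L (lebesgue_on Q1) (\<lambda>x. of_real \<mu> * (\<Sum>c\<in>UNIV. \<Sum>d\<in>UNIV. G u c d x * cnj (G v c d x)))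
      + of_real \<mu> * (\<Sum>c\<in>UNIV. \<Sum>d\<in>UNIV. integral\<^sup>L (lebesgue_on Q1) (\<lambda>x. G u c d x * cnj (G v d c x)))"
    unfolding aform_def pt_id using i by simp
  then show ?thesis unfolding cross by (simp add: G_def)
qed

text \<open>By \<open>darcy_form\<close> both fields solve the same problem for the energy form. The
  difference w is tested with the two solutions separately, which gives a(w, w) = 0 for a field w in
  H(Q_1).\<close>

lemma darcy_unique:
  assumes coeff: "coeff_solutions \<mu> Q1 Q2 e uin uout" and D: "darcy_solution \<mu> Q1 Q2 e uD"
  shows "AE x in lebesgue. x \<in> Q1 \<longrightarrow> uout 0 x = uD x"
proof -
  have u: "HQ1_0 Q1 Q2 (uout 0)" and ue: "\<And>v. HQ1_0 Q1 Q2 v \<Longrightarrow> aform \<mu> Q1 (uout 0) v = load Q1 e v"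
    using coeff by (auto simp: coeff_solutions_def)
  have d: "HQ1_0 Q1 Q2 uD" and de: "\<And>v. HQ1_0 Q1 Q2 v \<Longrightarrow> aform \<mu> Q1 uD v = load Q1 e v"
    using D darcy_form unfolding darcy_solution_def by auto
  have u1: "HQ1 Q1 Q2 (uout 0)" and d1: "HQ1 Q1 Q2 uD" using u d by (auto simp: HQ1_0_def)
  note H = HQ1_H1v[OF u1] HQ1_H1v[OF d1]
  define w where "w = (\<lambda>x. uout 0 x - uD x)"
  have w: "HQ1 Q1 Q2 w" unfolding w_def by (rule HQ1_diff[OF u1 d1])
  have "aform \<mu> Q1 w w = 0"
    using aform_diff(2)[OF Q1_open H HQ1_H1v[OF w], of \<mu>] aform_diff(1)[OF Q1_open H H(1), of \<mu>]
      aform_diff(1)[OF Q1_open H H(2), of \<mu>] ue[OF u] ue[OF d] de[OF u] de[OF d]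
    unfolding w_def[symmetric] by simp
  then have "enorm \<mu> Q1 w = 0" by (simp add: enorm_def)
  from HQ1_zero[OF w this] show ?thesis by eventually_elim (simp add: w_def)
qed

section \<open>Comparison of the permeabilities\<close>

lemma integral_ext0: "integral\<^sup>L (lebesgue_on cell) (\<lambda>x. ext0 v x $ i) = integral\<^sup>L (lebesgue_on Q1) (\<lambda>x. v x $ i)"
proof -
  have "indicator cell x *\<^sub>R (ext0 v x $ i) = indicator Q1 x *\<^sub>R (v x $ i)" for x
    using P_cell by (auto simp: indicator_def ext0_def)
  then show ?thesis
    unfolding integral_on[OF open_leb[OF cell_open]] integral_on[OF open_leb[OF Q1_open]] by simp
qed

text \<open>Two directions occur: the coefficient fields for e_i represent the integral of the i-th
  component, those for e approximate u. Each of the two resulting energy products contains one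
  factor that is small by \<open>permeability_estimate\<close>.\<close>

lemma permeability_difference:
  assumes coeff: "coeff_solutions \<mu> Q1 Q2 (axis i 1) uin uout"
    and coeff': "coeff_solutions \<mu> Q1 Q2 e uin' uout'"
    and perm: "perm_solution \<mu> Q1 Q2 z e u"
    and E: "is_extension_constant \<mu> Q1 Q2 E" and z: "E\<^sup>2 < cmod z"
  shows "cmod (integral\<^sup>L (lebesgue_on cell) (\<lambda>x. u x $ i) - integral\<^sup>L (lebesgue_on Q1) (\<lambda>x. uout' 0 x $ i))
    \<le> (enorm \<mu> Q2 (uin 1) + E * enorm \<mu> Q1 (uout 0)) * (enorm \<mu> Q2 (uin' 1) / (cmod z - E\<^sup>2))"
proof -
  have u: "HQ Q1 Q2 u" using perm by (simp add: perm_solution_def)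
  have E1: "E \<ge> 1" using E by (simp add: is_extension_constant_def)
  define s where "s = ext0 (uout' 0)"
  have s: "HQ Q1 Q2 s"
    unfolding s_def by (rule ext0_HQ) (use coeff' in \<open>simp add: coeff_solutions_def\<close>)
  note H = HQ_H1v(2)[OF u] HQ_H1v(3)[OF u] HQ_H1v(2)[OF s] HQ_H1v(3)[OF s]
  have a1: "H1v Q2 (uin 1)" using coeff_H1v(2)[OF coeff, of 0] by simp
  note a0 = coeff_H1v(1)[OF coeff, of 0] and b0 = coeff_H1v(1)[OF coeff', of 0]
  have s_out: "AE x in lebesgue. x \<in> Q1 \<longrightarrow> s x = uout' 0 x" by (simp add: s_def ext0_Q1)
  have s2: "aform \<mu> Q2 (uin 1) s = 0"
    by (rule aform_vanish_right[OF a1 _ H(4)]) (simp add: s_def ext0_Q2)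
  have s1: "aform \<mu> Q1 (uout 0) s = aform \<mu> Q1 (uout 0) (uout' 0)"
    by (rule aform_cong(2)[OF Q1_open H(3) s_out])
  define I where "I = integral\<^sup>L (lebesgue_on cell) (\<lambda>x. u x $ i) - integral\<^sup>L (lebesgue_on Q1) (\<lambda>x. uout' 0 x $ i)"
  have "cnj I = load cell (axis i 1) u - load cell (axis i 1) s"
    unfolding I_def load_axis s_def integral_ext0 by simp
  also have "\<dots> = aform \<mu> Q2 (uin 1) u + aform \<mu> Q1 (uout 0) (\<lambda>x. u x - uout' 0 x)"
    unfolding load_representation[OF coeff u] load_representation[OF coeff s] s1 s2
      aform_diff(2)[OF Q1_open H(1) b0 a0] by simp
  finally have "cmod I \<le> cmod (aform \<mu> Q2 (uin 1) u) + cmod (aform \<mu> Q1 (uout 0) (\<lambda>x. u x - uout' 0 x))"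
    using norm_triangle_ineq complex_mod_cnj by metis
  also have "\<dots> \<le> enorm \<mu> Q2 (uin 1) * enorm \<mu> Q2 u + enorm \<mu> Q1 (uout 0) * enorm \<mu> Q1 (\<lambda>x. u x - uout' 0 x)"
    by (intro add_mono aform_CS[OF \<mu>] a1 a0 H H1v_diff[OF Q1_open] b0)
  also have "\<dots> \<le> enorm \<mu> Q2 (uin 1) * enorm \<mu> Q2 u + enorm \<mu> Q1 (uout 0) * (E * enorm \<mu> Q2 u)"
    using permeability_estimate(2)[OF coeff' perm E z] aform_diag(4)[OF a0 \<mu>]
    by (intro add_left_mono mult_left_mono)
  also have "\<dots> = (enorm \<mu> Q2 (uin 1) + E * enorm \<mu> Q1 (uout 0)) * enorm \<mu> Q2 u"
    by (simp add: algebra_simps)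
  also have "\<dots> \<le> (enorm \<mu> Q2 (uin 1) + E * enorm \<mu> Q1 (uout 0)) * (enorm \<mu> Q2 (uin' 1) / (cmod z - E\<^sup>2))"
    using permeability_estimate(1)[OF coeff' perm E z] aform_diag(4)[OF a0 \<mu>] aform_diag(4)[OF a1 \<mu>] E1
    by (intro mult_left_mono) auto
  finally show ?thesis unfolding I_def .
qed

lemma outer_series_at_0:
  assumes coeff: "coeff_solutions \<mu> Q1 Q2 e uin uout" and u: "HQ1 Q1 Q2 u"
    and lim: "(\<lambda>N. enorm \<mu> Q1 (\<lambda>x. (\<Sum>m<N. (0 ^ m) *s uout m x) - u x)) \<longlonglongrightarrow> 0"
  shows "AE x in lebesgue. x \<in> Q1 \<longrightarrow> uout 0 x = u x"
proof -
  \<comment> \<open>At w = 0 the power 0^0 = 1 keeps the term m = 0 and no other, hence the passage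
    to partial sums of positive length.\<close>
  have "(\<Sum>m<Suc N. ((0::complex) ^ m) *s uout m x) = uout 0 x" for N x
    unfolding sum.lessThan_Suc_shift by simp
  then have "(\<lambda>N::nat. enorm \<mu> Q1 (\<lambda>x. uout 0 x - u x)) \<longlonglongrightarrow> 0"
    using LIMSEQ_Suc[OF lim] by (simp only:)
  then have "enorm \<mu> Q1 (\<lambda>x. uout 0 x - u x) = 0" by (simp add: LIMSEQ_const_iff)
  moreover have "HQ1 Q1 Q2 (\<lambda>x. uout 0 x - u x)"
    by (rule HQ1_diff[OF _ u]) (use coeff in \<open>simp add: coeff_solutions_def HQ1_0_def\<close>)
  ultimately show ?thesis using HQ1_zero[of "\<lambda>x. uout 0 x - u x"] by simp
qed

lemma inner_series_at_0:
  fixes uin :: "nat \<Rightarrow> 'n field"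
  assumes u: "HQ2 Q2 u" and lim: "(\<lambda>N. enorm \<mu> Q2 (\<lambda>x. (\<Sum>m<N. (0 ^ (m + 1)) *s uin (Suc m) x) - u x)) \<longlonglongrightarrow> 0"
  shows "AE x in lebesgue_on Q2. u x = 0"
proof (rule HQ2_zero[OF u])
  have uH: "H1v Q2 u" using u by (simp add: HQ2_def H1v_def)
  \<comment> \<open>The inner series starts with the power w^1, so at w = 0 every partial sum is
    0.\<close>
  have "(\<lambda>N::nat. enorm \<mu> Q2 (\<lambda>x. - u x)) \<longlonglongrightarrow> 0" using lim by simp
  then show "enorm \<mu> Q2 u = 0" unfolding enorm_minus[OF \<mu> Q2_open uH] by (simp add: LIMSEQ_const_iff)
qed

end

theorem theorem2:
  fixes \<mu>1 :: real and Q2 :: "(real^'n::finite) set" and k :: nat and \<sigma> :: real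
    and E1 :: real
    and uin uout :: "'n \<Rightarrow> nat \<Rightarrow> 'n field"
    and uinf uoutf :: "'n \<Rightarrow> complex \<Rightarrow> 'n field"
    and uD :: "'n \<Rightarrow> 'n field"
    and usol :: "complex \<Rightarrow> 'n \<Rightarrow> 'n field"
  defines "Q1 \<equiv> cell - closure Q2"
  assumes dim: "CARD('n) = 2 \<or> CARD('n) = 3"
    and mu: "\<mu>1 > 0"
    and Q2_open: "open Q2" and Q2_conn: "connected Q2" and Q2_sub: "closure Q2 \<subseteq> cell"
    and sigma: "0 \<le> \<sigma>" "\<sigma> \<le> 1" "real k + \<sigma> \<ge> 2"
    and Gamma_reg: "Ck_sigma_boundary k \<sigma> Q2"
    and pos_meas: "emeasure lebesgue Q1 > 0" "emeasure lebesgue Q2 > 0"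
    and per_open: "open (per_ext Q2)" "open (per_ext_matrix Q2)"
    and per_C1: "C1_boundary (per_ext Q2)" "C1_boundary (per_ext_matrix Q2)"
    and per_conn: "connected (per_ext_matrix Q2)"
    and Q1_conn: "connected Q1" and Q1_lip: "lipschitz_boundary Q1"
    and E1: "is_extension_constant \<mu>1 Q1 Q2 E1"
    and coeff: "\<And>i. coeff_solutions \<mu>1 Q1 Q2 (axis i 1) (uin i) (uout i)"
    and lim_in: "\<And>i w. cmod w < 1 / (2 * E1\<^sup>2) \<Longrightarrow> HQ2 Q2 (uinf i w) \<and>
        (\<lambda>N. enorm \<mu>1 Q2 (\<lambda>x. (\<Sum>m<N. (w ^ (m + 1)) *s uin i (Suc m) x) - uinf i w x))
          \<longlonglongrightarrow> 0"
    and lim_out: "\<And>i w. cmod w < 1 / (2 * E1\<^sup>2) \<Longrightarrow> HQ1 Q1 Q2 (uoutf i w) \<and>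
        (\<lambda>N. enorm \<mu>1 Q1 (\<lambda>x. (\<Sum>m<N. (w ^ m) *s uout i m x) - uoutf i w x))
          \<longlonglongrightarrow> 0"
    and darcy: "\<And>i. darcy_solution \<mu>1 Q1 Q2 (axis i 1) (uD i)"
    and perm: "\<And>z j. z \<notin> neg_axis \<Longrightarrow> perm_solution \<mu>1 Q1 Q2 z (axis j 1) (usol z j)"
  defines "K \<equiv> \<lambda>z i j. integral\<^sup>L (lebesgue_on cell) (\<lambda>y. usol z j y $ i)"
    and "KD \<equiv> \<lambda>i j. integral\<^sup>L (lebesgue_on Q1) (\<lambda>y. uD j y $ i)"
  shows "(\<forall>i. AE x in lebesgue_on Q2. uinf i 0 x = 0)
    \<and> (\<forall>i. ((\<lambda>w. enorm \<mu>1 Q1 (\<lambda>x. uoutf i w x - uD i x)) \<longlongrightarrow> 0) (at 0)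
           \<and> (AE x in lebesgue_on Q1. uoutf i 0 x = uD i x))
    \<and> (\<exists>C. \<forall>w i j. w \<noteq> 0 \<longrightarrow> cmod w < 1 / (2 * E1\<^sup>2) \<longrightarrow> 1 / w \<notin> neg_axis \<longrightarrow>
           cmod (K (1 / w) i j - KD i j) \<le> C * (2 * E1\<^sup>2 * cmod w) / (1 - 2 * E1\<^sup>2 * cmod w))
    \<and> (\<forall>i j. ((\<lambda>z. K z i j) \<longlongrightarrow> KD i j) (inf at_infinity (principal (- neg_axis))))"
proof -
  interpret two_phase Q1 Q2 \<mu>1
  proof
    show "negligible (frontier Q2)"
    proof (rule graph_boundary_null[OF Q2_open Gamma_reg[unfolded Ck_sigma_boundary_def]])
      fix p r and h :: "real^'n \<Rightarrow> real" assume "Ck_sigma_on k \<sigma> (ball p r) h"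
      \<comment> \<open>The empty list of derivatives in \<open>Ck_on\<close> expresses continuity
        of the graph function itself.\<close>
      then have "continuous_on (ball p r) (pds [] h)"
        unfolding Ck_sigma_on_def Ck_on_def by (metis le0 list.size(3))
      then show "continuous_on (ball p r) h" by simp
    qed
  qed (use Q1_def mu Q2_open Q2_conn Q2_sub pos_meas per_open per_conn in auto)
  have E1_ge: "E1 \<ge> 1" using E1 by (simp add: is_extension_constant_def)
  define r where "r = 1 / (2 * E1\<^sup>2)"
  have r: "r > 0" using E1_ge by (simp add: r_def)
  note lim_in = lim_in[folded r_def] and lim_out = lim_out[folded r_def]
  have lim0: "HQ1 Q1 Q2 (uoutf i w)" if "cmod w < r" for i w using lim_out[OF that] by blast
  note out_D = darcy_unique[OF coeff darcy]
  have in_0: "AE x in lebesgue_on Q2. uinf i 0 x = 0" for i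
    using inner_series_at_0[of "uinf i 0" "uin i"] lim_in[of 0 i] r by simp
  have out_0: "AE x in lebesgue_on Q1. uoutf i 0 x = uD i x" for i
  proof -
    have "AE x in lebesgue. x \<in> Q1 \<longrightarrow> uout i 0 x = uoutf i 0 x"
      using outer_series_at_0[OF coeff lim0, of 0 i i] lim_out[of 0 i] r by simp
    then show ?thesis
      unfolding AE_on[OF open_leb[OF Q1_open]] using out_D[of i] by eventually_elim simp
  qed
  have out_lim: "((\<lambda>w. enorm \<mu>1 Q1 (\<lambda>x. uoutf i w x - uD i x)) \<longlongrightarrow> 0) (at 0)" for i
  proof (rule Lim_transform_eventually)
    show "((\<lambda>w. enorm \<mu>1 Q1 (\<lambda>x. uoutf i w x - uout i 0 x)) \<longlongrightarrow> 0) (at 0)"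
      by (rule power_series_at_0[OF mu Q1_open coeff_H1v(1)[OF coeff] r])
        (use lim_out HQ1_H1v in blast)+
    \<comment> \<open>Near 0 the limit field exists, and there u^out_0 may be exchanged for the
      Darcy field, which agrees with it almost everywhere on Q_1.\<close>
    have "\<forall>\<^sub>F w in at 0. cmod w < r" using r by (auto simp: eventually_at intro!: exI[of _ r])
    then show "\<forall>\<^sub>F w in at 0. enorm \<mu>1 Q1 (\<lambda>x. uoutf i w x - uout i 0 x) = enorm \<mu>1 Q1 (\<lambda>x. uoutf i w x - uD i x)"
    proof eventually_elim
      case (elim w)
      show ?case
      proof (rule enorm_cong[OF Q1_open])
        show "H1v Q1 (\<lambda>x. uoutf i w x - uout i 0 x)"
          by (rule H1v_diff[OF Q1_open HQ1_H1v[OF lim0[OF elim]] coeff_H1v(1)[OF coeff]])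
        show "AE x in lebesgue. x \<in> Q1 \<longrightarrow> uoutf i w x - uout i 0 x = uoutf i w x - uD i x"
          using out_D[of i] by eventually_elim simp
      qed
    qed
  qed
  have uDm: "(\<lambda>y. uD j y $ i) \<in> borel_measurable (lebesgue_on Q1)" for i j
  proof -
    have "HQ1 Q1 Q2 (uD j)" using darcy[of j] by (simp add: darcy_solution_def HQ1_0_def)
    then have "L2 Q1 (comp (uD j) i)" using HQ1_H1v[of "uD j"] by (simp add: H1v_def H1_def)
    then show ?thesis by (simp add: L2_def comp_def)
  qed
  have um: "(\<lambda>y. uout j 0 y $ i) \<in> borel_measurable (lebesgue_on Q1)" for i j
    using coeff_H1v(1)[OF coeff, of j 0] by (simp add: H1v_def H1_def L2_def comp_def)
  have KD: "KD i j = integral\<^sup>L (lebesgue_on Q1) (\<lambda>y. uout j 0 y $ i)" for i j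
    unfolding KD_def
  proof (rule integral_cong_AE[OF uDm um])
    show "AE y in lebesgue_on Q1. uD j y $ i = uout j 0 y $ i"
      unfolding AE_on[OF open_leb[OF Q1_open]] using out_D[of j] by eventually_elim simp
  qed
  define A where "A i = enorm \<mu>1 Q2 (uin i 1)" for i
  define B where "B i = A i + E1 * enorm \<mu>1 Q1 (uout i 0)" for i
  have A0: "A i \<ge> 0" for i
    unfolding A_def using aform_diag(4)[OF coeff_H1v(2)[OF coeff, of i 0] mu] by simp
  have B0: "B i \<ge> 0" for i
    unfolding B_def using A0[of i] aform_diag(4)[OF coeff_H1v(1)[OF coeff, of i 0] mu] E1_ge by simp
  have diff: "cmod (K z i j - KD i j) \<le> B i * (A j / (cmod z - E1\<^sup>2))"
    if "z \<notin> neg_axis" "E1\<^sup>2 < cmod z" for z i j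
    using permeability_difference[OF coeff coeff perm[OF that(1)] E1 that(2)] unfolding K_def KD A_def B_def .
  \<comment> \<open>The sum over all pairs of indices bounds each B_i A_j, so one constant serves
    all entries and all w.\<close>
  define C where "C = (\<Sum>i\<in>UNIV. \<Sum>j\<in>UNIV. B i * A j)"
  have C: "B i * A j \<le> C" for i j
  proof -
    have "B i * A j \<le> (\<Sum>j\<in>UNIV. B i * A j)"
      using A0 B0 by (intro member_le_sum) auto
    also have "\<dots> \<le> C" unfolding C_def
      using A0 B0 by (intro member_le_sum[of i UNIV "\<lambda>i. \<Sum>j\<in>UNIV. B i * A j"] sum_nonneg) auto
    finally show ?thesis .
  qed
  have rate: "cmod (K (1 / w) i j - KD i j) \<le> C * (2 * E1\<^sup>2 * cmod w) / (1 - 2 * E1\<^sup>2 * cmod w)"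
    if w: "w \<noteq> 0" "cmod w < 1 / (2 * E1\<^sup>2)" "1 / w \<notin> neg_axis" for w i j
  proof -
    have E2: "E1\<^sup>2 \<ge> 1" using E1_ge by simp
    have "0 < 2 * E1\<^sup>2" using E2 by linarith
    then have "cmod w * (2 * E1\<^sup>2) < 1" using w(2) by (simp only: pos_less_divide_eq)
    then have w2: "2 * E1\<^sup>2 * cmod w < 1" by (simp only: mult.commute)
    have le: "1 * cmod w \<le> E1\<^sup>2 * cmod w" using E2 by (rule mult_right_mono) simp
    have le2: "cmod w \<le> 2 * E1\<^sup>2 * cmod w" and le3: "1 - 2 * E1\<^sup>2 * cmod w \<le> 1 - E1\<^sup>2 * cmod w"
      using le norm_ge_zero[of w] by linarith+
    have w3: "E1\<^sup>2 * cmod w < 1" using w2 le norm_ge_zero[of w] by linarith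
    have big: "E1\<^sup>2 < cmod (1 / w)" using w(1) w3 by (simp add: norm_divide field_simps)
    have "cmod (K (1 / w) i j - KD i j) \<le> (B i * A j) * (1 / (cmod (1 / w) - E1\<^sup>2))"
      using diff[OF w(3) big, of i j] by simp
    also have "1 / (cmod (1 / w) - E1\<^sup>2) = cmod w / (1 - E1\<^sup>2 * cmod w)"
      using w(1) by (simp add: norm_divide divide_simps)
    \<comment> \<open>By E1^2 >= 1 the numerator grows from |w| to 2 E1^2 |w| while the denominator
      shrinks and stays positive.\<close>
    also have "(B i * A j) * \<dots> \<le> C * ((2 * E1\<^sup>2 * cmod w) / (1 - 2 * E1\<^sup>2 * cmod w))"
    proof (intro mult_mono C frac_le)
      show "C \<ge> 0" using C[of i j] A0[of j] B0[of i] by (meson mult_nonneg_nonneg order_trans)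
    qed (use w2 w3 le2 le3 in auto)
    finally show ?thesis by simp
  qed
  have lim_K: "((\<lambda>z. K z i j) \<longlongrightarrow> KD i j) (inf at_infinity (principal (- neg_axis)))" for i j
  proof -
    \<comment> \<open>The fields \<open>usol\<close> are specified off the half-line (-\<infinity>,
      0], so the limit is taken along its complement; there \<open>diff\<close> applies as soon as
      |z| >= E1^2 + 1.\<close>
    let ?F = "inf at_infinity (principal (- neg_axis))"
    have "filterlim (\<lambda>z::complex. - E1\<^sup>2 + cmod z) at_top at_infinity"
      by (rule filterlim_tendsto_add_at_top[OF tendsto_const filterlim_norm_at_top])
    then have "((\<lambda>z. (B i * A j) / (- E1\<^sup>2 + cmod z)) \<longlongrightarrow> 0) at_infinity"
      by (intro tendsto_divide_0[OF tendsto_const] filterlim_at_top_imp_at_infinity)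
    then have g: "((\<lambda>z. (B i * A j) / (- E1\<^sup>2 + cmod z)) \<longlongrightarrow> 0) ?F"
      by (rule tendsto_mono[rotated]) simp
    have "\<forall>\<^sub>F z in ?F. norm (K z i j - KD i j) \<le> (B i * A j) / (- E1\<^sup>2 + cmod z)"
      unfolding eventually_inf_principal eventually_at_infinity
      by (rule exI[of _ "E1\<^sup>2 + 1"]) (use diff[of _ i j] in auto)
    then have "((\<lambda>z. K z i j - KD i j) \<longlongrightarrow> 0) ?F" by (rule Lim_null_comparison[OF _ g])
    then show ?thesis by (rule Lim_null[THEN iffD2])
  qed
  show ?thesis using in_0 out_0 out_lim rate lim_K by blast
qed

end
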